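(* Let $G=(U,W,E)_c$ be an $n$-vertex graph in $\mathcal{X}^*$. Then for every sufficiently small $\Lambda>0$ there exist $\Delta' \in (0, 1/3)$ and a UDG-representation $g$ of $G$ with the following properties: (1) $g(U) \subseteq D_1$ and $g(W) \subseteq D_2$, where $D_1=[0, \Delta'] \times [-\Lambda,\Lambda]$ and $D_2=[0,\Delta'] \times [1-\Lambda, 1+\Lambda]$. (2) For every $u \in U$ and $w \in W$, either $\delta(g(u), g(w))=1$ or $|\delta(g(u), g(w))-1| \geq q''\Lambda$, where $q''=\frac{1}{64^4 \cdot 200\, n^2}$.
   Context: All graphs are finite and simple. $\delta$ denotes Euclidean distance in $\mathbb{R}^2$. A UDG-representation of a graph $G=(V,E)$ is a function $g:V\to\mathbb{R}^2$ such that for distinct $u,v\in V$, $uv\in E$ if and only if $\delta(g(u),g(v))\le 1$. $(U,W,E)$ denotes a bipartite graph with fixed partition of the vertex set into independent sets $U,W$ and edge set $E$; $(U,W,E)_c$ denotes the co-bipartite graph with vertex set $U\cup W$ in which $U$ and $W$ are cliques and $E$ is the set of edges between $U$ and $W$. For $G=(U,W,E)$, $G^*=(U,W,E)_c$. The class $\mathcal{X}$ consists of all graphs (necessarily bipartite) containing none of the following graphs as an induced subgraph: the cycles $C_n$ for $n\ge 3$, $n\neq 6$; the tree $S_{3,3,3}$ (one centre vertex with three attached disjoint paths of length 3); the graph $C_6^{+3c}$ ($C_6$ with one pendant vertex attached to each of three consecutive vertices of the cycle); the graph $C_6^{+3nc}$ ($C_6$ with one pendant vertex attached to each of three pairwise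 non-adjacent vertices of the cycle); the graph $C_6^{+2l2}$ ($C_6$ with a path of length 2 attached at each of two adjacent vertices of the cycle, i.e. with $C_6=c_1\dots c_6$, new vertices $x,x',y,y'$ and new edges $c_1x,xx',c_2y,yy'$). Finally, $\mathcal{X}^*=\{G^*: G=(U,W,E)\in\mathcal{X}\}$. *)

theory Defs
  imports "HOL-Analysis.Analysis"
begin

type_synonym 'a graph = "'a set \<times> 'a set set"

abbreviation verts :: "'a graph \<Rightarrow> 'a set" where "verts \<equiv> fst"
abbreviation edges :: "'a graph \<Rightarrow> 'a set set" where "edges \<equiv> snd"

definition simple_graph :: "'a graph \<Rightarrow> bool" where
  "simple_graph G \<longleftrightarrow> finite (verts G) \<and>
     (\<forall>e\<in>edges G. \<exists>u\<in>verts G. \<exists>v\<in>verts G. u \<noteq> v \<and> e = {u, v})"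

definition induced_subgraph :: "'a graph \<Rightarrow> 'a set \<Rightarrow> 'a graph" where
  "induced_subgraph G S = (S, {e \<in> edges G. e \<subseteq> S})"

definition graph_iso :: "'a graph \<Rightarrow> 'b graph \<Rightarrow> bool" where
  "graph_iso G H \<longleftrightarrow> (\<exists>f. bij_betw f (verts G) (verts H) \<and>
     (\<forall>u\<in>verts G. \<forall>v\<in>verts G. {u, v} \<in> edges G \<longleftrightarrow> {f u, f v} \<in> edges H))"

definition contains_induced :: "'a graph \<Rightarrow> 'b graph \<Rightarrow> bool" where
  "contains_induced G H \<longleftrightarrow> (\<exists>S\<subseteq>verts G. graph_iso H (induced_subgraph G S))"

definition cycle_graph :: "nat \<Rightarrow> nat graph" where
  "cycle_graph n = ({0..<n}, {{i, (i + 1) mod n} | i. i < n})"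

definition S333 :: "nat graph" where
  "S333 = ({0..<10},
     {{0,1}, {1,2}, {2,3},  {0,4}, {4,5}, {5,6},  {0,7}, {7,8}, {8,9}})"

definition C6_3c :: "nat graph" where
  "C6_3c = ({0..<9}, edges (cycle_graph 6) \<union> {{0,6}, {1,7}, {2,8}})"

definition C6_3nc :: "nat graph" where
  "C6_3nc = ({0..<9}, edges (cycle_graph 6) \<union> {{0,6}, {2,7}, {4,8}})"

definition C6_2l2 :: "nat graph" where
  "C6_2l2 = ({0..<10}, edges (cycle_graph 6) \<union> {{0,6}, {6,7}, {1,8}, {8,9}})"

definition class_X :: "'a graph set" where
  "class_X = {G. simple_graph G \<and>
     (\<forall>n. n \<ge> 3 \<and> n \<noteq> 6 \<longrightarrow> \<not> contains_induced G (cycle_graph n)) \<and>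
     \<not> contains_induced G S333 \<and>
     \<not> contains_induced G C6_3c \<and>
     \<not> contains_induced G C6_3nc \<and>
     \<not> contains_induced G C6_2l2}"

text \<open>A triple \<open>(U, W, E)\<close> with \<open>bipartitioned U W E\<close> is a bipartite graph with a
  fixed bipartition; \<open>bip\<close> and \<open>cobip\<close> are the graphs \<open>(U, W, E)\<close> and
  \<open>(U, W, E)\<^sub>c\<close> that it determines.\<close>

definition bipartitioned :: "'a set \<Rightarrow> 'a set \<Rightarrow> 'a set set \<Rightarrow> bool" where
  "bipartitioned U W E \<longleftrightarrow> finite U \<and> finite W \<and> U \<inter> W = {} \<and>
     E \<subseteq> {{u, w} | u w. u \<in> U \<and> w \<in> W}"

definition bip :: "'a set \<Rightarrow> 'a set \<Rightarrow> 'a set set \<Rightarrow> 'a graph" where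
  "bip U W E = (U \<union> W, E)"

definition cobip :: "'a set \<Rightarrow> 'a set \<Rightarrow> 'a set set \<Rightarrow> 'a graph" where
  "cobip U W E = (U \<union> W,
     E \<union> {{u, v} | u v. u \<in> U \<and> v \<in> U \<and> u \<noteq> v}
       \<union> {{u, v} | u v. u \<in> W \<and> v \<in> W \<and> u \<noteq> v})"

text \<open>The members of the starred class carry their fixed partition into two cliques, so
  they are recorded as triples: \<open>(U, W, E) \<in> class_X_star\<close> says that the
  co-bipartite graph \<open>cobip U W E\<close>, taken with the partition \<open>U, W\<close>, is \<open>G\<^sup>*\<close> for the
  bipartite graph \<open>G = bip U W E\<close> in the class.\<close>

definition class_X_star :: "('a set \<times> 'a set \<times> 'a set set) set" where
  "class_X_star = {(U, W, E). bipartitioned U W E \<and> bip U W E \<in> class_X}"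

text \<open>On \<open>real \<times> real\<close> the library's \<open>dist\<close> is the Euclidean distance of the plane.\<close>

definition UDG_representation :: "'a graph \<Rightarrow> ('a \<Rightarrow> real \<times> real) \<Rightarrow> bool" where
  "UDG_representation G g \<longleftrightarrow> (\<forall>u\<in>verts G. \<forall>v\<in>verts G. u \<noteq> v \<longrightarrow>
     ({u, v} \<in> edges G \<longleftrightarrow> dist (g u) (g v) \<le> 1))"

end

theory Submission imports Defs begin

text \<open>As \<open>\<Lambda> \<rightarrow> 0\<close>, a representation of the required kind is the same as a pair of functions \<open>A, h\<close> on the
  vertices with \<open>(A u - A w)\<^sup>2 \<le> h u + h w\<close> exactly for the edges between the two cliques, the
  inequality and its negation holding with a margin of order \<open>1 / n\<^sup>2\<close>. Leaves are set aside: they can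
  be put at the horizontal position of their neighbour, provided that this neighbour is high.

  The remaining graph is drawn by induction on the number of vertices. A vertex with two neighbours
  that lead on, apart from the edge by which it is attached to the rest, must lie on a hexagon, since
  there is no induced \<open>S\<^sub>3\<^sub>,\<^sub>3\<^sub>,\<^sub>3\<close>. Hexagons come in bundles of paths of length three with common ends; as
  the other three graphs are excluded, such a bundle is attached to the rest of the graph by one edge at
  each end, and because induced cycles have length six, it separates the two sides. A bundle is drawn
  with its middle vertices near one point and its two ends far to the left and to the right, so that a
  drawing of the whole is a chain of bundles, bridges and stars.\<close>

section \<open>Forbidden induced subgraphs\<close>

text \<open>With heights scaled by \<open>\<Lambda> / 12100\<close> and horizontal positions by
  \<open>sqrt (2 * \<Lambda> / 12100)\<close>, the squared distance across is 1 + 2 *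
  (\<open>\<Lambda>\<close> / 12100) * ((A u - A w)^2 - h u - h w) + O(\<open>\<Lambda>\<close>^2).
  Hence heights must stay bounded independently of \<open>n\<close>, while the horizontal extent may
  grow freely: it only lowers the threshold for \<open>\<Lambda>\<close>. So parts of a drawing are
  only shifted or mirrored. The number \<open>n\<close> enters only where many vertices share a
  place (next to a root, or in the middle of a bundle): they get distinct positions in an interval
  of length 1, with squared distances of order 1/n^2. Two heights are needed because of bridges. A
  bridge of length x between roots \<open>w\<close> and \<open>v\<close> needs x^2 below the sum of
  their heights. The vertices of height 10000 next to \<open>w\<close>, up to 1 nearer to
  \<open>v\<close>, must not see those that will be put next to \<open>v\<close>, so (x - 1)^2 must
  exceed 20000. Roots of height 12100 leave room for x = 150. A part may hang on a vertex or on an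
  edge of a hexagon. Its attachment must end up at the right of its drawing, and either kind can
  contain the other, so the induction treats both together with whole components.\<close>

locale bipartite_graph =
  fixes V :: "'a set" and adj :: "'a \<Rightarrow> 'a \<Rightarrow> bool" and side :: "'a \<Rightarrow> bool"
  assumes finite_V: "finite V"
    and adj_sym: "adj u v \<Longrightarrow> adj v u"
    and adj_V: "adj u v \<Longrightarrow> u \<in> V"
    and adj_side: "adj u v \<Longrightarrow> side u \<noteq> side v"
begin

lemma adj_V2: "adj u v \<Longrightarrow> v \<in> V"
  using adj_V adj_sym by blast

lemma adj_commute: "adj u v \<longleftrightarrow> adj v u"
  using adj_sym by blast

lemma adj_side_iff: "adj u v \<Longrightarrow> side v \<longleftrightarrow> \<not> side u"
  using adj_side by blast

lemma nadj_side: "side u = side v \<Longrightarrow> \<not> adj u v"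
  using adj_side by blast

text \<open>Nothing forces \<open>f\<close> into \<open>V\<close>: adjacent vertices lie in
  \<open>V\<close> anyway, and none of the excluded graphs has an isolated vertex.\<close>

definition embeds :: "nat graph \<Rightarrow> bool" where
  "embeds H \<longleftrightarrow> (\<exists>f. inj_on f (verts H) \<and>
     (\<forall>i\<in>verts H. \<forall>j\<in>verts H. adj (f i) (f j) \<longleftrightarrow> {i, j} \<in> edges H))"

lemma embeds_nth:
  assumes "distinct xs" and "verts H = {0..<length xs}"
    and "\<And>i. {i} \<notin> edges H"
    and "\<forall>j<length xs. \<forall>i<j. adj (xs ! i) (xs ! j) \<longleftrightarrow> {i, j} \<in> edges H"
  shows "embeds H"
  unfolding embeds_def
proof (intro exI[of _ "(!) xs"] conjI ballI)
  show "inj_on ((!) xs) (verts H)"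
    using assms(1,2) by (simp add: inj_on_def nth_eq_iff_index_eq)
  fix i j assume "i \<in> verts H" "j \<in> verts H"
  then have ij: "i < length xs" "j < length xs" using assms(2) by auto
  consider "i < j" | "i = j" | "j < i" by linarith
  then show "adj (xs ! i) (xs ! j) \<longleftrightarrow> {i, j} \<in> edges H"
  proof cases
    case 1 then show ?thesis using assms(4) ij by blast
  next
    case 2 then show ?thesis using assms(3)[of i] nadj_side by simp
  next
    case 3 then show ?thesis using assms(4) ij adj_commute by (metis insert_commute)
  qed
qed

text \<open>\<open>induced_rows es 0 xs\<close> says that the edges induced by \<open>xs\<close> are those listed in \<open>es\<close>; the
  recursion lets the simplifier run through all pairs of a concrete list.\<close>

fun induced_row :: "(nat \<times> nat) list \<Rightarrow> nat \<Rightarrow> nat \<Rightarrow> 'a \<Rightarrow> 'a list \<Rightarrow> bool" where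
  "induced_row es i j x [] = True"
| "induced_row es i j x (y # ys) =
     ((adj x y \<longleftrightarrow> (i, j) \<in> set es) \<and> induced_row es i (j + 1) x ys)"

fun induced_rows :: "(nat \<times> nat) list \<Rightarrow> nat \<Rightarrow> 'a list \<Rightarrow> bool" where
  "induced_rows es i [] = True"
| "induced_rows es i (x # xs) = (induced_row es i (i + 1) x xs \<and> induced_rows es (i + 1) xs)"

lemma induced_row_nth:
  "\<lbrakk>induced_row es i j x ys; k < length ys\<rbrakk> \<Longrightarrow> adj x (ys ! k) \<longleftrightarrow> (i, j + k) \<in> set es"
proof (induction es i j x ys arbitrary: k rule: induced_row.induct)
  case (2 es i j x y ys)
  then show ?case by (cases k) auto
qed simp

lemma induced_rows_nth:
  "\<lbrakk>induced_rows es i xs; a < b; b < length xs\<rbrakk>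
    \<Longrightarrow> adj (xs ! a) (xs ! b) \<longleftrightarrow> (i + a, i + b) \<in> set es"
proof (induction es i xs arbitrary: a b rule: induced_rows.induct)
  case (2 es i x xs)
  obtain b' where b: "b = Suc b'" using 2(3) by (cases b) auto
  show ?case
  proof (cases a)
    case 0
    then show ?thesis using 2(2,4) b induced_row_nth[of es i "i + 1" x xs b'] by simp
  next
    case (Suc a')
    then show ?thesis using 2(1)[of a' b'] 2(2-4) b by simp
  qed
qed simp

lemma embeds_list:
  assumes "distinct xs" and "verts H = {0..<length xs}"
    and es: "edges H = (\<lambda>(i, j). {i, j}) ` set es" "\<forall>(i, j)\<in>set es. i < j"
    and a: "induced_rows es 0 xs"
  shows "embeds H"
proof (rule embeds_nth[OF assms(1,2)])
  show "{i} \<notin> edges H" for i using es by auto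
  have "{i, j} \<in> edges H \<longleftrightarrow> (i, j) \<in> set es" if "i < j" for i j
  proof
    assume "{i, j} \<in> edges H"
    then obtain p q where "(p, q) \<in> set es" "{i, j} = {p, q}" using es(1) by auto
    then show "(i, j) \<in> set es" using es(2) that by (auto simp: doubleton_eq_iff)
  qed (auto simp: es(1))
  then show "\<forall>j<length xs. \<forall>i<j. adj (xs ! i) (xs ! j) \<longleftrightarrow> {i, j} \<in> edges H"
    using induced_rows_nth[OF a] by simp
qed

fun induced_path :: "'a list \<Rightarrow> bool" where
  "induced_path [] = True"
| "induced_path [x] = True"
| "induced_path (x # y # ys) =
     (adj x y \<and> (\<forall>z\<in>set ys. \<not> adj x z) \<and> x \<notin> set (y # ys) \<and> induced_path (y # ys))"

lemma induced_path_distinct: "induced_path xs \<Longrightarrow> distinct xs"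
  by (induction xs rule: induced_path.induct) auto

lemma induced_path_tl: "induced_path (x # xs) \<Longrightarrow> induced_path xs"
  by (cases xs) auto

lemma induced_path_suffix: "induced_path (xs @ ys) \<Longrightarrow> induced_path ys"
  by (induction xs) (auto dest: induced_path_tl)

lemma induced_path_prefix: "induced_path (xs @ ys) \<Longrightarrow> induced_path xs"
proof (induction xs)
  case (Cons x xs)
  then show ?case by (cases xs) (auto dest: induced_path_tl)
qed simp

lemma induced_path_nth:
  "\<lbrakk>induced_path xs; i < j; j < length xs\<rbrakk> \<Longrightarrow> adj (xs ! i) (xs ! j) \<longleftrightarrow> j = Suc i"
proof (induction xs arbitrary: i j rule: induced_path.induct)
  case (3 x y ys)
  show ?case
  proof (cases i)
    case 0
    obtain j' where j: "j = Suc j'" using 3(3) by (cases j) auto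
    show ?thesis
    proof (cases j')
      case 0 then show ?thesis using 3(2) \<open>i = 0\<close> j by simp
    next
      case (Suc j'')
      then have "ys ! j'' \<in> set ys" using 3(4) j by simp
      then show ?thesis using 3(2) \<open>i = 0\<close> j Suc by simp
    qed
  next
    case (Suc i')
    then show ?thesis using 3 by (cases j) auto
  qed
qed auto

end

lemma edge_cycle_graph:
  assumes "i < j" "j < n"
  shows "{i, j} \<in> edges (cycle_graph n) \<longleftrightarrow> j = Suc i \<or> (i = 0 \<and> Suc j = n)"
proof
  assume "{i, j} \<in> edges (cycle_graph n)"
  then obtain k where k: "k < n" "{i, j} = {k, Suc k mod n}"
    by (auto simp: cycle_graph_def)
  have "Suc k mod n = (if Suc k = n then 0 else Suc k)" using k(1) by auto
  with k assms show "j = Suc i \<or> (i = 0 \<and> Suc j = n)"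
    by (auto simp: doubleton_eq_iff split: if_splits)
next
  assume "j = Suc i \<or> (i = 0 \<and> Suc j = n)"
  then have "{i, j} = {i, (i + 1) mod n} \<or> {i, j} = {j, (j + 1) mod n}"
    using assms by auto
  moreover have "i < n" using assms by simp
  ultimately show "{i, j} \<in> edges (cycle_graph n)"
    using assms(2) unfolding cycle_graph_def snd_conv by blast
qed

lemma loop_cycle_graph: "n \<ge> 2 \<Longrightarrow> {i} \<notin> edges (cycle_graph n)"
proof
  assume n: "n \<ge> 2" and "{i} \<in> edges (cycle_graph n)"
  then obtain k where k: "k < n" "{i} = {k, Suc k mod n}"
    by (auto simp: cycle_graph_def)
  moreover have "Suc k mod n = (if Suc k = n then 0 else Suc k)" using k(1) by auto
  ultimately show False using n by (auto split: if_splits)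
qed

lemma edges_cycle_graph_6:
  "edges (cycle_graph 6) = (\<lambda>(i, j). {i, j}) ` set [(0,1), (1,2), (2,3), (3,4), (4,5), (0,5)]"
proof -
  have "edges (cycle_graph 6) = (\<lambda>i. {i, (i + 1) mod 6}) ` {..<6}"
    by (auto simp: cycle_graph_def)
  also have "\<dots> = (\<lambda>i. {i, (i + 1) mod 6}) ` {0,1,2,3,4,5}"
    by (simp add: lessThan_nat_numeral lessThan_Suc insert_commute)
  finally show ?thesis by (simp add: insert_commute flip: numeral_2_eq_2)
qed

locale X_graph = bipartite_graph +
  assumes no_cycle: "\<And>n. n \<ge> 3 \<Longrightarrow> n \<noteq> 6 \<Longrightarrow> \<not> embeds (cycle_graph n)"
    and no_S333: "\<not> embeds S333"
    and no_C6_3c: "\<not> embeds C6_3c"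
    and no_C6_3nc: "\<not> embeds C6_3nc"
    and no_C6_2l2: "\<not> embeds C6_2l2"
begin

text \<open>Adding \<open>z\<close> turns the path into an induced cycle with one more vertex, and
  six is the only length that is allowed. The excluded cycles enter the proof only here.\<close>

lemma induced_path_close:
  assumes ip: "induced_path xs" and len: "length xs \<ge> 2"
    and z: "z \<notin> set xs" "adj z (hd xs)" "adj z (last xs)"
    and other: "\<And>y. y \<in> set xs \<Longrightarrow> adj z y \<Longrightarrow> y = hd xs \<or> y = last xs"
  shows "length xs = 5"
proof (rule ccontr)
  assume n: "length xs \<noteq> 5"
  let ?n = "Suc (length xs)"
  have d: "distinct xs" using ip by (rule induced_path_distinct)
  have "embeds (cycle_graph ?n)"
  proof (rule embeds_nth[of "z # xs"])
    show "distinct (z # xs)" using d z(1) by simp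
    show "verts (cycle_graph ?n) = {0..<length (z # xs)}" by (simp add: cycle_graph_def)
    show "{i} \<notin> edges (cycle_graph ?n)" for i using len by (intro loop_cycle_graph) simp
    show "\<forall>j<length (z # xs). \<forall>i<j. adj ((z # xs) ! i) ((z # xs) ! j) \<longleftrightarrow>
        {i, j} \<in> edges (cycle_graph ?n)"
    proof (intro allI impI)
      fix i j assume ij: "j < length (z # xs)" "i < j"
      then obtain j' where j: "j = Suc j'" "j' < length xs" by (cases j) auto
      have e: "{i, j} \<in> edges (cycle_graph ?n) \<longleftrightarrow> j = Suc i \<or> (i = 0 \<and> Suc j = ?n)"
        using ij by (intro edge_cycle_graph) auto
      show "adj ((z # xs) ! i) ((z # xs) ! j) \<longleftrightarrow> {i, j} \<in> edges (cycle_graph ?n)"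
      proof (cases i)
        case 0
        have ne: "xs \<noteq> []" using len by auto
        have "adj z (xs ! j') \<longleftrightarrow> j' = 0 \<or> j' = length xs - 1"
        proof
          assume "adj z (xs ! j')"
          then have "xs ! j' = xs ! 0 \<or> xs ! j' = xs ! (length xs - 1)"
            using other[of "xs ! j'"] j(2) ne by (simp add: hd_conv_nth last_conv_nth)
          then show "j' = 0 \<or> j' = length xs - 1"
            using d j(2) ne by (auto simp: nth_eq_iff_index_eq)
        next
          assume "j' = 0 \<or> j' = length xs - 1"
          then show "adj z (xs ! j')" using z ne by (auto simp: hd_conv_nth last_conv_nth)
        qed
        then show ?thesis using 0 j e len by auto
      next
        case (Suc i')
        then show ?thesis using e j ij induced_path_nth[OF ip, of i' j'] by auto
      qed
    qed
  qed
  then show False using no_cycle[of ?n] len n by simp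
qed

text \<open>Otherwise \<open>a\<close> would close the path \<open>b\<close>, \<open>e\<close>,
  \<open>d\<close> to an induced cycle of length four. Together with the sides, this uniqueness of
  common neighbours gives most non-adjacencies needed below.\<close>

lemma C4_free:
  assumes "adj a b" "adj b e" "adj e d" "adj d a" "a \<noteq> e"
  shows "b = d"
proof (rule ccontr)
  assume "b \<noteq> d"
  have s: "side b = (\<not> side a)" "side e = side a" "side d = (\<not> side a)"
    using assms(1-3)[THEN adj_side_iff] by simp_all
  then have ip: "induced_path [b, e, d]"
    using assms \<open>b \<noteq> d\<close> by (auto simp: nadj_side)
  have "a \<notin> set [b, e, d]" using s assms(5) by auto
  moreover have "\<not> adj a e" using s by (simp add: nadj_side)
  ultimately have "length [b, e, d] = 5"
    using induced_path_close[OF ip, of a] assms(1) adj_sym[OF assms(4)] by auto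
  then show False by simp
qed

lemma no_C4: "\<lbrakk>adj a b; adj b e; adj e d; a \<noteq> e; b \<noteq> d\<rbrakk> \<Longrightarrow> \<not> adj a d"
  using C4_free[of a b e d] adj_sym[of a d] by blast

text \<open>The sides and the absence of a \<open>C_4\<close> rule out every other additional edge.
  Coinciding ends, such as \<open>z1 = z2\<close>, also appear in the conclusion as an edge, here
  \<open>adj y1 z2\<close>.\<close>

lemma S333_free:
  assumes x: "adj v x1" "adj v x2" "adj v x3" "x1 \<noteq> x2" "x1 \<noteq> x3" "x2 \<noteq> x3"
    and y: "adj x1 y1" "adj x2 y2" "adj x3 y3" "y1 \<noteq> v" "y2 \<noteq> v" "y3 \<noteq> v"
    and z: "adj y1 z1" "adj y2 z2" "adj y3 z3" "z1 \<noteq> x1" "z2 \<noteq> x2" "z3 \<noteq> x3"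
  shows "adj y1 z2 \<or> adj y1 z3 \<or> adj y2 z1 \<or> adj y2 z3 \<or> adj y3 z1 \<or> adj y3 z2"
proof (rule ccontr)
  assume na: "\<not> ?thesis"
  have vz: "\<not> adj v z" if "adj v x" "adj x y" "y \<noteq> v" "adj y z" "z \<noteq> x" for x y z
    using C4_free[of v x y z] that adj_sym[of v z] by auto
  have xy: "\<not> adj x y" if "adj v x" "adj v x'" "x \<noteq> x'" "adj x' y" "y \<noteq> v" for x x' y
    using C4_free[of v x y x'] that adj_sym[of v x'] adj_sym[of x' y] by auto
  have n1: "\<not> adj v z1" "\<not> adj v z2" "\<not> adj v z3"
    using vz[OF x(1) y(1) y(4) z(1) z(4)] vz[OF x(2) y(2) y(5) z(2) z(5)]
      vz[OF x(3) y(3) y(6) z(3) z(6)] by simp_all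
  have n2: "\<not> adj x1 y2" "\<not> adj x1 y3" "\<not> adj x2 y1" "\<not> adj x2 y3" "\<not> adj x3 y1" "\<not> adj x3 y2"
    using xy[OF x(1,2,4) y(2,5)] xy[OF x(1,3,5) y(3,6)] xy[OF x(2,1) x(4)[symmetric] y(1,4)]
      xy[OF x(2,3,6) y(3,6)] xy[OF x(3,1) x(5)[symmetric] y(1,4)]
      xy[OF x(3,2) x(6)[symmetric] y(2,5)] by simp_all
  have s: "side x1 = (\<not> side v)" "side x2 = (\<not> side v)" "side x3 = (\<not> side v)"
     "side y1 = side v" "side y2 = side v" "side y3 = side v"
     "side z1 = (\<not> side v)" "side z2 = (\<not> side v)" "side z3 = (\<not> side v)"
    using x(1-3)[THEN adj_side_iff] y(1-3)[THEN adj_side_iff] z(1-3)[THEN adj_side_iff] by simp_all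
  have ne: "y1 \<noteq> y2" "y1 \<noteq> y3" "y2 \<noteq> y3" "z1 \<noteq> z2" "z1 \<noteq> z3" "z2 \<noteq> z3"
     "x1 \<noteq> z2" "x1 \<noteq> z3" "x2 \<noteq> z1" "x2 \<noteq> z3" "x3 \<noteq> z1" "x3 \<noteq> z2"
    using n2 na y(1-3) z(1-3) z(1-3)[THEN adj_sym] by auto
  let ?xs = "[v, x1, y1, z1, x2, y2, z2, x3, y3, z3]"
  have "embeds S333"
  proof (rule embeds_list[of ?xs _ "[(0,1), (1,2), (2,3), (0,4), (4,5), (5,6), (0,7), (7,8), (8,9)]"])
    show "distinct ?xs" using ne x y z s by auto
    show "verts S333 = {0..<length ?xs}" by (simp add: S333_def numeral_eq_Suc)
    show "edges S333 = (\<lambda>(i, j). {i, j}) ` set [(0,1), (1,2), (2,3), (0,4), (4,5), (5,6), (0,7), (7,8), (8,9)]"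
      by (simp add: S333_def insert_commute)
    show "\<forall>(i, j)\<in>set [(0,1), (1,2), (2,3), (0,4), (4,5), (5,6), (0,7), (7,8), (8,9)]. (i::nat) < j" by simp
    show "induced_rows [(0,1), (1,2), (2,3), (0,4), (4,5), (5,6), (0,7), (7,8), (8,9)] 0 ?xs"
      using n1 n2 x(1-3) y(1-3) z(1-3) s na
      by (simp add: nadj_side adj_commute)
  qed
  then show False using no_S333 by simp
qed

section \<open>Hexagons and their excluded extensions\<close>

definition hexagon :: "'a \<Rightarrow> 'a \<Rightarrow> 'a \<Rightarrow> 'a \<Rightarrow> 'a \<Rightarrow> 'a \<Rightarrow> bool" where
  "hexagon c1 c2 c3 c4 c5 c6 \<longleftrightarrow> adj c1 c2 \<and> adj c2 c3 \<and> adj c3 c4 \<and> adj c4 c5 \<and> adj c5 c6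
     \<and> adj c6 c1 \<and> c1 \<noteq> c3 \<and> c1 \<noteq> c5 \<and> c3 \<noteq> c5 \<and> c2 \<noteq> c4 \<and> c2 \<noteq> c6 \<and> c4 \<noteq> c6"

text \<open>In use, \<open>x\<close> and \<open>y\<close> are the two neighbours of \<open>v\<close>
  on a hexagon, and the third neighbour is a pendant of the hexagon.\<close>

definition branching :: "'a \<Rightarrow> 'a \<Rightarrow> 'a \<Rightarrow> bool" where
  "branching v x y \<longleftrightarrow> (\<exists>z. adj v z \<and> z \<noteq> x \<and> z \<noteq> y)"

lemma hexagonD:
  assumes "hexagon a b c d e f"
  shows "adj a b" "adj b c" "adj c d" "adj d e" "adj e f" "adj f a"
    "a \<noteq> c" "a \<noteq> e" "c \<noteq> e" "b \<noteq> d" "b \<noteq> f" "d \<noteq> f"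
  using assms by (simp_all add: hexagon_def)

lemma hexagon_rotate: "hexagon a b c d e f \<Longrightarrow> hexagon b c d e f a"
  by (auto simp: hexagon_def)

lemma hexagon_reflect: "hexagon a b c d e f \<Longrightarrow> hexagon b a f e d c"
  by (auto simp: hexagon_def adj_commute)

lemma hexagon_side:
  assumes "hexagon a b c d e f"
  shows "side b = (\<not> side a)" "side c = side a" "side d = (\<not> side a)" "side e = side a"
    "side f = (\<not> side a)"
  using hexagonD(1-5)[OF assms, THEN adj_side_iff] by simp_all

text \<open>A long diagonal would cut off a \<open>C_4\<close>, and the other chords join vertices
  of the same side. So a \<open>hexagon\<close> is induced although its definition does not ask for
  it.\<close>

lemma hexagon_chord:
  assumes "hexagon a b c d e f"
  shows "\<not> adj a d" "\<not> adj b e" "\<not> adj c f"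
  using no_C4[OF hexagonD(1,2,3,7,10)[OF assms]] no_C4[OF hexagonD(2,3,4,10,9)[OF assms]]
    no_C4[OF hexagonD(3,4,5,9,12)[OF assms]] by simp_all

lemma hexagon_pendant:
  assumes h: "hexagon a b c d e f" and x: "adj a x" "x \<noteq> b" "x \<noteq> f"
  shows "x \<noteq> d" "\<not> adj x c" "\<not> adj x e" "side x = (\<not> side a)"
  using hexagon_chord(1)[OF h] x(1)
    no_C4[OF adj_sym[OF x(1)] hexagonD(1,2)[OF h] x(2) hexagonD(7)[OF h]]
    no_C4[OF adj_sym[OF x(1)] adj_sym[OF hexagonD(6)[OF h]] adj_sym[OF hexagonD(5)[OF h]]
      x(3) hexagonD(8)[OF h]] adj_side_iff[OF x(1)]
  by auto

text \<open>Any choice of the three pendants works: a coincidence or an edge among them, or a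
  further edge to the hexagon, would create a \<open>C_4\<close> or contradict the sides. So it is
  enough to know which vertices branch.\<close>

lemma C6_3c_free:
  assumes h: "hexagon a b c d e f"
    and "branching a f b" "branching b a c" "branching c b d"
  shows False
proof -
  obtain x y z where x: "adj a x" "x \<noteq> b" "x \<noteq> f" and y: "adj b y" "y \<noteq> c" "y \<noteq> a"
    and z: "adj c z" "z \<noteq> d" "z \<noteq> b"
    using assms unfolding branching_def by metis
  note h2 = hexagon_rotate[OF h] and h3 = hexagon_rotate[OF hexagon_rotate[OF h]]
  note s = hexagon_side[OF h] hexagon_pendant(4)[OF h x] hexagon_pendant(4)[OF h2 y]
    hexagon_pendant(4)[OF h3 z]
  note p = hexagon_pendant(1-3)[OF h x] hexagon_pendant(1-3)[OF h2 y] hexagon_pendant(1-3)[OF h3 z]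
  have n: "\<not> adj x y" "\<not> adj y z" "x \<noteq> z"
    using no_C4[OF adj_sym[OF x(1)] hexagonD(1)[OF h] y(1) x(2) y(3)[symmetric]]
      no_C4[OF adj_sym[OF y(1)] hexagonD(2)[OF h] z(1) y(2) z(3)[symmetric]] p(2) adj_sym[OF z(1)]
    by auto
  let ?xs = "[a, b, c, d, e, f, x, y, z]"
  have "embeds C6_3c"
  proof (rule embeds_list[of ?xs _ "[(0,1), (1,2), (2,3), (3,4), (4,5), (0,5), (0,6), (1,7), (2,8)]"])
    show "distinct ?xs" using h s n x y z p by (auto simp: hexagon_def)
    show "verts C6_3c = {0..<length ?xs}" by (simp add: C6_3c_def numeral_eq_Suc)
    show "edges C6_3c = (\<lambda>(i, j). {i, j}) ` set [(0,1), (1,2), (2,3), (3,4), (4,5), (0,5), (0,6), (1,7), (2,8)]"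
      by (simp add: C6_3c_def edges_cycle_graph_6 insert_commute)
    show "\<forall>(i, j)\<in>set [(0,1), (1,2), (2,3), (3,4), (4,5), (0,5), (0,6), (1,7), (2,8)]. (i::nat) < j" by simp
    show "induced_rows [(0,1), (1,2), (2,3), (3,4), (4,5), (0,5), (0,6), (1,7), (2,8)] 0 ?xs"
      using hexagonD(1-6)[OF h] s n x(1) y(1) z(1) p hexagon_chord[OF h]
      by (simp add: nadj_side adj_commute)
  qed
  then show False using no_C6_3c by simp
qed

lemma C6_3nc_free:
  assumes h: "hexagon a b c d e f"
    and "branching a f b" "branching c b d" "branching e d f"
  shows False
proof -
  obtain x y z where x: "adj a x" "x \<noteq> b" "x \<noteq> f" and y: "adj c y" "y \<noteq> d" "y \<noteq> b"
    and z: "adj e z" "z \<noteq> f" "z \<noteq> d"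
    using assms unfolding branching_def by metis
  note h3 = hexagon_rotate[OF hexagon_rotate[OF h]]
  note h5 = hexagon_rotate[OF hexagon_rotate[OF h3]]
  note s = hexagon_side[OF h] hexagon_pendant(4)[OF h x] hexagon_pendant(4)[OF h3 y]
    hexagon_pendant(4)[OF h5 z]
  note p = hexagon_pendant(1-3)[OF h x] hexagon_pendant(1-3)[OF h3 y] hexagon_pendant(1-3)[OF h5 z]
  have n: "x \<noteq> y" "y \<noteq> z" "x \<noteq> z"
    using p(2,3,5,6) adj_sym[OF y(1)] adj_sym[OF z(1)] by auto
  let ?xs = "[a, b, c, d, e, f, x, y, z]"
  have "embeds C6_3nc"
  proof (rule embeds_list[of ?xs _ "[(0,1), (1,2), (2,3), (3,4), (4,5), (0,5), (0,6), (2,7), (4,8)]"])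
    show "distinct ?xs" using h s n x y z p by (auto simp: hexagon_def)
    show "verts C6_3nc = {0..<length ?xs}" by (simp add: C6_3nc_def numeral_eq_Suc)
    show "edges C6_3nc = (\<lambda>(i, j). {i, j}) ` set [(0,1), (1,2), (2,3), (3,4), (4,5), (0,5), (0,6), (2,7), (4,8)]"
      by (simp add: C6_3nc_def edges_cycle_graph_6 insert_commute)
    show "\<forall>(i, j)\<in>set [(0,1), (1,2), (2,3), (3,4), (4,5), (0,5), (0,6), (2,7), (4,8)]. (i::nat) < j" by simp
    show "induced_rows [(0,1), (1,2), (2,3), (3,4), (4,5), (0,5), (0,6), (2,7), (4,8)] 0 ?xs"
      using hexagonD(1-6)[OF h] s n x(1) y(1) z(1) p hexagon_chord[OF h]
      by (simp add: nadj_side adj_commute)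
  qed
  then show False using no_C6_3nc by simp
qed

text \<open>The three edges in the conclusion are the only ones between the two tails and the
  hexagon, or between the tails, that the sides and the absence of a \<open>C_4\<close> leave
  open.\<close>

lemma C6_2l2_free:
  assumes h: "hexagon a b c d e f"
    and x: "adj a x" "x \<noteq> b" "x \<noteq> f" "adj x x'" "x' \<noteq> a"
    and y: "adj b y" "y \<noteq> c" "y \<noteq> a" "adj y y'" "y' \<noteq> b"
  shows "adj x' d \<or> adj y' e \<or> adj x' y'"
proof (rule ccontr)
  assume na: "\<not> ?thesis"
  note h2 = hexagon_rotate[OF h]
  note s = hexagon_side[OF h] hexagon_pendant(4)[OF h x(1-3)] hexagon_pendant(4)[OF h2 y(1-3)]
  note p = hexagon_pendant(1-3)[OF h x(1-3)] hexagon_pendant(1-3)[OF h2 y(1-3)]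
  have s': "side x' = side a" "side y' = (\<not> side a)" using adj_side_iff[OF x(4)] adj_side_iff[OF y(4)] s by auto
  have n: "\<not> adj x y" "\<not> adj x' b" "\<not> adj x' f" "\<not> adj y' a" "\<not> adj y' c"
    using no_C4[OF adj_sym[OF x(1)] hexagonD(1)[OF h] y(1) x(2) y(3)[symmetric]]
      no_C4[OF adj_sym[OF x(4)] adj_sym[OF x(1)] hexagonD(1)[OF h] x(5,2)]
      no_C4[OF adj_sym[OF x(4)] adj_sym[OF x(1)] adj_sym[OF hexagonD(6)[OF h]] x(5,3)]
      no_C4[OF adj_sym[OF y(4)] adj_sym[OF y(1)] adj_sym[OF hexagonD(1)[OF h]] y(5,3)]
      no_C4[OF adj_sym[OF y(4)] adj_sym[OF y(1)] hexagonD(2)[OF h] y(5,2)]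
    by simp_all
  have ne: "x' \<noteq> c" "x' \<noteq> e" "x' \<noteq> y" "y' \<noteq> d" "y' \<noteq> f" "y' \<noteq> x"
    using p n(1) x(4) y(4) adj_sym[OF y(4)] by auto
  let ?xs = "[a, b, c, d, e, f, x, x', y, y']"
  have "embeds C6_2l2"
  proof (rule embeds_list[of ?xs _ "[(0,1), (1,2), (2,3), (3,4), (4,5), (0,5), (0,6), (6,7), (1,8), (8,9)]"])
    show "distinct ?xs" using h s s' n ne x y p by (auto simp: hexagon_def)
    show "verts C6_2l2 = {0..<length ?xs}" by (simp add: C6_2l2_def numeral_eq_Suc)
    show "edges C6_2l2 = (\<lambda>(i, j). {i, j}) ` set [(0,1), (1,2), (2,3), (3,4), (4,5), (0,5), (0,6), (6,7), (1,8), (8,9)]"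
      by (simp add: C6_2l2_def edges_cycle_graph_6 insert_commute)
    show "\<forall>(i, j)\<in>set [(0,1), (1,2), (2,3), (3,4), (4,5), (0,5), (0,6), (6,7), (1,8), (8,9)]. (i::nat) < j" by simp
    show "induced_rows [(0,1), (1,2), (2,3), (3,4), (4,5), (0,5), (0,6), (6,7), (1,8), (8,9)] 0 ?xs"
      using hexagonD(1-6)[OF h] s s' n ne na x(1,4) y(1,4) p hexagon_chord[OF h]
      by (simp add: nadj_side adj_commute)
  qed
  then show False using no_C6_2l2 by simp
qed

end

section \<open>Drawings and how to combine them\<close>

lemma square_mono_dist:
  fixes x y c :: real
  assumes "0 \<le> c" "c \<le> \<bar>x - y\<bar>"
  shows "c\<^sup>2 \<le> (x - y)\<^sup>2"
  using assms by (metis power2_abs power_mono)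

lemma square_dist_mono:
  fixes x y c :: real
  assumes "\<bar>x - y\<bar> \<le> c"
  shows "(x - y)\<^sup>2 \<le> c\<^sup>2"
  using assms by (metis abs_ge_zero power2_abs power_mono)

text \<open>In the limit \<open>\<Lambda> \<rightarrow> 0\<close> a unit disk graph drawing becomes a pair of functions: vertex \<open>u\<close> is at
  horizontal position \<open>A u\<close> (in units of order \<open>\<surd>\<Lambda>\<close>) and is moved by \<open>h u\<close> (in units of order
  \<open>\<Lambda>\<close>) towards the other clique; being adjacent means \<open>(A u - A w)\<^sup>2 \<le> h u + h w\<close>, and \<open>gap\<close> is
  the margin to be kept in this inequality and in its negation. An exposed vertex has room for a
  further neighbour, placed at the same horizontal position, that sees no other vertex.\<close>

locale drawing = bipartite_graph +
  fixes gap :: real and pos :: "'a \<Rightarrow> real" and exposed :: "'a \<Rightarrow> bool"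
  assumes gap: "0 < gap" "gap \<le> 1 / 8"
    and pos: "0 \<le> pos u" "pos u \<le> 1"
    and pos_gap: "\<lbrakk>u \<in> V; w \<in> V; u \<noteq> w\<rbrakk> \<Longrightarrow> 2 * gap \<le> (pos u - pos w)\<^sup>2"
begin

text \<open>The third clause is the second one for \<open>w\<close> and a leaf of \<open>u\<close>
  that is put at \<open>A u\<close> with height \<open>gap - h u\<close>. It makes the relation
  asymmetric.\<close>

definition fits :: "('a \<Rightarrow> real) \<Rightarrow> ('a \<Rightarrow> real) \<Rightarrow> 'a \<Rightarrow> 'a \<Rightarrow> bool" where
  "fits A h u w \<longleftrightarrow>
     (adj u w \<longrightarrow> (A u - A w)\<^sup>2 + gap \<le> h u + h w) \<and>
     (side u \<noteq> side w \<and> \<not> adj u w \<longrightarrow> h u + h w + gap \<le> (A u - A w)\<^sup>2) \<and>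
     (side u = side w \<and> exposed u \<longrightarrow> h w + 2 * gap \<le> h u + (A u - A w)\<^sup>2)"

definition drawn :: "'a set \<Rightarrow> ('a \<Rightarrow> real) \<Rightarrow> ('a \<Rightarrow> real) \<Rightarrow> bool" where
  "drawn K A h \<longleftrightarrow> (\<forall>u\<in>K. 0 \<le> h u \<and> h u \<le> 12100 \<and> (exposed u \<longrightarrow> 10000 \<le> h u)) \<and>
     (\<forall>u\<in>K. \<forall>w\<in>K. u \<noteq> w \<longrightarrow> fits A h u w)"

lemma drawnD:
  assumes "drawn K A h" "u \<in> K"
  shows "0 \<le> h u" "h u \<le> 12100" "exposed u \<Longrightarrow> 10000 \<le> h u"
  using assms by (auto simp: drawn_def)

text \<open>The margin is doubled so that the sides of \<open>u\<close> and \<open>w\<close> need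
  not be known: on the same side, it is what an exposed vertex asks for.\<close>

lemma fits_apart:
  assumes "\<not> adj u w" "0 \<le> h u" "0 \<le> h w" "h u + h w + 2 * gap \<le> (A u - A w)\<^sup>2"
  shows "fits A h u w" "fits A h w u"
  using assms gap by (auto simp: fits_def adj_commute[of w u] power2_commute[of "A w"])

lemma fits_adj:
  assumes "adj u w" "(A u - A w)\<^sup>2 + gap \<le> h u + h w"
  shows "fits A h u w" "fits A h w u"
  using assms adj_side[of u w] by (auto simp: fits_def adj_commute[of w u] power2_commute[of "A w"])

lemma fits_same_side:
  assumes "side u = side w"
    and "exposed u \<Longrightarrow> h w + 2 * gap \<le> h u + (A u - A w)\<^sup>2"
    and "exposed w \<Longrightarrow> h u + 2 * gap \<le> h w + (A u - A w)\<^sup>2"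
  shows "fits A h u w" "fits A h w u"
  using assms nadj_side[of u w] nadj_side[of w u]
  by (auto simp: fits_def power2_commute[of "A w"])

lemma fits_affine:
  assumes "s\<^sup>2 = 1" "A' u = s * A u + t" "A' w = s * A w + t" "h' u = h u" "h' w = h w"
  shows "fits A' h' u w \<longleftrightarrow> fits A h u w"
proof -
  have "(A' u - A' w)\<^sup>2 = s\<^sup>2 * (A u - A w)\<^sup>2"
    unfolding assms(2,3) by (simp add: power2_eq_square algebra_simps)
  then show ?thesis using assms by (simp add: fits_def)
qed

lemma drawn_affine:
  assumes "drawn K A h" "s\<^sup>2 = 1" "\<And>u. u \<in> K \<Longrightarrow> A' u = s * A u + t \<and> h' u = h u"
  shows "drawn K A' h'"
  using assms(1,3) fits_affine[OF assms(2), of A' _ A t _ h' h] unfolding drawn_def by simp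

lemma drawn_shift: "drawn K A h \<Longrightarrow> drawn K (\<lambda>u. A u + t) h"
  by (rule drawn_affine[where s = 1 and t = t]) auto

lemma drawn_cong:
  assumes "drawn K A h" "\<And>u. u \<in> K \<Longrightarrow> A' u = A u \<and> h' u = h u"
  shows "drawn K A' h'"
  by (rule drawn_affine[OF assms(1), where s = 1 and t = 0]) (use assms(2) in auto)

lemma drawn_union:
  assumes "drawn K A h" "drawn R A h"
    and "\<And>u w. \<lbrakk>u \<in> K; w \<in> R\<rbrakk> \<Longrightarrow> fits A h u w \<and> fits A h w u"
  shows "drawn (K \<union> R) A h"
  using assms by (auto simp: drawn_def)

lemma drawn_insert:
  assumes "drawn K A h" "0 \<le> h x" "h x \<le> 12100" "exposed x \<Longrightarrow> 10000 \<le> h x"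
    and "\<And>u. \<lbrakk>u \<in> K; u \<noteq> x\<rbrakk> \<Longrightarrow> fits A h u x \<and> fits A h x u"
  shows "drawn (insert x K) A h"
  using assms by (auto simp: drawn_def)

lemma drawn_far:
  assumes K: "drawn K A1 h1" and R: "drawn R A2 h2" and "finite K" "finite R"
    and dis: "K \<inter> R = {}" and nadj: "\<And>u w. \<lbrakk>u \<in> K; w \<in> R\<rbrakk> \<Longrightarrow> \<not> adj u w"
  obtains A h where "drawn (K \<union> R) A h" "\<And>u. u \<in> K \<Longrightarrow> A u = A1 u \<and> h u = h1 u"
    "\<And>u. u \<in> R \<Longrightarrow> A u \<le> -200"
proof -
  define B where "B = (\<Sum>u\<in>K. \<bar>A1 u\<bar>) + (\<Sum>u\<in>R. \<bar>A2 u\<bar>)"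
  have s: "0 \<le> (\<Sum>u\<in>K. \<bar>A1 u\<bar>)" "0 \<le> (\<Sum>u\<in>R. \<bar>A2 u\<bar>)" by (auto intro: sum_nonneg)
  have B1: "\<bar>A1 u\<bar> \<le> B" if "u \<in> K" for u
    using member_le_sum[OF that abs_ge_zero assms(3), of A1] s(2) unfolding B_def by linarith
  have B2: "\<bar>A2 u\<bar> \<le> B" if "u \<in> R" for u
    using member_le_sum[OF that abs_ge_zero assms(4), of A2] s(1) unfolding B_def by linarith
  \<comment> \<open>This puts \<open>R\<close> at distance at least 200 from \<open>K\<close> and to
    the left of -200; 200^2 exceeds twice the maximal height 12100 by far more than
    \<open>2 * gap\<close>.\<close>
  define A where "A u = (if u \<in> R then A2 u - (2 * B + 200) else A1 u)" for u
  define h where "h u = (if u \<in> R then h2 u else h1 u)" for u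
  have K': "A u = A1 u \<and> h u = h1 u" if "u \<in> K" for u
    using that dis by (auto simp: A_def h_def)
  have dK: "drawn K A h" using K K' by (rule drawn_cong)
  have dR: "drawn R A h"
    by (rule drawn_affine[OF R, where s = 1 and t = "- (2 * B + 200)"]) (auto simp: A_def h_def)
  have "drawn (K \<union> R) A h"
  proof (rule drawn_union[OF dK dR])
    fix u w assume uw: "u \<in> K" "w \<in> R"
    have "200 \<le> \<bar>A u - A w\<bar>"
      using B1[OF uw(1)] B2[OF uw(2)] K'[OF uw(1)] uw(2) by (auto simp: A_def)
    then have "200\<^sup>2 \<le> (A u - A w)\<^sup>2" by (intro square_mono_dist) auto
    then have "h u + h w + 2 * gap \<le> (A u - A w)\<^sup>2"
      using drawnD(2)[OF dK uw(1)] drawnD(2)[OF dR uw(2)] gap by simp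
    then show "fits A h u w \<and> fits A h w u"
      using fits_apart[of u w h A] nadj[OF uw] drawnD(1)[OF dK uw(1)] drawnD(1)[OF dR uw(2)]
      by blast
  qed
  moreover have "A u \<le> -200" if "u \<in> R" for u
    using B2[OF that] s that unfolding A_def by auto
  ultimately show ?thesis using that K' by blast
qed

definition drawable :: "'a set \<Rightarrow> bool" where
  "drawable K \<longleftrightarrow> (\<exists>A h. drawn K A h)"

text \<open>The radii \<open>100\<close> and \<open>110\<close> are square roots of the two heights \<open>10000\<close> and \<open>12100\<close>. In a
  drawing of \<open>K\<close> rooted at \<open>v\<close>, the rest of \<open>K\<close> is to the left of \<open>v\<close> and leaves room for a
  further vertex at distance \<open>0\<close> from \<open>v\<close> with height \<open>10000\<close>.\<close>

definition clear :: "('a \<Rightarrow> real) \<Rightarrow> ('a \<Rightarrow> real) \<Rightarrow> 'a \<Rightarrow> 'a \<Rightarrow> bool" where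
  "clear A h v u \<longleftrightarrow> A u \<le> -1 \<and> h u + 1 \<le> 10000 + (A u)\<^sup>2 \<and>
     (side u = side v \<longrightarrow> h u + 10001 \<le> (A u)\<^sup>2)"

definition rooted :: "'a set \<Rightarrow> 'a \<Rightarrow> bool" where
  "rooted K v \<longleftrightarrow> (\<exists>A h. drawn K A h \<and> v \<in> K \<and> A v = 0 \<and> h v = 12100 \<and>
     (\<forall>u\<in>K - {v}. clear A h v u))"

text \<open>The second alternative is meant for the neighbours of \<open>v\<close> that lead
  nowhere. They stand together within distance 1 of \<open>v\<close>, and \<open>pos_gap\<close>
  keeps them apart, which costs a margin of order 1/n^2.\<close>

definition legged :: "'a set \<Rightarrow> 'a \<Rightarrow> bool" where
  "legged K v \<longleftrightarrow> (\<exists>A h. drawn K A h \<and> v \<in> K \<and> A v = 0 \<and> h v = 12100 \<and>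
     (\<forall>u\<in>K - {v}. clear A h v u \<or> (adj v u \<and> A u = pos u \<and> h u = 10000)))"

text \<open>The shape required of the part of a drawing to the left of a bundle of paths of length three
  that is centred at \<open>0\<close> and starts at the edge between \<open>a\<close> and \<open>b\<close>: \<open>a\<close> is the common end of
  these paths, and \<open>b\<close> is the second vertex of one of them.\<close>

definition left_end :: "'a set \<Rightarrow> 'a \<Rightarrow> 'a \<Rightarrow> ('a \<Rightarrow> real) \<Rightarrow> ('a \<Rightarrow> real) \<Rightarrow> bool" where
  "left_end K a b A h \<longleftrightarrow> drawn K A h \<and> a \<in> K \<and> b \<in> K \<and> side a \<noteq> side b \<and>
     (\<exists>r\<in>{100, 110}. h a = r\<^sup>2 \<and> 3 - r \<le> A a) \<and> A a \<le> -90 \<and>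
     (\<exists>r\<in>{100, 110}. h b = r\<^sup>2 \<and> A b = - r - 3 / 2) \<and>
     (\<forall>u\<in>K - {a, b}. A u \<le> -90 \<and> h u + 1 \<le> (A u + 2)\<^sup>2)"

definition ended :: "'a set \<Rightarrow> 'a \<Rightarrow> 'a \<Rightarrow> bool" where
  "ended K a b \<longleftrightarrow> (\<exists>A h. left_end K a b A h)"

section \<open>Extending rooted drawings by legs, single edges and bridges\<close>

lemma legged_drawable: "legged K v \<Longrightarrow> drawable K"
  by (auto simp: legged_def drawable_def)

lemma drawable_empty: "drawable {}"
  by (simp add: drawable_def drawn_def)

lemma rooted_singleton: "rooted {v} v"
  unfolding rooted_def
  by (rule exI[of _ "\<lambda>_. 0"], rule exI[of _ "\<lambda>_. 12100"]) (simp add: drawn_def)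

lemma rooted_union:
  assumes K: "rooted K v" and R: "drawable R" and fin: "finite K" "finite R" "K \<inter> R = {}"
    and nadj: "\<And>u w. \<lbrakk>u \<in> K; w \<in> R\<rbrakk> \<Longrightarrow> \<not> adj u w"
  shows "rooted (K \<union> R) v"
proof -
  obtain A1 h1 where 1: "drawn K A1 h1" "v \<in> K" "A1 v = 0" "h1 v = 12100"
    "\<forall>u\<in>K - {v}. clear A1 h1 v u" using K unfolding rooted_def by blast
  obtain A2 h2 where 2: "drawn R A2 h2" using R unfolding drawable_def by blast
  obtain A h where Ah: "drawn (K \<union> R) A h" "\<And>u. u \<in> K \<Longrightarrow> A u = A1 u \<and> h u = h1 u"
    "\<And>u. u \<in> R \<Longrightarrow> A u \<le> -200"
    using drawn_far[OF 1(1) 2 fin nadj] by blast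
  have "clear A h v u" if "u \<in> K \<union> R - {v}" for u
  proof (cases "u \<in> K")
    case True
    then show ?thesis using that 1(5) Ah(2)[OF True] by (auto simp: clear_def)
  next
    case False
    then have u: "u \<in> R" using that by blast
    have "200\<^sup>2 \<le> (A u - 0)\<^sup>2" using Ah(3)[OF u] by (intro square_mono_dist) auto
    then show ?thesis using drawnD(2)[OF Ah(1), of u] u Ah(3)[OF u] by (simp add: clear_def)
  qed
  then show ?thesis unfolding rooted_def using Ah(1,2) 1 by (intro exI[of _ A] exI[of _ h]) auto
qed

text \<open>The other vertices of \<open>K\<close> are to the left of -1, so moving from 0 to
  \<open>pos l\<close> only increases the distances that \<open>clear\<close> bounds from below. The
  heights 12100 and 10000 cover the distance of at most 1 to \<open>v\<close> easily.\<close>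

lemma rooted_legs:
  assumes K: "rooted K v" and L: "L \<subseteq> V" "K \<inter> L = {}"
    and adj: "\<And>l. l \<in> L \<Longrightarrow> adj v l"
    and only: "\<And>l u. \<lbrakk>l \<in> L; u \<in> K \<union> L; adj l u\<rbrakk> \<Longrightarrow> u = v"
  shows "legged (K \<union> L) v"
proof -
  obtain A1 h1 where 1: "drawn K A1 h1" "v \<in> K" "A1 v = 0" "h1 v = 12100"
    "\<forall>u\<in>K - {v}. clear A1 h1 v u" using K unfolding rooted_def by blast
  define A where "A u = (if u \<in> L then pos u else A1 u)" for u
  define h where "h u = (if u \<in> L then 10000 else h1 u)" for u
  have AK: "A u = A1 u \<and> h u = h1 u" if "u \<in> K" for u
    using that L(2) by (auto simp: A_def h_def)
  have AL: "A u = pos u \<and> h u = 10000" if "u \<in> L" for u using that by (simp add: A_def h_def)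
  have dK: "drawn K A h" using 1(1) AK by (rule drawn_cong)
  have dL: "drawn L A h"
    unfolding drawn_def
  proof (intro conjI ballI impI)
    fix u w assume uw: "u \<in> L" "w \<in> L" "u \<noteq> w"
    have "side u = side w"
      using adj_side_iff[OF adj[OF uw(1)]] adj_side_iff[OF adj[OF uw(2)]] by simp
    moreover have "2 * gap \<le> (A u - A w)\<^sup>2"
      using pos_gap[of u w] AL[OF uw(1)] AL[OF uw(2)] uw L(1) by auto
    ultimately show "fits A h u w"
      using AL[OF uw(1)] AL[OF uw(2)] by (intro fits_same_side) auto
  qed (use AL in auto)
  have "drawn (K \<union> L) A h"
  proof (rule drawn_union[OF dK dL])
    fix u l assume ul: "u \<in> K" "l \<in> L"
    note b = drawnD[OF dK ul(1)]
    show "fits A h u l \<and> fits A h l u"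
    proof (cases "u = v")
      case True
      have "(A u - A l)\<^sup>2 \<le> 1\<^sup>2"
        using True 1(2,3) AK AL[OF ul(2)] pos[of l] by (intro square_dist_mono) auto
      then have "(A u - A l)\<^sup>2 + gap \<le> h u + h l"
        using True 1(2,4) AK AL[OF ul(2)] gap by auto
      then show ?thesis using fits_adj[of u l A h] adj[OF ul(2)] True by auto
    next
      case False
      then have n: "\<not> adj u l" using only[OF ul(2), of u] ul(1) adj_sym by blast
      have c: "clear A h v u" using 1(5) False ul(1) AK[OF ul(1)] by (auto simp: clear_def)
      have sq: "(A u)\<^sup>2 \<le> (A u - A l)\<^sup>2"
        using square_mono_dist[of "- A u" "A u" "A l"] c pos[of l] AL[OF ul(2)]
        by (auto simp: clear_def)
      have "1\<^sup>2 \<le> (A u - A l)\<^sup>2"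
        using c pos[of l] AL[OF ul(2)] by (intro square_mono_dist) (auto simp: clear_def)
      then have one: "1 \<le> (A u - A l)\<^sup>2" by simp
      show ?thesis
      proof (cases "side u = side v")
        case True
        then have "h u + h l + 2 * gap \<le> (A u - A l)\<^sup>2"
          using c sq AL[OF ul(2)] gap by (auto simp: clear_def)
        then show ?thesis using fits_apart[of u l h A] n b AL[OF ul(2)] by auto
      next
        case False
        then have "side u = side l" using adj_side_iff[OF adj[OF ul(2)]] by blast
        moreover have "h l + 2 * gap \<le> h u + (A u - A l)\<^sup>2" if "exposed u"
          using b(3)[OF that] AL[OF ul(2)] gap one by simp
        moreover have "h u + 2 * gap \<le> h l + (A u - A l)\<^sup>2"
          using c sq AL[OF ul(2)] gap by (auto simp: clear_def)
        ultimately show ?thesis using fits_same_side[of u l h A] by blast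
      qed
    qed
  qed
  moreover have "clear A h v u \<or> (adj v u \<and> A u = pos u \<and> h u = 10000)"
    if "u \<in> K \<union> L - {v}" for u
    using that 1(5) AK[of u] AL[of u] adj[of u] by (auto simp: clear_def)
  ultimately show ?thesis
    unfolding legged_def using AK[OF 1(2)] 1(2-4) by (intro exI[of _ A] exI[of _ h]) auto
qed

text \<open>The edge from \<open>v\<close> to \<open>x\<close> is going to be the edge at which a
  bundle is attached. Distance at least 4 to all vertices but \<open>v\<close> satisfies the exposed
  ones, and 15^2 is well below 12100 + 10000.\<close>

lemma legged_insert:
  assumes d: "drawn K A h" and v: "v \<in> K" "A v = 0" "h v = 12100"
    and K: "\<forall>u\<in>K - {v}. clear A h v u \<or> (adj v u \<and> A u = pos u \<and> h u = 10000)"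
    and x: "x \<notin> K" "adj v x" "\<And>u. \<lbrakk>u \<in> K; adj x u\<rbrakk> \<Longrightarrow> u = v"
    and A': "\<And>u. u \<in> K \<Longrightarrow> A' u = A u \<and> h' u = h u" "A' x = t" "h' x = 10000"
    and t: "5 \<le> t" "t \<le> 15"
  shows "drawn (insert x K) A' h'"
proof (rule drawn_insert)
  show "drawn K A' h'" using d A'(1) by (rule drawn_cong)
  fix u assume u: "u \<in> K"
  note b = drawnD[OF d u]
  show "fits A' h' u x \<and> fits A' h' x u"
  proof (cases "u = v")
    case True
    have "(A' u - A' x)\<^sup>2 \<le> 15\<^sup>2"
      using True v A'(1)[OF u] A'(2) t by (intro square_dist_mono) auto
    then have "(A' u - A' x)\<^sup>2 + gap \<le> h' u + h' x"
      using True A'(1)[OF u] A'(3) v gap by simp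
    then show ?thesis using fits_adj[of u x A' h'] x(2) True by auto
  next
    case False
    have "clear A h v u \<or> (adj v u \<and> A u = pos u \<and> h u = 10000)" using K False u by blast
    then have le: "A u \<le> 1" using pos[of u] by (auto simp: clear_def)
    have "4\<^sup>2 \<le> (A' u - A' x)\<^sup>2"
      using le A'(1)[OF u] A'(2) t by (intro square_mono_dist) auto
    then have four: "16 \<le> (A' u - A' x)\<^sup>2" by simp
    have n: "\<not> adj u x" using x(3)[OF u] False adj_sym by blast
    show ?thesis
    proof (cases "side u = side v")
      case True
      then have c: "clear A h v u" using K False u adj_side[of v u] by auto
      have "(A u)\<^sup>2 \<le> (A' u - A' x)\<^sup>2"
        using square_mono_dist[of "- A u" "A' u" "A' x"] c A'(1)[OF u] A'(2) t
        by (auto simp: clear_def)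
      then have "h' u + h' x + 2 * gap \<le> (A' u - A' x)\<^sup>2"
        using c True A'(1)[OF u] A'(3) gap by (auto simp: clear_def)
      then show ?thesis using fits_apart[of u x h' A'] n b A'(1)[OF u] A'(3) by auto
    next
      case False
      note ns = False
      then have "side u = side x" using adj_side_iff[OF x(2)] by blast
      moreover have "h' x + 2 * gap \<le> h' u + (A' u - A' x)\<^sup>2" if "exposed u"
        using b(3)[OF that] A'(1)[OF u] A'(3) gap four by simp
      moreover have "h' u + 2 * gap \<le> h' x + (A' u - A' x)\<^sup>2"
      proof (cases "clear A h v u")
        case True
        have "(A u)\<^sup>2 \<le> (A' u - A' x)\<^sup>2"
          using square_mono_dist[of "- A u" "A' u" "A' x"] True A'(1)[OF u] A'(2) t
          by (auto simp: clear_def)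
        then show ?thesis using True A'(1)[OF u] A'(3) gap by (auto simp: clear_def)
      next
        case False
        then have "h u = 10000" using K u ns by auto
        then show ?thesis using A'(1)[OF u] A'(3) gap four by simp
      qed
      ultimately show ?thesis using fits_same_side[of u x h' A'] by blast
    qed
  qed
qed (use A' in auto)

lemma legged_ended_root:
  assumes "legged K v" "x \<notin> K" "adj v x" "\<And>u. \<lbrakk>u \<in> K; adj x u\<rbrakk> \<Longrightarrow> u = v"
  shows "ended (insert x K) v x" "ended (insert x K) x v"
proof -
  obtain A h where d: "drawn K A h" and v: "v \<in> K" "A v = 0" "h v = 12100"
    and K: "\<forall>u\<in>K - {v}. clear A h v u \<or> (adj v u \<and> A u = pos u \<and> h u = 10000)"
    using assms(1) unfolding legged_def by blast
  define h' where "h' = h(x := 10000)"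
  define A' where "A' t = A(x := t)" for t
  have vx: "v \<noteq> x" using v assms(2) by blast
  have d': "drawn (insert x K) (A' t) h'" if "5 \<le> t" "t \<le> 15" for t
    by (rule legged_insert[OF d v K assms(2-4), of "A' t" h' t])
      (use assms(2) that in \<open>auto simp: A'_def h'_def\<close>)
  have other: "A u + s \<le> -90 \<and> h u + 1 \<le> (A u + s + 2)\<^sup>2" if u: "u \<in> K - {v}" "s \<le> -107" for u s
  proof (cases "clear A h v u")
    case True
    have "(A u - 105)\<^sup>2 \<le> (A u + s + 2 - 0)\<^sup>2"
      using True u(2) square_mono_dist[of "105 - A u" "A u + s + 2" 0]
      by (auto simp: clear_def power2_commute)
    moreover have "(A u - 105)\<^sup>2 = (A u)\<^sup>2 - 210 * A u + 11025"
      by (simp add: power2_eq_square algebra_simps)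
    ultimately show ?thesis using True u(2) by (auto simp: clear_def)
  next
    case False
    then have "A u = pos u" "h u = 10000" using K u(1) by auto
    moreover have "104\<^sup>2 \<le> (A u + s + 2 - 0)\<^sup>2"
      using \<open>A u = pos u\<close> pos[of u] u(2) by (intro square_mono_dist) auto
    ultimately show ?thesis using pos[of u] u(2) by simp
  qed
  have s: "side v \<noteq> side x" using adj_side[OF assms(3)] .
  \<comment> \<open>The end \<open>v\<close> has radius 110 and is put at 3 - 110 = -107;
    \<open>x\<close> has radius 100 and must be at -100 - 3/2, which is 11/2 further right.\<close>
  have "left_end (insert x K) v x (\<lambda>u. A' (11/2) u + -107) h'"
    unfolding left_end_def
  proof (intro conjI ballI)
    show "drawn (insert x K) (\<lambda>u. A' (11/2) u + -107) h'"
      by (intro drawn_shift d') auto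
    fix u assume u: "u \<in> insert x K - {v, x}"
    then show "A' (11/2) u + -107 \<le> -90" "h' u + 1 \<le> (A' (11/2) u + -107 + 2)\<^sup>2"
      using other[of u "-107"] by (auto simp: A'_def h'_def)
  qed (use v vx s in \<open>auto simp: A'_def h'_def\<close>)
  then show "ended (insert x K) v x" unfolding ended_def by blast
  \<comment> \<open>Now the end \<open>x\<close> has radius 100 and is put at 3 - 100 = -97, and
    \<open>v\<close> must be at -110 - 3/2 = -223/2; the difference is 29/2.\<close>
  have "left_end (insert x K) x v (\<lambda>u. A' (29/2) u + -(223/2)) h'"
    unfolding left_end_def
  proof (intro conjI ballI)
    show "drawn (insert x K) (\<lambda>u. A' (29/2) u + -(223/2)) h'"
      by (intro drawn_shift d') auto
    fix u assume u: "u \<in> insert x K - {x, v}"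
    then show "A' (29/2) u + -(223/2) \<le> -90" "h' u + 1 \<le> (A' (29/2) u + -(223/2) + 2)\<^sup>2"
      using other[of u "-(223/2)"] by (auto simp: A'_def h'_def)
  qed (use v vx s in \<open>auto simp: A'_def h'_def\<close>)
  then show "ended (insert x K) x v" unfolding ended_def by blast
qed

lemma legged_bridge:
  assumes "legged K w" "v \<notin> K" "adj v w" "\<And>u. \<lbrakk>u \<in> K; adj v u\<rbrakk> \<Longrightarrow> u = w"
  shows "rooted (insert v K) v"
proof -
  obtain A1 h1 where d: "drawn K A1 h1" and w: "w \<in> K" "A1 w = 0" "h1 w = 12100"
    and K: "\<forall>u\<in>K - {w}. clear A1 h1 w u \<or> (adj w u \<and> A1 u = pos u \<and> h1 u = 10000)"
    using assms(1) unfolding legged_def by blast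
  \<comment> \<open>Since 150^2 is below 2 * 12100, \<open>v\<close> sees \<open>w\<close>. The legs
    of \<open>w\<close> are on the side of \<open>v\<close> and have distance at least 149; as 149^2
    exceeds 10000 + 10001, they are \<open>clear\<close>.\<close>
  define A where "A u = (if u = v then 0 else A1 u - 150)" for u
  define h where "h u = (if u = v then 12100 else h1 u)" for u
  have AK: "A u = A1 u - 150 \<and> h u = h1 u" if "u \<in> K" for u
    using that assms(2) by (auto simp: A_def h_def)
  have Av: "A v = 0" "h v = 12100" by (auto simp: A_def h_def)
  have dK: "drawn K A h"
    by (rule drawn_affine[OF d, where s = 1 and t = "-150"]) (use AK in auto)
  have s: "side w \<longleftrightarrow> \<not> side v" using adj_side_iff[OF assms(3)] .
  have c: "clear A h v u" if "u \<in> K" for u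
  proof (cases "u = w")
    case True
    then show ?thesis using AK[OF that] w s by (simp add: clear_def)
  next
    case False
    show ?thesis
    proof (cases "clear A1 h1 w u")
      case True
      have "(A u)\<^sup>2 = (A1 u)\<^sup>2 - 300 * A1 u + 22500"
        unfolding AK[OF that, THEN conjunct1] by (simp add: power2_eq_square algebra_simps)
      then show ?thesis using True AK[OF that] by (auto simp: clear_def)
    next
      case F: False
      then have u: "A1 u = pos u" "h1 u = 10000" using K that False by auto
      have "149\<^sup>2 \<le> (A u - 0)\<^sup>2"
        using AK[OF that] u pos[of u] by (intro square_mono_dist) auto
      then show ?thesis using AK[OF that] u pos[of u] by (simp add: clear_def)
    qed
  qed
  have far: "149\<^sup>2 \<le> (A u - A v)\<^sup>2" if "u \<in> K" for u
  proof -
    have "A1 u \<le> 1"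
    proof (cases "u = w")
      case False
      then have "clear A1 h1 w u \<or> (adj w u \<and> A1 u = pos u \<and> h1 u = 10000)"
        using K that by blast
      then show ?thesis using pos[of u] by (auto simp: clear_def)
    qed (simp add: w)
    then show ?thesis using AK[OF that] Av by (intro square_mono_dist) auto
  qed
  have op: "h u + 12100 + 2 * gap \<le> (A u)\<^sup>2" if "u \<in> K" "u \<noteq> w" "side u = side w" for u
  proof -
    have "clear A1 h1 w u" using K that adj_side[of w u] by auto
    moreover have "(A u)\<^sup>2 = (A1 u)\<^sup>2 - 300 * A1 u + 22500"
      unfolding AK[OF that(1), THEN conjunct1] by (simp add: power2_eq_square algebra_simps)
    ultimately show ?thesis using AK[OF that(1)] that(3) gap by (auto simp: clear_def)
  qed
  have "drawn (insert v K) A h"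
  proof (rule drawn_insert[OF dK])
    fix u assume u: "u \<in> K"
    note b = drawnD[OF dK u]
    show "fits A h u v \<and> fits A h v u"
    proof (cases "u = w")
      case True
      have "(A u - A v)\<^sup>2 + gap \<le> h u + h v"
        using True AK[OF u] w Av gap by simp
      then show ?thesis using fits_adj[of u v A h] adj_sym[OF assms(3)] True by blast
    next
      case False
      then have n: "\<not> adj u v" using assms(4)[OF u] adj_sym by blast
      show ?thesis
      proof (cases "side u = side w")
        case True
        then have "h u + h v + 2 * gap \<le> (A u - A v)\<^sup>2" using op[OF u False] Av by simp
        then show ?thesis using fits_apart[of u v h A] n b Av by auto
      next
        case False
        then have "side u = side v" using s by blast
        then show ?thesis
          using fits_same_side[of u v h A] b far[OF u] Av gap by auto
      qed
    qed
  qed (auto simp: Av)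
  then show ?thesis
    unfolding rooted_def using Av c by (intro exI[of _ A] exI[of _ h]) auto
qed

end

section \<open>Bundles of paths of length three\<close>

context bipartite_graph
begin

text \<open>A bundle of paths \<open>a, p w, w, d\<close> for \<open>w \<in> D\<close>, in which only \<open>p w0\<close> and \<open>w1\<close> may have neighbours
  outside of the bundle.\<close>

definition path_bundle :: "'a set \<Rightarrow> ('a \<Rightarrow> 'a) \<Rightarrow> 'a \<Rightarrow> 'a \<Rightarrow> 'a \<Rightarrow> 'a \<Rightarrow> bool" where
  "path_bundle D p a d w0 w1 \<longleftrightarrow> w0 \<in> D \<and> w1 \<in> D \<and> w0 \<noteq> w1 \<and> a \<notin> D \<and>
     (\<forall>w\<in>D. adj w d \<and> adj w (p w) \<and> adj (p w) a) \<and>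
     (\<forall>w\<in>D - {w1}. \<forall>z. adj w z \<longrightarrow> z = d \<or> z = p w) \<and>
     (\<forall>w\<in>D - {w0}. \<forall>z. adj (p w) z \<longrightarrow> z = w \<or> z = a)"

text \<open>These vertices have no neighbour outside the bundle. What is left of the bundle are two
  edges that attach it: \<open>a\<close>, \<open>p w0\<close> on the left and \<open>d\<close>,
  \<open>w1\<close> on the right.\<close>

definition middle :: "'a set \<Rightarrow> ('a \<Rightarrow> 'a) \<Rightarrow> 'a \<Rightarrow> 'a \<Rightarrow> 'a set" where
  "middle D p w0 w1 = (D - {w1}) \<union> p ` (D - {w0})"

lemma bundleD:
  assumes "path_bundle D p a d w0 w1"
  shows "w0 \<in> D" "w1 \<in> D" "w0 \<noteq> w1" "a \<notin> D"
    and "\<And>w. w \<in> D \<Longrightarrow> adj w d" "\<And>w. w \<in> D \<Longrightarrow> adj w (p w)" "\<And>w. w \<in> D \<Longrightarrow> adj (p w) a"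
    and "\<And>w z. \<lbrakk>w \<in> D; w \<noteq> w1; adj w z\<rbrakk> \<Longrightarrow> z = d \<or> z = p w"
    and "\<And>w z. \<lbrakk>w \<in> D; w \<noteq> w0; adj (p w) z\<rbrakk> \<Longrightarrow> z = w \<or> z = a"
  using assms unfolding path_bundle_def by auto

lemma bundle_side:
  assumes "path_bundle D p a d w0 w1" "w \<in> D"
  shows "side d \<longleftrightarrow> \<not> side a" "side w \<longleftrightarrow> side a" "side (p w) \<longleftrightarrow> \<not> side a"
  using bundleD(5-7)[OF assms, THEN adj_side_iff] by auto

lemma bundle_inj:
  assumes b: "path_bundle D p a d w0 w1"
  shows "inj_on p D"
proof (rule inj_onI, rule ccontr)
  fix w w' assume w: "w \<in> D" "w' \<in> D" "p w = p w'" "w \<noteq> w'"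
  have "w = a \<or> w' = a"
    using bundleD(9)[OF b w(1), of w'] bundleD(9)[OF b w(2), of w] w
      adj_sym[OF bundleD(6)[OF b w(1)]] adj_sym[OF bundleD(6)[OF b w(2)]] by metis
  then show False using bundleD(4)[OF b] w by blast
qed

end

context drawing
begin

text \<open>This keeps the two ends of a bundle apart: for positions beyond 90 on both sides of 0,
  the cross term in the squared distance is at least 2 * 90 * 90 = 16200, more than 2 * 4000 +
  \<open>2 * gap\<close>.\<close>

lemma left_end_bound:
  assumes "left_end K a b A h" "u \<in> K"
  shows "A u \<le> -90" "h u \<le> 4000 + (A u)\<^sup>2"
proof -
  note l = assms(1)[unfolded left_end_def]
  have "A u \<le> -90 \<and> h u \<le> 4000 + (A u)\<^sup>2"
  proof -
    consider "u = b" | "u = a" | "u \<in> K - {a, b}" using assms(2) by blast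
    then show ?thesis
    proof cases
      case 1
      then show ?thesis using l by (auto simp: power2_eq_square)
    next
      case 2
      have "90\<^sup>2 \<le> (A a - 0)\<^sup>2" using l by (intro square_mono_dist) auto
      moreover have "h a \<le> 12100" using l drawnD(2) by blast
      ultimately show ?thesis using 2 l by simp
    next
      case 3
      then have u: "A u \<le> -90" "h u + 1 \<le> (A u + 2)\<^sup>2" using l by auto
      have "(A u + 2)\<^sup>2 = (A u)\<^sup>2 + 4 * A u + 4" by (simp add: power2_eq_square algebra_simps)
      then show ?thesis using u by simp
    qed
  qed
  then show "A u \<le> -90" "h u \<le> 4000 + (A u)\<^sup>2" by auto
qed

text \<open>This explains the numbers in \<open>left_end\<close>. From \<open>3 - r\<close> or
  further right, \<open>a\<close> with radius \<open>r\<close> sees all of [-2, 2]. From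
  \<open>- r - 3 / 2\<close>, \<open>b\<close> sees the point -2 at distance \<open>r - 1/2\<close>,
  but nothing from -1 on. The condition on the remaining vertices says that they do not even reach
  -2.\<close>

lemma left_end_middle:
  assumes l: "left_end K a b A h" and u: "u \<in> K"
    and x: "-2 \<le> A x" "A x \<le> 2" "0 \<le> h x" "h x \<le> gap" "\<not> exposed x"
    and only: "adj u x \<Longrightarrow> u = a \<or> (u = b \<and> A x = -2)"
    and ax: "side x \<noteq> side a \<Longrightarrow> adj a x"
    and bx: "\<lbrakk>side x \<noteq> side b; \<not> adj b x\<rbrakk> \<Longrightarrow> -1 \<le> A x"
  shows "fits A h u x \<and> fits A h x u"
proof -
  note l' = l[unfolded left_end_def]
  have d: "drawn K A h" using l' by blast
  note b = drawnD[OF d u]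
  have same: ?thesis if "side u = side x"
    using fits_same_side[OF that, of h A] b(3) x(4,5) gap zero_le_power2[of "A u - A x"] by fastforce
  consider "side u = side x" | "u = a" "side a \<noteq> side x" | "u = b" "side b \<noteq> side x" "adj b x"
    | "u = b" "\<not> adj b x" "side b \<noteq> side x" | "u \<in> K - {a, b}" using u by blast
  then show ?thesis
  proof cases
    case 1 then show ?thesis by (rule same)
  next
    case 2
    obtain r where r: "r \<in> {100, 110}" "h a = r\<^sup>2" "3 - r \<le> A a" using l' by blast
    have "(A a - A x)\<^sup>2 \<le> (r - 1)\<^sup>2" using r x l' by (intro square_dist_mono) auto
    then have "(A a - A x)\<^sup>2 + gap \<le> h a + h x" using r x(3) gap by auto
    then show ?thesis using fits_adj[of a x A h] ax 2 by auto
  next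
    case 3
    obtain r where r: "r \<in> {100, 110}" "h b = r\<^sup>2" "A b = - r - 3 / 2" using l' by blast
    have "a \<noteq> b" using l' by blast
    then have "A x = -2" using only 3 by auto
    then have "(A b - A x)\<^sup>2 + gap \<le> h b + h x" using r x(3) gap by (auto simp: power2_eq_square)
    then show ?thesis using fits_adj[of b x A h] 3 by auto
  next
    case 4
    obtain r where r: "r \<in> {100, 110}" "h b = r\<^sup>2" "A b = - r - 3 / 2" using l' by blast
    have "-1 \<le> A x" using bx 4 by auto
    then have "(r + 1/2)\<^sup>2 \<le> (A b - A x)\<^sup>2" using r by (intro square_mono_dist) auto
    then have "h b + h x + 2 * gap \<le> (A b - A x)\<^sup>2" using r x(4) gap by (auto simp: power2_eq_square)
    then show ?thesis using fits_apart[of b x h A] 4 b(1) x(3) by auto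
  next
    case 5
    then have u': "A u \<le> -90" "h u + 1 \<le> (A u + 2)\<^sup>2" using l' by auto
    have "(- (A u + 2))\<^sup>2 \<le> (A u - A x)\<^sup>2" using u' x by (intro square_mono_dist) auto
    then have "h u + h x + 2 * gap \<le> (A u - A x)\<^sup>2"
      using u' x gap by (simp only: power2_minus)
    moreover have "\<not> adj u x" using only 5 by auto
    ultimately show ?thesis using fits_apart[of u x h A] b(1) x(3) by auto
  qed
qed

lemma left_end_cong:
  assumes "left_end K a b A h" "\<And>u. u \<in> K \<Longrightarrow> A' u = A u \<and> h' u = h u"
  shows "left_end K a b A' h'"
proof -
  have "drawn K A' h'" using drawn_cong assms unfolding left_end_def by blast
  then show ?thesis using assms unfolding left_end_def by auto
qed

text \<open>\<open>L\<close> stays where it is, \<open>R\<close> is mirrored to the right, and the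
  middle vertices are low and near 0, where the high vertices \<open>a\<close> and \<open>d\<close>
  see them. As no middle vertex is exposed, middle vertices of the same side do not restrict each
  other.\<close>

lemma bundle_drawn:
  assumes b: "path_bundle D p a d w0 w1"
    and L: "left_end L a (p w0) A1 h1" and R: "left_end R d w1 A2 h2"
    and dis: "L \<inter> middle D p w0 w1 = {}" "R \<inter> middle D p w0 w1 = {}" "L \<inter> R = {}"
    and nadj: "\<And>u w. \<lbrakk>u \<in> L; w \<in> R\<rbrakk> \<Longrightarrow> \<not> adj u w"
    and ex: "\<And>u. u \<in> middle D p w0 w1 \<Longrightarrow> \<not> exposed u"
  obtains A h where "drawn (L \<union> middle D p w0 w1 \<union> R) A h"
    "\<And>u. u \<in> L \<Longrightarrow> A u = A1 u \<and> h u = h1 u"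
    "\<And>u. u \<in> R \<Longrightarrow> A u = - A2 u \<and> h u = h2 u"
    "\<And>u. u \<in> middle D p w0 w1 \<Longrightarrow> -2 \<le> A u \<and> A u \<le> 2 \<and> h u \<le> gap"
proof -
  let ?M = "middle D p w0 w1"
  note bD = bundleD[OF b] and bs = bundle_side[OF b]
  have mem: "a \<in> L" "p w0 \<in> L" "d \<in> R" "w1 \<in> R" using L R by (auto simp: left_end_def)
  have DM: "w \<in> ?M" "w \<notin> L" "w \<notin> R" if "w \<in> D" "w \<noteq> w1" for w
    using that dis unfolding middle_def by blast+
  have pM: "p w \<in> ?M" "p w \<notin> L" "p w \<notin> R" if "w \<in> D" "w \<noteq> w0" for w
    using that dis unfolding middle_def by blast+
  have pD: "p w \<notin> D" if "w \<in> D" for w using bs(2,3) that by blast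
  have DV: "w \<in> V" if "w \<in> D" for w using bD(5)[OF that] by (rule adj_V)
  \<comment> \<open>The vertex \<open>w0\<close> must be seen by \<open>p w0\<close>, which belongs
    to \<open>L\<close>, and symmetrically \<open>p w1\<close> by \<open>w1\<close> in
    \<open>R\<close>; hence the positions -2 and 2. Every other pair \<open>w\<close>,
    \<open>p w\<close> shares the position \<open>pos w\<close>.\<close>
  define A where "A u = (if u \<in> L then A1 u else if u \<in> R then - A2 u else if u = w0 then -2
    else if u = p w1 then 2 else if u \<in> D then pos u else pos (inv_into D p u))" for u
  \<comment> \<open>For a pair at the same position, the sum of the heights is exactly the margin
    \<open>gap\<close>. Different pairs have squared distance at least \<open>2 * gap\<close>,
    exactly what their non-adjacency needs.\<close>
  define h where "h u = (if u \<in> L then h1 u else if u \<in> R then h2 u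
    else if u \<in> D then gap else 0)" for u
  have AL: "A u = A1 u \<and> h u = h1 u" if "u \<in> L" for u using that by (simp add: A_def h_def)
  have AR: "A u = - A2 u \<and> h u = h2 u" if "u \<in> R" for u
    using that dis(3) by (auto simp: A_def h_def)
  have AD: "A w = (if w = w0 then -2 else pos w)" "h w = gap" if w: "w \<in> D" "w \<noteq> w1" for w
    using DM[OF w] pD[OF bD(2)] w by (auto simp: A_def h_def)
  have Ap: "A (p w) = (if w = w1 then 2 else pos w)" "h (p w) = 0" if w: "w \<in> D" "w \<noteq> w0" for w
    using pM[OF w] pD[OF w(1)] bD(1,2) w inv_into_f_f[OF bundle_inj[OF b] w(1)]
      inj_on_eq_iff[OF bundle_inj[OF b] w(1) bD(2)]
    by (auto simp: A_def h_def)
  have M: "-2 \<le> A u \<and> A u \<le> 2 \<and> 0 \<le> h u \<and> h u \<le> gap" if "u \<in> ?M" for u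
    using that AD Ap pos gap unfolding middle_def
    by (smt (verit) Diff_iff UnE imageE singletonI)
  have lL: "left_end L a (p w0) A h" using L AL by (rule left_end_cong)
  have lR: "left_end R d w1 (\<lambda>u. - A u) h" by (rule left_end_cong[OF R]) (use AR in auto)
  have dL: "drawn L A h" using lL by (simp add: left_end_def)
  have dR: "drawn R A h"
    by (rule drawn_affine[where s = "-1" and t = 0 and A = "\<lambda>u. - A u" and h = h])
      (use lR in \<open>auto simp: left_end_def\<close>)
  have mixed: "fits A h w (p v)" if w: "w \<in> D" "w \<noteq> w1" and v: "v \<in> D" "v \<noteq> w0" for w v
  proof (cases "w = v")
    case True
    then show ?thesis using fits_adj(1)[OF bD(6)[OF w(1)], of A h] AD[OF w] Ap[OF v] w v by simp
  next
    case False
    have n: "\<not> adj w (p v)"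
      using bD(9)[OF v, of w] False bD(4) w(1) adj_sym by blast
    have "2 * gap \<le> (A w - A (p v))\<^sup>2 \<or> 1 \<le> \<bar>A w - A (p v)\<bar>"
      using AD(1)[OF w] Ap(1)[OF v] pos[of w] pos[of v] pos_gap[OF DV DV, OF w(1) v(1) False]
      by auto
    moreover have "1\<^sup>2 \<le> (A w - A (p v))\<^sup>2" if "1 \<le> \<bar>A w - A (p v)\<bar>"
      using that by (intro square_mono_dist) auto
    ultimately have "2 * gap \<le> (A w - A (p v))\<^sup>2" using gap by auto
    then show ?thesis using n ex[OF DM(1)[OF w]] AD(2)[OF w] Ap(2)[OF v] by (simp add: fits_def)
  qed
  have flip: "fits A h w u" if "fits A h u w" "u \<in> ?M" "w \<in> ?M" for u w
    using that ex by (auto simp: fits_def adj_commute[of w u] power2_commute[of "A w"])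
  have dM: "drawn ?M A h"
    unfolding drawn_def
  proof (intro conjI ballI impI)
    fix u w assume uw: "u \<in> ?M" "w \<in> ?M" "u \<noteq> w"
    have same: "fits A h u w" if "side u = side w"
      using that ex[OF uw(1)] ex[OF uw(2)] by (intro fits_same_side) auto
    from uw(1) consider "u \<in> D" "u \<noteq> w1" | v where "u = p v" "v \<in> D" "v \<noteq> w0"
      unfolding middle_def by blast
    then show "fits A h u w"
    proof cases
      case u: 1
      from uw(2) consider "w \<in> D" "w \<noteq> w1" | v where "w = p v" "v \<in> D" "v \<noteq> w0"
        unfolding middle_def by blast
      then show ?thesis
      proof cases
        case 1 then show ?thesis using same bs(2) u(1) by blast
      next
        case 2 then show ?thesis using mixed u by blast
      qed
    next
      case u: 2
      from uw(2) consider "w \<in> D" "w \<noteq> w1" | v where "w = p v" "v \<in> D" "v \<noteq> w0"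
        unfolding middle_def by blast
      then show ?thesis
      proof cases
        case 1 then show ?thesis using flip[OF mixed] u uw by blast
      next
        case 2 then show ?thesis using same bs(3) u(1,2) by blast
      qed
    qed
  qed (use M gap ex in force)+
  have LM: "fits A h u x \<and> fits A h x u" if u: "u \<in> L" and x: "x \<in> ?M" for u x
  proof -
    note m = M[OF x]
    from x consider "x \<in> D" "x \<noteq> w1" | v where "x = p v" "v \<in> D" "v \<noteq> w0"
      unfolding middle_def by blast
    then show ?thesis
    proof cases
      case 1
      show ?thesis
      proof (rule left_end_middle[OF lL u])
        assume "adj u x"
        then have "u = d \<or> u = p x" using bD(8)[OF 1] adj_sym by blast
        then have "u = p x" "x = w0" using u dis(3) mem pM(2)[OF 1(1)] by blast+
        then show "u = a \<or> (u = p w0 \<and> A x = -2)" using AD(1)[OF 1] by auto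
      next
        assume "\<not> adj (p w0) x"
        then have "x \<noteq> w0" using bD(6)[OF bD(1)] adj_sym by blast
        then show "-1 \<le> A x" using AD(1)[OF 1] pos[of x] by simp
      qed (use m ex[OF x] bs(2)[OF 1(1)] in auto)
    next
      case 2
      show ?thesis
      proof (rule left_end_middle[OF lL u])
        assume "adj u x"
        then have "u = v \<or> u = a" using bD(9)[OF 2(2,3)] 2(1) adj_sym by blast
        then show "u = a \<or> (u = p w0 \<and> A x = -2)"
          using u DM(2)[OF 2(2)] mem(4) dis(3) by blast
      next
        show "adj a x" using bD(7)[OF 2(2)] 2(1) adj_sym by blast
      next
        assume "side x \<noteq> side (p w0)"
        then show "-1 \<le> A x" using bs(3)[OF 2(2)] bs(3)[OF bD(1)] 2(1) by simp
      qed (use m ex[OF x] in auto)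
    qed
  qed
  have RM: "fits A h u x \<and> fits A h x u" if u: "u \<in> R" and x: "x \<in> ?M" for u x
  proof -
    note m = M[OF x]
    from x consider "x \<in> D" "x \<noteq> w1" | v where "x = p v" "v \<in> D" "v \<noteq> w0"
      unfolding middle_def by blast
    then have "fits (\<lambda>u. - A u) h u x \<and> fits (\<lambda>u. - A u) h x u"
    proof cases
      case 1
      show ?thesis
      proof (rule left_end_middle[OF lR u])
        assume "adj u x"
        then have "u = d \<or> u = p x" using bD(8)[OF 1] adj_sym by blast
        then show "u = d \<or> (u = w1 \<and> - A x = -2)"
          using u dis(3) mem pM(3)[OF 1(1)] by blast
      next
        show "adj d x" using bD(5)[OF 1(1)] adj_sym by blast
      next
        assume "side x \<noteq> side w1"
        then show "-1 \<le> - A x" using bs(2)[OF 1(1)] bs(2)[OF bD(2)] by simp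
      qed (use m ex[OF x] in auto)
    next
      case 2
      show ?thesis
      proof (rule left_end_middle[OF lR u])
        assume "adj u x"
        then have "u = v \<or> u = a" using bD(9)[OF 2(2,3)] 2(1) adj_sym by blast
        then have "u = v" "v = w1" using u DM(3)[OF 2(2)] mem(1) dis(3) by blast+
        then show "u = d \<or> (u = w1 \<and> - A x = -2)" using Ap(1)[OF 2(2,3)] 2(1) by simp
      next
        assume "\<not> adj w1 x"
        then have "v \<noteq> w1" using bD(6)[OF bD(2)] 2(1) by blast
        then show "-1 \<le> - A x" using Ap(1)[OF 2(2,3)] 2(1) pos[of v] by simp
      next
        assume "side x \<noteq> side d"
        then show "adj d x" using bs(1,3)[OF 2(2)] 2(1) by simp
      qed (use m ex[OF x] in auto)
    qed
    then show ?thesis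
      using fits_affine[where s = "-1" and t = 0 and A = A and A' = "\<lambda>u. - A u" and h = h and h' = h]
      by simp
  qed
  have LR: "fits A h u w \<and> fits A h w u" if u: "u \<in> L" and w: "w \<in> R" for u w
  proof -
    note bu = left_end_bound[OF lL u] and bw = left_end_bound[OF lR w]
    have "(- A u + A w)\<^sup>2 \<le> (A u - A w)\<^sup>2" by (simp add: power2_eq_square algebra_simps)
    \<comment> \<open>Both positions are at least 90 in absolute value; this bounds the cross term
      of the squared distance from below.\<close>
    moreover have "0 \<le> (- A u - 90) * (A w - 90)" using bu bw by simp
    ultimately have "h u + h w + 2 * gap \<le> (A u - A w)\<^sup>2"
      using bu bw gap by (simp add: power2_eq_square algebra_simps)
    then show ?thesis
      using fits_apart[of u w h A] nadj[OF u w] drawnD(1)[OF dL u] drawnD(1)[OF dR w] by blast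
  qed
  have "drawn (L \<union> ?M) A h" using dL dM LM by (rule drawn_union)
  then have "drawn (L \<union> ?M \<union> R) A h"
    by (rule drawn_union[OF _ dR]) (use LR RM in blast)
  then show ?thesis using that AL AR M by blast
qed

lemma bundle_drawable:
  assumes b: "path_bundle D p a d w0 w1" and L: "ended L a (p w0)" and R: "ended R d w1"
    and dis: "L \<inter> middle D p w0 w1 = {}" "R \<inter> middle D p w0 w1 = {}" "L \<inter> R = {}"
    and nadj: "\<And>u w. \<lbrakk>u \<in> L; w \<in> R\<rbrakk> \<Longrightarrow> \<not> adj u w"
    and ex: "\<And>u. u \<in> middle D p w0 w1 \<Longrightarrow> \<not> exposed u"
  shows "drawable (L \<union> middle D p w0 w1 \<union> R)"
proof -
  obtain A1 h1 A2 h2 where l: "left_end L a (p w0) A1 h1" "left_end R d w1 A2 h2"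
    using L R unfolding ended_def by blast
  show ?thesis
  proof (rule bundle_drawn[OF b l dis])
    show "\<not> adj u w" if "u \<in> L" "w \<in> R" for u w using that by (rule nadj)
    show "\<not> exposed u" if "u \<in> middle D p w0 w1" for u using that by (rule ex)
    fix A h assume "drawn (L \<union> middle D p w0 w1 \<union> R) A h"
    then show ?thesis unfolding drawable_def by blast
  qed
qed

context
  fixes D p a d w0 w1 L K
  assumes b: "path_bundle D p a d w0 w1" and L: "ended L a (p w0)"
    and dis: "L \<inter> middle D p w0 w1 = {}" "{d, w1} \<inter> middle D p w0 w1 = {}" "L \<inter> {d, w1} = {}"
    and nadj: "\<And>u w. \<lbrakk>u \<in> L; w \<in> {d, w1}\<rbrakk> \<Longrightarrow> \<not> adj u w"
    and ex: "\<And>u. u \<in> middle D p w0 w1 \<Longrightarrow> \<not> exposed u"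
    and K: "K = L \<union> middle D p w0 w1 \<union> {d, w1}"
begin

text \<open>The right end is the bare edge from \<open>d\<close> to \<open>w1\<close>, so the radii
  of both vertices and, within the limits of \<open>left_end\<close>, the position \<open>t\<close>
  of \<open>d\<close> can be chosen. After a shift by \<open>s\<close>, either vertex can serve as a
  root or belong to the attaching edge of a further bundle.\<close>

lemma bundle_two:
  assumes r: "r \<in> {100, 110}" "r' \<in> {100, 110}" "90 \<le> t" "t \<le> r - 3"
  obtains A h where "drawn K A h" "A d = t" "h d = r\<^sup>2" "A w1 = r' + 3/2" "h w1 = r'\<^sup>2"
    "\<And>u s. \<lbrakk>u \<in> K; u \<noteq> d; u \<noteq> w1; 198 \<le> s\<rbrakk> \<Longrightarrow> A u - s \<le> -90 \<and> h u + 1 \<le> (A u - s + 2)\<^sup>2"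
    "\<And>u s v. \<lbrakk>u \<in> K; u \<noteq> d; u \<noteq> w1; 107 \<le> s\<rbrakk> \<Longrightarrow> clear (\<lambda>u. A u - s) h v u"
proof -
  have dw: "adj d w1" using bundleD(5)[OF b bundleD(2)[OF b]] adj_sym by blast
  then have ne: "d \<noteq> w1" "side d \<noteq> side w1" using adj_side by blast+
  obtain A1 h1 where L': "left_end L a (p w0) A1 h1" using L unfolding ended_def by blast
  define A2 where "A2 u = (if u = d then - t else - r' - 3/2)" for u
  define h2 where "h2 u = (if u = d then r\<^sup>2 else r'\<^sup>2)" for u
  have sq: "r\<^sup>2 \<in> {10000, 12100}" "r'\<^sup>2 \<in> {10000, 12100}" using r by auto
  have "(A2 d - A2 w1)\<^sup>2 \<le> 30\<^sup>2"
    using r ne(1) by (intro square_dist_mono) (auto simp: A2_def)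
  then have "(A2 d - A2 w1)\<^sup>2 + gap \<le> h2 d + h2 w1" using sq gap ne(1) by (auto simp: h2_def)
  then have "drawn {d, w1} A2 h2"
    unfolding drawn_def using fits_adj[OF dw, of A2 h2] sq by (auto simp: h2_def)
  then have R: "left_end {d, w1} d w1 A2 h2"
    unfolding left_end_def using r ne by (auto simp: A2_def h2_def)
  show ?thesis
  proof (rule bundle_drawn[OF b L' R dis])
    show "\<not> adj u w" if "u \<in> L" "w \<in> {d, w1}" for u w using that by (rule nadj)
    show "\<not> exposed u" if "u \<in> middle D p w0 w1" for u using that by (rule ex)
    fix A h assume A: "drawn (L \<union> middle D p w0 w1 \<union> {d, w1}) A h"
    "\<And>u. u \<in> L \<Longrightarrow> A u = A1 u \<and> h u = h1 u"
    "\<And>u. u \<in> {d, w1} \<Longrightarrow> A u = - A2 u \<and> h u = h2 u"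
    "\<And>u. u \<in> middle D p w0 w1 \<Longrightarrow> -2 \<le> A u \<and> A u \<le> 2 \<and> h u \<le> gap"
    have l: "left_end L a (p w0) A h" using L' A(2) by (rule left_end_cong)
    have far: "h u + 10001 \<le> (A u - s)\<^sup>2 \<and> A u \<le> 2" if u: "u \<in> K" "u \<noteq> d" "u \<noteq> w1" "107 \<le> s" for u s
    proof (cases "u \<in> L")
      case True
      note bu = left_end_bound[OF l True]
      have "(107 - A u)\<^sup>2 \<le> (A u - s)\<^sup>2" using bu u(4) by (intro square_mono_dist) auto
      moreover have "(107 - A u)\<^sup>2 = (A u)\<^sup>2 - 214 * A u + 11449"
        by (simp add: power2_eq_square algebra_simps)
      ultimately show ?thesis using bu by simp
    next
      case False
      then have m: "-2 \<le> A u \<and> A u \<le> 2 \<and> h u \<le> gap" using A(4)[of u] u K by blast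
      have "105\<^sup>2 \<le> (A u - s)\<^sup>2" using m u(4) by (intro square_mono_dist) auto
      then show ?thesis using m gap by simp
    qed
    show ?thesis
    proof (rule that[of A h])
      show "drawn K A h" using A(1) K by simp
      show "A d = t" "h d = r\<^sup>2" "A w1 = r' + 3/2" "h w1 = r'\<^sup>2"
        using A(3)[of d] A(3)[of w1] ne(1) by (auto simp: A2_def h2_def)
      show "A u - s \<le> -90 \<and> h u + 1 \<le> (A u - s + 2)\<^sup>2"
        if "u \<in> K" "u \<noteq> d" "u \<noteq> w1" "198 \<le> s" for u s
        using far[OF that(1-3), of "s - 2"] that(4) by (simp add: algebra_simps)
      show "clear (\<lambda>u. A u - s) h v u" if "u \<in> K" "u \<noteq> d" "u \<noteq> w1" "107 \<le> s" for u s v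
        using far[OF that] that(4) by (auto simp: clear_def)
    qed
  qed
qed

text \<open>For the order \<open>d\<close>, \<open>w1\<close>, both are at 203/2, and the shift by
  203 brings \<open>w1\<close> to -100 - 3/2. For the other order, the shift by 397/2 brings
  \<open>w1\<close> from 203/2 to 3 - 100 and \<open>d\<close> from 97 to -100 - 3/2.\<close>

lemma bundle_ended: "ended K d w1" "ended K w1 d"
proof -
  have dw: "adj d w1" using bundleD(5)[OF b bundleD(2)[OF b]] adj_sym by blast
  then have s: "side d \<noteq> side w1" using adj_side by blast
  have m: "d \<in> K" "w1 \<in> K" using K by auto
  obtain A h where A: "drawn K A h" "A d = 203/2" "h d = 110\<^sup>2" "A w1 = 100 + 3/2" "h w1 = 100\<^sup>2"
    "\<And>u s. \<lbrakk>u \<in> K; u \<noteq> d; u \<noteq> w1; 198 \<le> s\<rbrakk> \<Longrightarrow> A u - s \<le> -90 \<and> h u + 1 \<le> (A u - s + 2)\<^sup>2"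
    by (rule bundle_two[of 110 100 "203/2"]) auto
  have "left_end K d w1 (\<lambda>u. A u + -203) h"
    unfolding left_end_def using A(2-5) A(6)[of _ 203] m s drawn_shift[OF A(1), of "-203"] by auto
  then show "ended K d w1" unfolding ended_def by blast
  obtain A h where A: "drawn K A h" "A d = 97" "h d = 100\<^sup>2" "A w1 = 100 + 3/2" "h w1 = 100\<^sup>2"
    "\<And>u s. \<lbrakk>u \<in> K; u \<noteq> d; u \<noteq> w1; 198 \<le> s\<rbrakk> \<Longrightarrow> A u - s \<le> -90 \<and> h u + 1 \<le> (A u - s + 2)\<^sup>2"
    by (rule bundle_two[of 100 100 97]) auto
  have "left_end K w1 d (\<lambda>u. A u + -(397/2)) h"
    unfolding left_end_def using A(2-5) A(6)[of _ "397/2"] m s drawn_shift[OF A(1), of "-(397/2)"] by auto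
  then show "ended K w1 d" unfolding ended_def by blast
qed

text \<open>The root gets radius 110 and the other vertex of the edge radius 100: its height may
  exceed 10000 only by less than its squared distance to the root, which is (11/2)^2 or
  (29/2)^2.\<close>

lemma bundle_rooted: "rooted K d" "rooted K w1"
proof -
  have dw: "adj d w1" using bundleD(5)[OF b bundleD(2)[OF b]] adj_sym by blast
  then have s: "side d \<noteq> side w1" using adj_side by blast
  have m: "d \<in> K" "w1 \<in> K" using K by auto
  obtain A h where A: "drawn K A h" "A d = 107" "h d = 110\<^sup>2" "A w1 = 100 + 3/2" "h w1 = 100\<^sup>2"
    "\<And>u s v. \<lbrakk>u \<in> K; u \<noteq> d; u \<noteq> w1; 107 \<le> s\<rbrakk> \<Longrightarrow> clear (\<lambda>u. A u - s) h v u"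
    by (rule bundle_two[of 110 100 107]) auto
  have "A w1 - 107 = -(11/2)" using A(4) by simp
  then have "clear (\<lambda>u. A u - 107) h d w1" using A(5) s by (simp add: clear_def power2_eq_square)
  then have "\<forall>u\<in>K - {d}. clear (\<lambda>u. A u - 107) h d u" using A(6)[of _ 107 d] by auto
  then show "rooted K d"
    unfolding rooted_def using A(2-5) m drawn_shift[OF A(1), of "-107"]
    by (intro exI[of _ "\<lambda>u. A u - 107"] exI[of _ h]) auto
  obtain A h where A: "drawn K A h" "A d = 97" "h d = 100\<^sup>2" "A w1 = 110 + 3/2" "h w1 = 110\<^sup>2"
    "\<And>u s v. \<lbrakk>u \<in> K; u \<noteq> d; u \<noteq> w1; 107 \<le> s\<rbrakk> \<Longrightarrow> clear (\<lambda>u. A u - s) h v u"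
    by (rule bundle_two[of 100 110 97]) auto
  have "A d - 223/2 = -(29/2)" using A(2) by simp
  then have "clear (\<lambda>u. A u - 223/2) h w1 d" using A(3) s by (simp add: clear_def power2_eq_square)
  then have "\<forall>u\<in>K - {w1}. clear (\<lambda>u. A u - 223/2) h w1 u" using A(6)[of _ "223/2" w1] by auto
  then show "rooted K w1"
    unfolding rooted_def using A(2-5) m drawn_shift[OF A(1), of "-(223/2)"]
    by (intro exI[of _ "\<lambda>u. A u - 223/2"] exI[of _ h]) auto
qed

end

end

section \<open>Decomposition of the graph\<close>

context bipartite_graph
begin

text \<open>The last conjunct keeps both ends of an isolated edge in \<open>core\<close>; thus the
  neighbour of a leaf is never a leaf.\<close>

definition leaf :: "'a \<Rightarrow> bool" where
  "leaf u \<longleftrightarrow> (\<exists>w. adj u w \<and> (\<forall>z. adj u z \<longrightarrow> z = w) \<and> (\<exists>z. adj w z \<and> z \<noteq> u))"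

definition core :: "'a set" where
  "core = {v \<in> V. \<not> leaf v}"

lemma core_two: "\<lbrakk>adj v x; adj v y; x \<noteq> y\<rbrakk> \<Longrightarrow> v \<in> core"
  unfolding core_def leaf_def using adj_V by blast

lemma core_next: "\<lbrakk>v \<in> core; adj v u; adj u t; t \<noteq> v\<rbrakk> \<Longrightarrow> \<exists>s. adj v s \<and> s \<noteq> u"
  unfolding core_def leaf_def by blast

lemma finite_core: "K \<subseteq> core \<Longrightarrow> finite K"
  using finite_V by (rule rev_finite_subset) (auto simp: core_def)

text \<open>\<open>K\<close> hangs on the rest of \<open>core\<close> only at vertices of
  \<open>S\<close>; for empty \<open>S\<close> it is a union of components of
  \<open>core\<close>.\<close>

definition closed_but :: "'a set \<Rightarrow> 'a set \<Rightarrow> bool" where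
  "closed_but S K \<longleftrightarrow> K \<subseteq> core \<and> (\<forall>u\<in>K - S. \<forall>w\<in>core. adj u w \<longrightarrow> w \<in> K)"

lemma closed_butD: "\<lbrakk>closed_but S K; u \<in> K; u \<notin> S; w \<in> core; adj u w\<rbrakk> \<Longrightarrow> w \<in> K"
  unfolding closed_but_def by blast

text \<open>A path of length three that leaves \<open>K\<close> at once: the third arm of a
  potential \<open>S333\<close>, and a pendant at \<open>v\<close> for hexagons inside
  \<open>K\<close>. Its last vertex may be a leaf.\<close>

definition outlet :: "'a set \<Rightarrow> 'a \<Rightarrow> bool" where
  "outlet K v \<longleftrightarrow> (\<exists>x y z. x \<notin> K \<and> adj v x \<and> adj x y \<and> y \<noteq> v \<and> adj y z \<and> z \<noteq> x)"

end

context X_graph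
begin

text \<open>\<open>K\<close> is what hangs on the edge \<open>a\<close>, \<open>b\<close> of a
  hexagon, typically of one in a bundle that was cut off. The hexagon is kept for its outlets at
  \<open>a\<close> and \<open>b\<close> and for \<open>C6_2l2_free\<close>.\<close>

definition hexagonal :: "'a set \<Rightarrow> 'a \<Rightarrow> 'a \<Rightarrow> bool" where
  "hexagonal K a b \<longleftrightarrow> a \<in> K \<and> b \<in> K \<and> closed_but {a, b} K \<and>
     (\<exists>c d e f. hexagon a b c d e f \<and> c \<notin> K \<and> d \<notin> K \<and> e \<notin> K \<and> f \<notin> K)"

lemma hexagonal_commute: "hexagonal K a b \<Longrightarrow> hexagonal K b a"
  unfolding hexagonal_def using hexagon_reflect by (metis insert_commute)

lemma bundle_hexagon:
  assumes b: "path_bundle D p a d w0 w1" and w: "w \<in> D" "w' \<in> D" "w \<noteq> w'"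
  shows "hexagon a (p w) w d w' (p w')"
proof -
  have "p w \<noteq> p w'" using bundle_inj[OF b] w by (auto simp: inj_on_def)
  moreover have "p w \<noteq> d"
  proof
    assume "p w = d"
    then have "adj a d" using bundleD(7)[OF b w(1)] adj_sym by simp
    moreover have "\<not> adj a d"
      if "p w \<noteq> p w'"
    proof -
      have "w' \<noteq> w0 \<or> w \<noteq> w0" using w by blast
      then show ?thesis
        using no_C4[of a "p w'" w' d] bundleD[OF b] w adj_sym that \<open>p w = d\<close> by metis
    qed
    ultimately show False using \<open>p w \<noteq> p w'\<close> by blast
  qed
  moreover have "p w' \<noteq> d"
  proof
    assume "p w' = d"
    then have "adj a d" using bundleD(7)[OF b w(2)] adj_sym by simp
    then show False
      using no_C4[of a "p w" w d] bundleD[OF b] w adj_sym \<open>p w \<noteq> d\<close> by metis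
  qed
  moreover have "a \<noteq> w" "a \<noteq> w'" using bundleD(4)[OF b] w by blast+
  ultimately show ?thesis
    unfolding hexagon_def using bundleD(5-7)[OF b] w adj_sym by metis
qed

lemma bundle_core:
  assumes b: "path_bundle D p a d w0 w1"
  shows "D \<subseteq> core" "p ` D \<subseteq> core" "a \<in> core" "d \<in> core"
proof -
  note h = bundle_hexagon[OF b bundleD(1,2,3)[OF b]]
  have "w \<in> core \<and> p w \<in> core" if w: "w \<in> D" for w
  proof -
    obtain w' where w': "w' \<in> D" "w \<noteq> w'" using bundleD(1-3)[OF b] by metis
    note h = hexagonD[OF bundle_hexagon[OF b w w']]
    have "w \<in> core" using core_two[OF adj_sym[OF h(2)] h(3)] h(10) by blast
    moreover have "p w \<in> core" using core_two[OF adj_sym[OF h(1)] h(2)] h(7) by blast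
    ultimately show ?thesis by blast
  qed
  then show "D \<subseteq> core" "p ` D \<subseteq> core" by auto
  show "a \<in> core" using core_two[OF hexagonD(1)[OF h] adj_sym[OF hexagonD(6)[OF h]]]
    hexagonD(11)[OF h] by blast
  show "d \<in> core" using core_two[OF hexagonD(4)[OF h] adj_sym[OF hexagonD(3)[OF h]]]
    hexagonD(9)[OF h] by blast
qed

text \<open>The required hexagon consists of the paths through \<open>w0\<close> and
  \<open>w1\<close>: apart from \<open>a\<close> and \<open>p w0\<close>, its vertices are in the
  middle or in \<open>R\<close>.\<close>

lemma bundle_left_hexagonal:
  assumes b: "path_bundle D p a d w0 w1"
    and L: "L = K - (middle D p w0 w1 \<union> R)" and K: "K \<subseteq> core"
    and R: "d \<in> R" "w1 \<in> R" "a \<notin> R" "p w0 \<notin> R" and mem: "a \<in> K" "p w0 \<in> K"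
    and closed: "\<And>u w. \<lbrakk>u \<in> L; w \<in> core; adj u w\<rbrakk> \<Longrightarrow> u = a \<or> u = p w0 \<or> w \<in> K"
    and nadj: "\<And>u w. \<lbrakk>u \<in> L; w \<in> R\<rbrakk> \<Longrightarrow> \<not> adj u w"
  shows "hexagonal L a (p w0)"
proof -
  note bD = bundleD[OF b] and bs = bundle_side[OF b]
  note h = bundle_hexagon[OF b bD(1,2,3)]
  have "a \<notin> p ` D" using bs(3) by auto
  then have "a \<notin> middle D p w0 w1" using bD(4) unfolding middle_def by blast
  moreover have "p w0 \<notin> middle D p w0 w1"
    using bs(2,3)[OF bD(1)] bs(2) bundle_inj[OF b] bD(1) unfolding middle_def inj_on_def by blast
  ultimately have "a \<in> L" "p w0 \<in> L" using L mem R by auto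
  moreover have "closed_but {a, p w0} L"
    unfolding closed_but_def
  proof (intro conjI ballI impI)
    show "L \<subseteq> core" using L K by blast
    fix u w assume u: "u \<in> L - {a, p w0}" and w: "w \<in> core" "adj u w"
    have "w \<in> K" using closed u w by blast
    moreover have "w \<notin> R" using nadj u w by blast
    moreover have "w \<notin> middle D p w0 w1"
    proof
      assume "w \<in> middle D p w0 w1"
      then consider "w \<in> D" "w \<noteq> w1" | v where "w = p v" "v \<in> D" "v \<noteq> w0"
        unfolding middle_def by blast
      then show False
      proof cases
        case 1
        then have "u = d \<or> u = p w" using bD(8) adj_sym[OF w(2)] by blast
        then show False using u L R(1) 1 unfolding middle_def by blast
      next
        case 2
        then have "u = v \<or> u = a" using bD(9) adj_sym[OF w(2)] by blast
        then show False using u L R(2) 2 unfolding middle_def by blast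
      qed
    qed
    ultimately show "w \<in> L" using L by blast
  qed
  moreover have "w0 \<notin> L" "d \<notin> L" "w1 \<notin> L" "p w1 \<notin> L"
    using L R bD(1-3) unfolding middle_def by blast+
  ultimately show ?thesis unfolding hexagonal_def using h by blast
qed

end

section \<open>The induction: parts that hang on a vertex\<close>

locale X_drawing = X_graph + drawing +
  assumes exposed_iff: "exposed v \<longleftrightarrow> (\<exists>u. adj v u \<and> leaf u)"
begin

lemma not_exposed:
  assumes "\<And>z. adj w z \<Longrightarrow> z \<in> core"
  shows "\<not> exposed w"
proof
  assume "exposed w"
  then obtain u where "adj w u" "leaf u" using exposed_iff by blast
  then show False using assms[of u] unfolding core_def by blast
qed

lemma bundle_not_exposed:
  assumes b: "path_bundle D p a d w0 w1" and u: "u \<in> middle D p w0 w1"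
  shows "\<not> exposed u"
proof (rule not_exposed)
  fix z assume z: "adj u z"
  from u consider "u \<in> D" "u \<noteq> w1" | v where "u = p v" "v \<in> D" "v \<noteq> w0"
    unfolding middle_def by blast
  then show "z \<in> core"
    using bundle_core[OF b] bundleD(8,9)[OF b] z by cases blast+
qed

text \<open>The induction hypothesis for the simultaneous construction of the three kinds of drawings.\<close>

definition drawable_below :: "nat \<Rightarrow> bool" where
  "drawable_below m \<longleftrightarrow>
     (\<forall>K. card K < m \<longrightarrow> closed_but {} K \<longrightarrow> drawable K) \<and>
     (\<forall>K v. card K < m \<longrightarrow> v \<in> K \<longrightarrow> closed_but {v} K \<longrightarrow> outlet K v \<longrightarrow> legged K v) \<and>
     (\<forall>K a b. card K < m \<longrightarrow> hexagonal K a b \<longrightarrow> ended K a b)"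

definition deep :: "'a set \<Rightarrow> 'a \<Rightarrow> 'a \<Rightarrow> bool" where
  "deep K v x \<longleftrightarrow> x \<in> K \<and> adj v x \<and> (\<exists>y\<in>core. adj x y \<and> y \<noteq> v)"

text \<open>The only possible neighbour of a leg in \<open>core\<close> is \<open>v\<close>, but it
  can have leaves. Legs may therefore be exposed and need height 10000.\<close>

definition legs :: "'a set \<Rightarrow> 'a \<Rightarrow> 'a set" where
  "legs K v = {x \<in> K. adj v x \<and> \<not> deep K v x}"

lemma legs_only: "\<lbrakk>l \<in> legs K v; u \<in> core; adj l u\<rbrakk> \<Longrightarrow> u = v"
  unfolding legs_def deep_def by blast

lemma legs_deep: "\<lbrakk>x \<in> K; adj v x; \<not> deep K v x\<rbrakk> \<Longrightarrow> x \<in> legs K v"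
  unfolding legs_def by blast

lemma legged_legs:
  assumes r: "rooted K0 v" and K: "K = K0 \<union> legs K v" "K \<subseteq> core" and dis: "K0 \<inter> legs K v = {}"
  shows "legged K v"
proof -
  have "legged (K0 \<union> legs K v) v"
  proof (rule rooted_legs[OF r _ dis])
    show "legs K v \<subseteq> V" using K(2) unfolding legs_def core_def by blast
    show "adj v l" if "l \<in> legs K v" for l using that unfolding legs_def by blast
    show "u = v" if "l \<in> legs K v" "u \<in> K0 \<union> legs K v" "adj l u" for l u
      using legs_only[OF that(1) _ that(3)] that(2) K by blast
  qed
  then show ?thesis using K(1) by simp
qed

text \<open>If \<open>w\<close> is the only deep neighbour, the edge from \<open>v\<close> to
  \<open>w\<close> is a bridge: \<open>v\<close> and its legs are removed, the rest is drawn with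
  root \<open>w\<close> by induction, and \<open>v\<close> is put to the right of it. Without a deep
  neighbour the rest is not connected to \<open>v\<close> and is moved far away. \<open>v\<close>
  itself needs no outlet here.\<close>

lemma legged_few_deep:
  assumes IH: "drawable_below (card K)" and v: "v \<in> K" and K: "closed_but {v} K"
    and w: "\<And>x. deep K v x \<Longrightarrow> x = w"
    and out: "deep K v w \<Longrightarrow> outlet (K - {v} - legs K v) w"
  shows "legged K v"
proof -
  let ?K = "K - {v} - legs K v"
  have Kc: "K \<subseteq> core" using K unfolding closed_but_def by blast
  have fin: "finite K" using finite_core[OF Kc] .
  have card: "card ?K < card K" using fin v by (intro psubset_card_mono) auto
  have vl: "v \<notin> legs K v" using adj_side[of v v] unfolding legs_def by blast
  have cl: "u' \<in> ?K" if "u \<in> ?K" "u' \<in> core" "adj u u'" "\<not> deep K v u" for u u'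
  proof -
    have "u' \<in> K" using closed_butD[OF K] that by blast
    moreover have "u' \<noteq> v" using that(1,3,4) adj_sym unfolding legs_def by blast
    moreover have "u' \<notin> legs K v" using legs_only[OF _ _ adj_sym[OF that(3)]] that(1) Kc by blast
    ultimately show ?thesis by blast
  qed
  have nv: "\<not> adj v u" if "u \<in> ?K" "\<not> deep K v u" for u
    using that legs_deep by blast
  have r: "rooted (insert v ?K) v"
  proof (cases "deep K v w")
    case True
    have wK: "w \<in> ?K"
      using True adj_side[of v v] unfolding deep_def legs_def by blast
    have "closed_but {w} ?K" unfolding closed_but_def using cl w Kc by blast
    then have "legged ?K w"
      using IH card wK out[OF True] unfolding drawable_below_def by blast
    then show ?thesis
    proof (rule legged_bridge)
      show "adj v w" using True unfolding deep_def by blast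
      show "u = w" if "u \<in> ?K" "adj v u" for u using nv[OF that(1)] that(2) w by blast
    qed blast
  next
    case False
    then have nd: "\<not> deep K v x" for x using w by blast
    then have "closed_but {} ?K" unfolding closed_but_def using cl Kc by blast
    then have "drawable ?K" using IH card unfolding drawable_below_def by blast
    then have "rooted ({v} \<union> ?K) v"
      by (rule rooted_union[OF rooted_singleton]) (use fin nv nd in auto)
    then show ?thesis by simp
  qed
  show ?thesis
    by (rule legged_legs[OF r _ Kc]) (use v vl in \<open>auto simp: legs_def\<close>)
qed

text \<open>Two arms of length three at \<open>v\<close> that start in \<open>K\<close>, together with the outlet, would form an
  \<open>S\<^sub>3\<^sub>,\<^sub>3\<^sub>,\<^sub>3\<close>.\<close>

lemma deep_common:
  assumes v: "v \<in> K" and K: "closed_but {v} K" and out: "outlet K v"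
    and x: "deep K v x" "deep K v x'" "x \<noteq> x'"
    and y: "adj x y" "y \<noteq> v" "y \<in> core" and y': "adj x' y'" "y' \<noteq> v" "y' \<in> core"
  obtains q where "adj y q" "adj q y'" "q \<noteq> x" "q \<noteq> x'" "q \<in> K" "y \<noteq> y'"
proof -
  obtain o1 o2 o3 where o: "o1 \<notin> K" "adj v o1" "adj o1 o2" "o2 \<noteq> v" "adj o2 o3" "o3 \<noteq> o1"
    using out unfolding outlet_def by blast
  have xv: "adj v x" "adj v x'" "x \<in> K" "x' \<in> K" using x unfolding deep_def by blast+
  have "x \<noteq> v" "x' \<noteq> v" using xv adj_side by blast+
  then have yK: "y \<in> K" "y' \<in> K" using closed_butD[OF K] xv y y' by blast+
  \<comment> \<open>The outlet cannot come back to \<open>K\<close>, since only \<open>v\<close> has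
    neighbours in \<open>core\<close> outside \<open>K\<close>.\<close>
  have o2K: "o2 \<notin> K"
    using closed_butD[OF K, of o2 o1] o core_two[OF adj_sym[OF o(2)] o(3)] adj_sym[OF o(3)] by blast
  have s: "side x = (\<not> side v)" "side x' = (\<not> side v)" "side y = side v" "side y' = side v"
    "side o1 = (\<not> side v)" "side o2 = side v" "side o3 = (\<not> side v)"
    using xv(1,2)[THEN adj_side_iff] y(1)[THEN adj_side_iff] y'(1)[THEN adj_side_iff]
      o(2,3,5)[THEN adj_side_iff] by simp_all
  have o3K: "o3 \<notin> K"
  proof
    assume "o3 \<in> K"
    moreover have "o3 \<noteq> v" using s by blast
    ultimately show False
      using closed_butD[OF K, of o3 o2] core_two[OF adj_sym[OF o(3)] o(5)] o(5,6) o2K adj_sym by blast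
  qed
  obtain z where z: "adj y z" "z \<noteq> x"
    using core_next[OF y(3) adj_sym[OF y(1)] adj_sym[OF xv(1)]] y(2) by blast
  obtain z' where z': "adj y' z'" "z' \<noteq> x'"
    using core_next[OF y'(3) adj_sym[OF y'(1)] adj_sym[OF xv(2)]] y'(2) by blast
  have no3: "\<not> adj y o3" if "y \<in> K" "y \<noteq> v" for y
  proof
    assume a: "adj y o3"
    have "o3 \<in> core" using core_two[OF adj_sym[OF o(5)] adj_sym[OF a]] o2K that by blast
    then show False using closed_butD[OF K that(1)] a o3K that by blast
  qed
  have no2: "\<not> adj o2 z" if "y \<in> K" "y \<noteq> v" "side y = side v" "adj y z" for y z
  proof
    assume a: "adj o2 z"
    have "z \<in> core" using core_two[OF adj_sym[OF a] adj_sym[OF that(4)]] o2K that by blast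
    then have zK: "z \<in> K" using closed_butD[OF K that(1)] that by blast
    have "z \<noteq> v" using adj_side[OF that(4)] that(3) by blast
    moreover have "o2 \<in> core" using core_two[OF adj_sym[OF o(3)] a] zK o(1) by blast
    ultimately show False using closed_butD[OF K zK, of o2] adj_sym[OF a] o2K by blast
  qed
  have ne: "o1 \<noteq> x" "o1 \<noteq> x'" using o(1) xv by blast+
  have "adj y z' \<or> adj y' z"
    using S333_free[OF o(2) xv(1,2) ne x(3) o(3) y(1) y'(1) o(4) y(2) y'(2) o(5) z(1) z'(1) o(6)
      z(2) z'(2)]
      no3[OF yK(1) y(2)] no3[OF yK(2) y'(2)] no2[OF yK(1) y(2) s(3) z(1)]
      no2[OF yK(2) y'(2) s(4) z'(1)] by blast
  moreover have n: "\<not> adj x y'" "\<not> adj x' y"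
    using no_C4[OF adj_sym[OF xv(1)] xv(2) y'(1) x(3) y'(2)[symmetric]]
      no_C4[OF adj_sym[OF xv(2)] xv(1) y(1) x(3)[symmetric] y(2)[symmetric]] by blast+
  ultimately obtain q where q: "adj y q" "adj q y'" "q \<noteq> x" "q \<noteq> x'"
    using z z' adj_sym by metis
  have yy: "y \<noteq> y'" using n y by blast
  have "q \<in> core" using core_two[OF adj_sym[OF q(1)] q(2)] yy by blast
  then have "q \<in> K" using closed_butD[OF K yK(1)] q(1) y(2) by blast
  then show ?thesis using that q yy by blast
qed

text \<open>At most one \<open>w\<close> and at most one \<open>p w\<close> branch, and not on the
  same path. These are chosen as \<open>w1\<close> and \<open>w0\<close>; if there is none, any
  choice does, and \<open>D\<close> has two elements to keep them distinct.\<close>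

lemma bundle_select:
  assumes D: "x \<in> D" "x' \<in> D" "x \<noteq> x'" "a \<notin> D"
    and path: "\<And>w. w \<in> D \<Longrightarrow> adj w d \<and> adj w (p w) \<and> adj (p w) a"
    and one: "\<And>w w'. \<lbrakk>w \<in> D; w' \<in> D; branching w d (p w); branching w' d (p w')\<rbrakk> \<Longrightarrow> w = w'"
    and onep: "\<And>w w'. \<lbrakk>w \<in> D; w' \<in> D; branching (p w) w a; branching (p w') w' a\<rbrakk> \<Longrightarrow> w = w'"
    and diff: "\<And>w. \<lbrakk>w \<in> D; branching w d (p w); branching (p w) w a\<rbrakk> \<Longrightarrow> False"
  obtains w0 w1 where "path_bundle D p a d w0 w1"
proof -
  have "\<exists>w0\<in>D. \<exists>w1\<in>D. w0 \<noteq> w1 \<and> (\<forall>w\<in>D. branching w d (p w) \<longrightarrow> w = w1) \<and>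
      (\<forall>w\<in>D. branching (p w) w a \<longrightarrow> w = w0)"
  proof (cases "\<exists>w\<in>D. branching w d (p w)")
    case True
    then obtain w1 where w1: "w1 \<in> D" "branching w1 d (p w1)" by blast
    show ?thesis
    proof (cases "\<exists>w\<in>D. branching (p w) w a")
      case True
      then obtain w0 where w0: "w0 \<in> D" "branching (p w0) w0 a" by blast
      then have "w0 \<noteq> w1" using diff w1 by blast
      then show ?thesis using w0 w1 one onep by blast
    next
      case False
      obtain w0 where "w0 \<in> D" "w0 \<noteq> w1" using D by metis
      then show ?thesis using False w1 one by blast
    qed
  next
    case F: False
    show ?thesis
    proof (cases "\<exists>w\<in>D. branching (p w) w a")
      case True
      then obtain w0 where w0: "w0 \<in> D" "branching (p w0) w0 a" by blast
      obtain w1 where "w1 \<in> D" "w0 \<noteq> w1" using D by metis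
      then show ?thesis using F w0 onep by blast
    next
      case False
      then show ?thesis using F D by blast
    qed
  qed
  then obtain w0 w1 where w: "w0 \<in> D" "w1 \<in> D" "w0 \<noteq> w1"
    "\<And>w. \<lbrakk>w \<in> D; branching w d (p w)\<rbrakk> \<Longrightarrow> w = w1"
    "\<And>w. \<lbrakk>w \<in> D; branching (p w) w a\<rbrakk> \<Longrightarrow> w = w0" by metis
  have "\<forall>w\<in>D - {w1}. \<forall>z. adj w z \<longrightarrow> z = d \<or> z = p w"
    using w(4) unfolding branching_def by blast
  moreover have "\<forall>w\<in>D - {w0}. \<forall>z. adj (p w) z \<longrightarrow> z = w \<or> z = a"
    using w(5) unfolding branching_def by blast
  ultimately have "path_bundle D p a d w0 w1"
    unfolding path_bundle_def using w(1-3) D(4) path by simp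
  then show ?thesis by (rule that)
qed

lemma branching_commute: "branching v x y \<longleftrightarrow> branching v y x"
  unfolding branching_def by blast

lemma branchingI: "\<lbrakk>adj v z; z \<noteq> x; z \<noteq> y\<rbrakk> \<Longrightarrow> branching v x y"
  unfolding branching_def by blast

text \<open>The bundle is the rightmost piece of \<open>K\<close>, with the bare edge from
  \<open>d\<close> to \<open>w1\<close> as its right end; what remains to the left falls under the
  induction hypothesis. \<open>X\<close> stands for legs that are put back later.\<close>

lemma bundle_extend:
  assumes IH: "drawable_below (card K)" and b: "path_bundle D p a d w0 w1"
    and K: "K \<subseteq> core" "D \<subseteq> K" "p ` D \<subseteq> K" "a \<in> K" "d \<in> K"
    and X: "X \<inter> D = {}" "X \<inter> p ` D = {}" "a \<notin> X" "d \<notin> X"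
    and closed: "\<And>u w. \<lbrakk>u \<in> K; u \<noteq> d; u \<noteq> w1; w \<in> core; adj u w\<rbrakk> \<Longrightarrow> w \<in> K"
    and nadj: "\<And>u w. \<lbrakk>u \<in> K - (middle D p w0 w1 \<union> ({d, w1} \<union> X)); w \<in> {d, w1} \<union> X\<rbrakk> \<Longrightarrow> \<not> adj u w"
  shows "rooted (K - X) d" "rooted (K - X) w1" "ended (K - X) d w1" "ended (K - X) w1 d"
proof -
  define L where "L = K - (middle D p w0 w1 \<union> ({d, w1} \<union> X))"
  note bD = bundleD[OF b] and bs = bundle_side[OF b]
  note h = hexagonD[OF bundle_hexagon[OF b bD(1,2,3)]]
  have mK: "middle D p w0 w1 \<subseteq> K" "middle D p w0 w1 \<inter> X = {}"
    using K X unfolding middle_def by blast+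
  have ad: "a \<noteq> d" "d \<notin> D" "p w0 \<noteq> w1" "w1 \<notin> p ` D"
    using bs(1)[OF bD(1)] bs(2,3) bD(1,2) by blast+
  have dp: "d \<notin> p ` D"
  proof
    assume "d \<in> p ` D"
    then obtain w where w: "w \<in> D" "d = p w" by blast
    obtain w' where "w' \<in> D" "w \<noteq> w'" using bD(1-3) by metis
    then show False using hexagonD(10)[OF bundle_hexagon[OF b w(1)]] w by blast
  qed
  have "hexagonal L a (p w0)"
  proof (rule bundle_left_hexagonal[OF b L_def K(1)])
    show "a \<notin> {d, w1} \<union> X" using ad bD(2,4) X by blast
    show "p w0 \<notin> {d, w1} \<union> X" using ad dp bD(1) X by blast
    show "u = a \<or> u = p w0 \<or> w \<in> K" if "u \<in> L" "w \<in> core" "adj u w" for u w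
      using closed[of u w] that unfolding L_def by blast
    show "\<not> adj u w" if "u \<in> L" "w \<in> {d, w1} \<union> X" for u w
      using nadj that unfolding L_def by blast
  qed (use K bD(1) in auto)
  moreover have "card L < card K"
    using finite_core[OF K(1)] K(5) unfolding L_def by (intro psubset_card_mono) auto
  ultimately have e: "ended L a (p w0)" using IH unfolding drawable_below_def by blast
  have dis: "L \<inter> middle D p w0 w1 = {}" "{d, w1} \<inter> middle D p w0 w1 = {}" "L \<inter> {d, w1} = {}"
    using ad dp unfolding L_def middle_def by blast+
  have n: "\<not> adj u w" if "u \<in> L" "w \<in> {d, w1}" for u w
    using nadj that unfolding L_def by blast
  have "w1 \<notin> X" "w1 \<in> K" using X(1) K(2) bD(2) by blast+
  then have KX: "K - X = L \<union> middle D p w0 w1 \<union> {d, w1}"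
    using mK K(5) X(4) unfolding L_def by blast
  show "rooted (K - X) d" "rooted (K - X) w1"
    using bundle_rooted[OF b e dis n bundle_not_exposed[OF b] KX] by blast+
  show "ended (K - X) d w1" "ended (K - X) w1 d"
    using bundle_ended[OF b e dis n bundle_not_exposed[OF b] KX] by blast+
qed

lemma deep_hexagon:
  assumes v: "v \<in> K" and K: "closed_but {v} K" and out: "outlet K v"
    and x: "deep K v x" "deep K v x'" "x \<noteq> x'"
    and y: "adj x y" "y \<noteq> v" "y \<in> core" and y': "adj x' y'" "y' \<noteq> v" "y' \<in> core"
  obtains q where "hexagon v x y q y' x'" "q \<in> K"
proof -
  obtain q where q: "adj y q" "adj q y'" "q \<noteq> x" "q \<noteq> x'" "q \<in> K" "y \<noteq> y'"
    using deep_common[OF v K out x y y'] by blast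
  moreover have "adj v x" "adj v x'" using x unfolding deep_def by blast+
  ultimately have "hexagon v x y q y' x'"
    unfolding hexagon_def using x y y' by (blast intro: adj_sym)
  then show ?thesis using that q(5) by blast
qed

lemma outlet_branching: "\<lbrakk>outlet K v; x \<in> K; y \<in> K\<rbrakk> \<Longrightarrow> branching v x y"
  unfolding outlet_def branching_def by blast

text \<open>Every deep neighbour \<open>x\<close> of \<open>v\<close> has just one way
  \<open>p x\<close> to go on. All these vertices have a common neighbour \<open>q\<close>, so that
  the paths from \<open>q\<close> to \<open>v\<close> form a bundle with \<open>v\<close> in the
  role of \<open>d\<close>. The outlet makes \<open>v\<close> branch on each hexagon, which limits
  the other branching vertices.\<close>

lemma legged_unique_next:
  assumes IH: "drawable_below (card K)" and v: "v \<in> K" and K: "closed_but {v} K"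
    and out: "outlet K v" and x12: "deep K v x1" "deep K v x2" "x1 \<noteq> x2"
    and uniq: "\<And>x y z. \<lbrakk>deep K v x; adj x y; y \<noteq> v; y \<in> core; adj x z; z \<noteq> v; z \<in> core\<rbrakk> \<Longrightarrow> y = z"
  shows "legged K v"
proof -
  have Kc: "K \<subseteq> core" using K unfolding closed_but_def by blast
  define p where "p x = (SOME y. adj x y \<and> y \<noteq> v \<and> y \<in> core)" for x
  have p: "adj x (p x)" "p x \<noteq> v" "p x \<in> core" "adj v x" "x \<in> K" if "deep K v x" for x
  proof -
    have "\<exists>y. adj x y \<and> y \<noteq> v \<and> y \<in> core" using that unfolding deep_def by blast
    then have "adj x (p x) \<and> p x \<noteq> v \<and> p x \<in> core" unfolding p_def by (rule someI_ex)
    then show "adj x (p x)" "p x \<noteq> v" "p x \<in> core" "adj v x" "x \<in> K"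
      using that unfolding deep_def by blast+
  qed
  have pK: "p x \<in> K" if "deep K v x" for x
  proof -
    have "x \<noteq> v" using adj_side[OF p(4)[OF that]] by blast
    then show ?thesis using closed_butD[OF K p(5)[OF that]] p(1,3)[OF that] by blast
  qed
  have ps: "side x = (\<not> side v)" "side (p x) = side v" if "deep K v x" for x
    using adj_side_iff[OF p(4)[OF that]] adj_side_iff[OF p(1)[OF that]] by simp_all
  have nx: "\<not> adj x' (p x)" if "deep K v x" "deep K v x'" "x \<noteq> x'" for x x'
    using no_C4[OF adj_sym[OF p(4)[OF that(2)]] p(4,1)[OF that(1)]] p(2)[OF that(1)] that(3) by blast
  have common: "\<exists>r. hexagon v x (p x) r (p x') x' \<and> r \<in> K"
    if "deep K v x" "deep K v x'" "x \<noteq> x'" for x x'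
    using deep_hexagon[OF v K out that p(1-3)[OF that(1)] p(1-3)[OF that(2)]] by blast
  obtain q where q: "hexagon v x1 (p x1) q (p x2) x2" "q \<in> K" using common[OF x12] by blast
  have bv: "branching v x x'" if "deep K v x" "deep K v x'" for x x'
    using outlet_branching[OF out] p(5) that by blast
  have qp: "adj (p x) q" if x: "deep K v x" for x
  proof -
    consider "x = x1" | "x = x2" | "x \<noteq> x1" "x \<noteq> x2" by blast
    then show ?thesis
    proof cases
      case 1 then show ?thesis using hexagonD(3)[OF q(1)] by blast
    next
      case 2 then show ?thesis using adj_sym[OF hexagonD(4)[OF q(1)]] by blast
    next
      case 3
      obtain r where r: "hexagon v x1 (p x1) r (p x) x" using common[OF x12(1) x] 3 by blast
      obtain s where s: "hexagon v x2 (p x2) s (p x) x" using common[OF x12(2) x] 3 by blast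
      note rD = hexagonD[OF r] and sD = hexagonD[OF s] and qD = hexagonD[OF q(1)]
      \<comment> \<open>Otherwise \<open>v\<close>, \<open>p x1\<close> and \<open>p x2\<close>,
        every second vertex of a hexagon, would all branch.\<close>
      have "r = q \<or> s = q"
      proof (rule ccontr)
        assume n: "\<not> ?thesis"
        have "branching (p x1) x1 q" by (rule branchingI[OF rD(3)]) (use rD(10) n in auto)
        moreover have "branching (p x2) q x2" by (rule branchingI[OF sD(3)]) (use sD(10) n in auto)
        ultimately show False by (rule C6_3nc_free[OF q(1) bv[OF x12(2,1)]])
      qed
      then show ?thesis using adj_sym[OF rD(4)] adj_sym[OF sD(4)] by blast
    qed
  qed
  have qs: "side q = (\<not> side v)" using hexagon_side(3)[OF q(1)] .
  have qD: "\<not> deep K v q"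
  proof
    assume dq: "deep K v q"
    have "q = x1" using nx[OF x12(1) dq] adj_sym[OF qp[OF x12(1)]] by blast
    then show False using hexagonD(10)[OF q(1)] by blast
  qed
  have hex: "hexagon v x (p x) q (p x') x'" if d: "deep K v x" "deep K v x'" "x \<noteq> x'" for x x'
  proof -
    obtain r where "hexagon v x (p x) r (p x') x'" using common[OF d] by blast
    note rD = hexagonD[OF this]
    show ?thesis
      unfolding hexagon_def
      using rD(1,2,5-8,9,11) qp[OF d(1)] adj_sym[OF qp[OF d(2)]] qD d by blast
  qed
  let ?D = "{x. deep K v x}"
  obtain w0 w1 where b: "path_bundle ?D p q v w0 w1"
  proof (rule bundle_select[of x1 ?D x2 q v p])
    show "x1 \<in> ?D" "x2 \<in> ?D" "x1 \<noteq> x2" "q \<notin> ?D" using x12 qD by auto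
    show "adj w v \<and> adj w (p w) \<and> adj (p w) q" if "w \<in> ?D" for w
      using p(1,4) qp that adj_sym by blast
    show "w = w'" if w: "w \<in> ?D" "w' \<in> ?D" "branching w v (p w)" "branching w' v (p w')" for w w'
    proof (rule ccontr)
      assume ne: "w \<noteq> w'"
      have d: "deep K v w" "deep K v w'" using w by auto
      have "hexagon w' v w (p w) q (p w')"
        using hex[OF d ne] unfolding hexagon_def by metis
      then show False
        using C6_3c_free[of w' v w "p w" q "p w'"] bv[OF d(2,1)] w(3,4) branching_commute by blast
    qed
    show "w = w'" if w: "w \<in> ?D" "w' \<in> ?D" "branching (p w) w q" "branching (p w') w' q" for w w'
    proof (rule ccontr)
      assume ne: "w \<noteq> w'"
      have d: "deep K v w" "deep K v w'" using w by auto
      show False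
        using C6_3nc_free[OF hex[OF d ne] bv[OF d(2,1)] w(3)] w(4) branching_commute by blast
    qed
    show False if w: "w \<in> ?D" "branching w v (p w)" "branching (p w) w q" for w
    proof -
      obtain w' where ne: "w \<noteq> w'" "deep K v w'" using x12 by metis
      have d: "deep K v w" using w by auto
      show False
        using C6_3c_free[OF hex[OF d ne(2,1)] bv[OF ne(2) d] w(2,3)] .
    qed
  qed
  note bD = bundleD[OF b]
  have nvq: "\<not> adj v q"
    using no_C4[OF p(4,1)[OF x12(1)] qp[OF x12(1)]] p(2)[OF x12(1)] hexagonD(10)[OF q(1)] by blast
  have r: "rooted (K - legs K v) v"
  proof (rule bundle_extend(1)[OF IH b Kc])
    show "?D \<subseteq> K" "p ` ?D \<subseteq> K" using p(5) pK by auto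
    show "legs K v \<inter> ?D = {}" unfolding legs_def by blast
    have "u \<noteq> p w" if "u \<in> legs K v" "deep K v w" for u w
      using adj_side[of v u] ps(2)[OF that(2)] that(1) unfolding legs_def by auto
    then show "legs K v \<inter> p ` ?D = {}" by blast
    show "q \<notin> legs K v" using nvq unfolding legs_def by blast
    show "v \<notin> legs K v" using adj_side[of v v] unfolding legs_def by blast
    show "w \<in> K" if "u \<in> K" "u \<noteq> v" "u \<noteq> w1" "w \<in> core" "adj u w" for u w
      using closed_butD[OF K] that by blast
    fix u w assume u: "u \<in> K - (middle ?D p w0 w1 \<union> ({v, w1} \<union> legs K v))"
      and w: "w \<in> {v, w1} \<union> legs K v"
    then consider "w = v" | "w = w1" | "w \<in> legs K v" by blast
    then show "\<not> adj u w"
    proof cases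
      case 1
      show ?thesis
      proof
        assume "adj u w"
        then have "adj v u" using 1 adj_sym by blast
        then have "u \<in> ?D" using u legs_deep by blast
        then show False using u unfolding middle_def by blast
      qed
    next
      case 2
      show ?thesis
      proof
        assume "adj u w"
        then have "adj w1 u" using 2 adj_sym by blast
        then have "u = p w1" using uniq[of w1 u "p w1"] bD(2) u p Kc by blast
        then show False using u bD(2,3) unfolding middle_def by blast
      qed
    next
      case 3
      then show ?thesis using legs_only[OF 3, of u] u Kc adj_sym by blast
    qed
  qed (use q v in auto)
  show ?thesis by (rule legged_legs[OF r _ Kc]) (auto simp: legs_def)
qed

text \<open>Now \<open>x1\<close> is where paths fan out, so the bundle has \<open>x1\<close> as
  \<open>d\<close> and the next vertex \<open>y2\<close> behind \<open>x2\<close> as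
  \<open>a\<close>. The vertex \<open>v\<close> is one of the elements of \<open>D\<close>, the only
  one that branches, hence \<open>w1\<close>; its path continues with
  \<open>p v = x2\<close>.\<close>

lemma legged_two_next:
  assumes IH: "drawable_below (card K)" and v: "v \<in> K" and K: "closed_but {v} K"
    and out: "outlet K v" and x12: "deep K v x1" "deep K v x2" "x1 \<noteq> x2"
    and y: "adj x1 y" "y \<noteq> v" "y \<in> core" and y': "adj x1 y'" "y' \<noteq> v" "y' \<in> core" and "y \<noteq> y'"
  shows "legged K v"
proof -
  have Kc: "K \<subseteq> core" using K unfolding closed_but_def by blast
  have vx: "adj v x1" "adj v x2" "x1 \<in> K" "x2 \<in> K" using x12 unfolding deep_def by blast+
  have xv: "x1 \<noteq> v" "x2 \<noteq> v" using vx adj_side by blast+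
  obtain y2 where y2: "adj x2 y2" "y2 \<noteq> v" "y2 \<in> core" using x12 unfolding deep_def by blast
  have y2K: "y2 \<in> K" using closed_butD[OF K vx(4)] xv y2 by blast
  define Y where "Y = {y \<in> core. adj x1 y \<and> y \<noteq> v}"
  have Y: "adj x1 w" "w \<noteq> v" "w \<in> core" if "w \<in> Y" for w using that unfolding Y_def by blast+
  have yY: "y \<in> Y" "y' \<in> Y" using y y' unfolding Y_def by blast+
  define q where "q w = (SOME q. hexagon v x1 w q y2 x2 \<and> q \<in> K)" for w
  have q: "hexagon v x1 w (q w) y2 x2" "q w \<in> K" if "w \<in> Y" for w
  proof -
    have "\<exists>q. hexagon v x1 w q y2 x2 \<and> q \<in> K"
      using deep_hexagon[OF v K out x12 Y[OF that] y2] by blast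
    then have "hexagon v x1 w (q w) y2 x2 \<and> q w \<in> K" unfolding q_def by (rule someI_ex)
    then show "hexagon v x1 w (q w) y2 x2" "q w \<in> K" by blast+
  qed
  have bv: "branching v x x'" if "x \<in> K" "x' \<in> K" for x x'
    using outlet_branching[OF out that] .
  have bx1: "branching x1 v w" if w: "w \<in> Y" for w
  proof -
    obtain w' where "w' \<in> Y" "w' \<noteq> w" using yY \<open>y \<noteq> y'\<close> by metis
    then show ?thesis using branchingI[of x1 w' v w] Y by blast
  qed
  have Nx2: "z = v \<or> z = y2" if "adj x2 z" for z
  proof (rule ccontr)
    assume "\<not> ?thesis"
    then have "branching x2 y2 v" using branchingI[OF that] by blast
    moreover have "hexagon x2 v x1 y (q y) y2" using q(1)[OF yY(1)] unfolding hexagon_def by metis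
    ultimately show False using C6_3c_free bv[OF vx(4,3)] bx1[OF yY(1)] by blast
  qed
  have NY: "z = x1 \<or> z = q w" if w: "w \<in> Y" and z: "adj w z" for w z
  proof (rule ccontr)
    assume "\<not> ?thesis"
    then have "branching w x1 (q w)" using branchingI[OF z] by blast
    then show False using C6_3c_free[OF q(1)[OF w] bv[OF vx(4,3)] bx1[OF w]] by blast
  qed
  have qinj: "w = w'" if "w \<in> Y" "w' \<in> Y" "q w = q w'" for w w'
    using C4_free[OF Y(1)[OF that(1)] hexagonD(3)[OF q(1)[OF that(1)]]
      adj_sym[OF hexagonD(3)[OF q(1)[OF that(2)]], folded that(3)] adj_sym[OF Y(1)[OF that(2)]]]
      hexagonD(10)[OF q(1)[OF that(1)]] by blast
  have nx1y2: "\<not> adj x1 y2"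
    using no_C4[OF adj_sym[OF vx(1)] vx(2) y2(1)] x12(3) y2(2) by blast
  \<comment> \<open>A vertex behind a third deep neighbour would be adjacent to \<open>q w\<close>
    for all \<open>w\<close> in \<open>Y\<close>, as \<open>y2\<close> is; but \<open>q y\<close>
    and \<open>q y'\<close> have only one common neighbour.\<close>
  have only: "x = x1 \<or> x = x2" if x: "deep K v x" for x
  proof (rule ccontr)
    assume n: "\<not> ?thesis"
    obtain y3 where y3: "adj x y3" "y3 \<noteq> v" "y3 \<in> core" using x unfolding deep_def by blast
    have vx3: "adj v x" using x unfolding deep_def by blast
    have "y3 \<noteq> y2"
      using C4_free[OF vx(2) y2(1) _ adj_sym[OF vx3]] y2(2) adj_sym[OF y3(1)] n by blast
    have "adj (q w) y3" if w: "w \<in> Y" for w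
    proof -
      obtain r where r: "hexagon v x1 w r y3 x"
        using deep_hexagon[OF v K out x12(1) x _ Y[OF w] y3] n by blast
      have "r = q w" using NY[OF w hexagonD(3)[OF r]] hexagonD(10)[OF r] by blast
      then show ?thesis using hexagonD(4)[OF r] by blast
    qed
    then have "y2 = y3"
      using C4_free[OF adj_sym[OF hexagonD(4)[OF q(1)[OF yY(1)]]] _ adj_sym
          hexagonD(4)[OF q(1)[OF yY(2)]], of y3] qinj[OF yY] \<open>y \<noteq> y'\<close> yY
        C4_free[OF hexagonD(4)[OF q(1)[OF yY(1)]] adj_sym[OF hexagonD(4)[OF q(1)[OF yY(2)]]], of y3]
        adj_sym by metis
    then show False using \<open>y3 \<noteq> y2\<close> by blast
  qed
  have qs: "side w = side v" "side (q w) = (\<not> side v)" "q w \<noteq> x1" "q w \<noteq> x2" if "w \<in> Y" for w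
    using hexagon_side[OF q(1)[OF that]] hexagonD(10,12)[OF q(1)[OF that]] by auto
  have s: "side x1 = (\<not> side v)" "side x2 = (\<not> side v)" "side y2 = side v"
    using hexagon_side[OF q(1)[OF yY(1)]] by auto
  have YK: "w \<in> K" if "w \<in> Y" for w using closed_butD[OF K vx(3)] xv Y[OF that] by blast
  define p where "p w = (if w = v then x2 else q w)" for w
  have pv: "p v = x2" and pY: "\<And>w. w \<in> Y \<Longrightarrow> p w = q w" using Y(2) by (auto simp: p_def)
  let ?D = "insert v Y"
  have onep: "w = w'" if "w \<in> Y" "w' \<in> Y" "branching (q w) w y2" "branching (q w') w' y2" for w w'
  proof (rule ccontr)
    assume ne: "w \<noteq> w'"
    note h = hexagonD[OF q(1)[OF that(1)]] and h' = hexagonD[OF q(1)[OF that(2)]]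
    have "hexagon (q w) y2 (q w') w' x1 w"
      unfolding hexagon_def using h h' ne qinj[OF that(1,2)] adj_sym by metis
    moreover have "branching y2 (q w) (q w')"
      using branchingI[OF adj_sym[OF y2(1)]] qs(4)[OF that(1)] qs(4)[OF that(2)] by metis
    moreover have "branching (q w') y2 w'" using that(4) branching_commute by blast
    ultimately show False using C6_3c_free that(3) by blast
  qed
  obtain w0 where w0: "w0 \<in> Y" "\<And>w. \<lbrakk>w \<in> Y; branching (q w) w y2\<rbrakk> \<Longrightarrow> w = w0"
  proof (cases "\<exists>w\<in>Y. branching (q w) w y2")
    case True
    then show ?thesis using that onep by blast
  next
    case False
    then show ?thesis using that yY by blast
  qed
  have w0v: "w0 \<noteq> v" using Y(2) w0(1) by blast
  have b: "path_bundle ?D p y2 x1 w0 v"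
    unfolding path_bundle_def
  proof (intro conjI ballI allI impI)
    show "y2 \<notin> ?D" using Y(1) nx1y2 y2(2) by blast
    fix w assume w: "w \<in> ?D"
    show "adj w x1" using w vx(1) Y(1) adj_sym by blast
    show "adj w (p w)" using w pv pY vx(2) hexagonD(3)[OF q(1)] by auto
    show "adj (p w) y2" using w pv pY y2(1) hexagonD(4)[OF q(1)] by auto
  next
    fix w z assume w: "w \<in> ?D - {v}" "adj w z"
    then have "w \<in> Y" by blast
    then show "z = x1 \<or> z = p w" using NY[OF _ w(2)] pY[of w] by simp
  next
    fix w z assume w: "w \<in> ?D - {w0}" "adj (p w) z"
    show "z = w \<or> z = y2"
    proof (cases "w = v")
      case True
      then show ?thesis using Nx2 w pv by auto
    next
      case False
      then have "w \<in> Y" "\<not> branching (q w) w y2" using w w0(2) by blast+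
      then show ?thesis using w(2) pY unfolding branching_def by auto
    qed
  qed (simp_all add: w0(1) w0v)
  have ls: "side l = (\<not> side v)" "\<not> deep K v l" "adj v l" if "l \<in> legs K v" for l
  proof -
    show "adj v l" "\<not> deep K v l" using that unfolding legs_def by blast+
    then show "side l = (\<not> side v)" by (simp add: adj_side_iff)
  qed
  have r: "rooted (K - legs K v) v"
  proof (rule bundle_extend(2)[OF IH b Kc])
    show "?D \<subseteq> K" using v YK by blast
    show "p ` ?D \<subseteq> K" using pv pY vx(4) q(2) by auto
    have "l \<notin> ?D" if "l \<in> legs K v" for l using ls(1)[OF that] qs(1)[of l] by auto
    then show "legs K v \<inter> ?D = {}" by blast
    have "l \<noteq> q w" if "l \<in> legs K v" "w \<in> Y" for l w
    proof
      assume "l = q w"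
      then have "adj v (q w)" using ls(3)[OF that(1)] by blast
      then show False
        using no_C4[OF vx(1) Y(1)[OF that(2)] hexagonD(3)[OF q(1)[OF that(2)]]]
          Y(2)[OF that(2)] qs(3)[OF that(2)] by blast
    qed
    then show "legs K v \<inter> p ` ?D = {}" using ls(2) x12(2) pv pY by auto
    show "y2 \<notin> legs K v" using ls(1)[of y2] s(3) by auto
    show "x1 \<notin> legs K v" using ls(2) x12(1) by blast
    show "w \<in> K" if "u \<in> K" "u \<noteq> x1" "u \<noteq> v" "w \<in> core" "adj u w" for u w
      using closed_butD[OF K] that by blast
    fix u w assume u: "u \<in> K - (middle ?D p w0 v \<union> ({x1, v} \<union> legs K v))"
      and w: "w \<in> {x1, v} \<union> legs K v"
    then consider "w = x1" | "w = v" | "w \<in> legs K v" by blast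
    then show "\<not> adj u w"
    proof cases
      case 1
      show ?thesis
      proof
        assume "adj u w"
        then have "u \<in> Y" using 1 adj_sym u Kc unfolding Y_def by blast
        then show False using u Y(2) unfolding middle_def by blast
      qed
    next
      case 2
      show ?thesis
      proof
        assume "adj u w"
        then have "adj v u" using 2 adj_sym by blast
        then have "u = x1 \<or> u = x2" using u legs_deep only by blast
        moreover have "x2 \<in> middle ?D p w0 v" using pv w0v unfolding middle_def by force
        ultimately show False using u by blast
      qed
    next
      case 3
      then show ?thesis using legs_only[OF 3, of u] u Kc adj_sym by blast
    qed
  qed (use y2K vx in auto)
  show ?thesis by (rule legged_legs[OF r _ Kc]) (auto simp: legs_def)
qed

lemma legged_step:
  assumes IH: "drawable_below (card K)" and v: "v \<in> K" and K: "closed_but {v} K" and out: "outlet K v"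
  shows "legged K v"
proof (cases "\<exists>w. \<forall>x. deep K v x \<longrightarrow> x = w")
  case True
  then obtain w where w: "\<And>x. deep K v x \<Longrightarrow> x = w" by blast
  show ?thesis
  proof (rule legged_few_deep[OF IH v K w])
    assume "deep K v w"
    then have "adj w v" "w \<in> K" using adj_sym unfolding deep_def by blast+
    \<comment> \<open>The outlet of \<open>w\<close> runs through \<open>v\<close> and the first two
      vertices of the outlet of \<open>v\<close>.\<close>
    then show "outlet (K - {v} - legs K v) w" using out unfolding outlet_def by blast
  qed
next
  case False
  then obtain x1 x2 where x12: "deep K v x1" "deep K v x2" "x1 \<noteq> x2" by metis
  show ?thesis
  proof (cases "\<exists>x y z. deep K v x \<and> adj x y \<and> y \<noteq> v \<and> y \<in> core \<and> adj x z \<and> z \<noteq> v \<and> z \<in> core \<and> y \<noteq> z")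
    case True
    then obtain x y z where x: "deep K v x" and y: "adj x y" "y \<noteq> v" "y \<in> core"
      and z: "adj x z" "z \<noteq> v" "z \<in> core" "y \<noteq> z" by blast
    obtain x' where "deep K v x'" "x \<noteq> x'" using x12 by metis
    then show ?thesis using legged_two_next[OF IH v K out x _ _ y z] by blast
  next
    case False
    show ?thesis by (rule legged_unique_next[OF IH v K out x12]) (use False in blast)
  qed
qed

section \<open>The induction: parts that hang on an edge of a hexagon\<close>

lemma hexagonal_pairs:
  assumes K: "hexagonal K a b" and x: "x \<in> K" "adj a x" "x \<noteq> b" and x': "x' \<in> K" "adj b x'" "x' \<noteq> a"
    and y: "adj x y" "y \<noteq> a" and y': "adj x' y'" "y' \<noteq> b"
  shows "adj y y'"
proof -
  obtain c d e f where h: "hexagon a b c d e f" and o: "c \<notin> K" "d \<notin> K" "e \<notin> K" "f \<notin> K"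
    and cl: "closed_but {a, b} K" using K unfolding hexagonal_def by blast
  note hD = hexagonD[OF h]
  have s: "side b = (\<not> side a)" "side x = (\<not> side a)" "side x' = side a" "side y = side a"
    "side y' = (\<not> side a)"
    using adj_side_iff[OF hD(1)] adj_side_iff[OF x(2)] adj_side_iff[OF x'(2)]
      adj_side_iff[OF y(1)] adj_side_iff[OF y'(1)] by simp_all
  \<comment> \<open>The tails \<open>x\<close>, \<open>y\<close> at \<open>a\<close> and
    \<open>x'\<close>, \<open>y'\<close> at \<open>b\<close> are in question. The first two
    alternatives would connect \<open>K\<close> with the rest of \<open>core\<close> elsewhere than
    at \<open>a\<close> and \<open>b\<close>.\<close>
  have "adj y d \<or> adj y' e \<or> adj y y'"
    using C6_2l2_free[OF h x(2,3) _ y x'(2) _ x'(3) y'] o x(1) x'(1) by blast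
  moreover have "\<not> adj y d"
  proof
    assume yd: "adj y d"
    have "y \<in> core" using core_two[OF adj_sym[OF y(1)] yd] x(1) o(2) by blast
    moreover have "x \<noteq> a" "y \<noteq> b" using s by auto
    ultimately have "y \<in> K" using closed_butD[OF cl x(1)] x(3) y(1) by blast
    moreover have "d \<in> core" using core_two[OF hD(4) adj_sym[OF hD(3)]] hD(9) by blast
    ultimately show False using closed_butD[OF cl, of y d] yd y(2) \<open>y \<noteq> b\<close> o(2) by blast
  qed
  moreover have "\<not> adj y' e"
  proof
    assume ye: "adj y' e"
    have "y' \<in> core" using core_two[OF adj_sym[OF y'(1)] ye] x'(1) o(3) by blast
    moreover have "x' \<noteq> b" "y' \<noteq> a" using s by auto
    ultimately have "y' \<in> K" using closed_butD[OF cl x'(1)] x'(3) y'(1) by blast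
    moreover have "e \<in> core" using core_two[OF hD(5) adj_sym[OF hD(4)]] hD(12) by blast
    ultimately show False using closed_butD[OF cl, of y' e] ye y'(2) \<open>y' \<noteq> a\<close> o(3) by blast
  qed
  ultimately show ?thesis by blast
qed

text \<open>All vertices behind the neighbours of \<open>a\<close> are adjacent to the same vertex
  \<open>y'\<close> behind \<open>x'\<close>. So the paths from \<open>y'\<close> to
  \<open>a\<close> form a bundle, with \<open>b\<close> as one of the elements of \<open>D\<close>
  and \<open>p b = x'\<close>. Both orders are concluded, so that \<open>a\<close> and
  \<open>b\<close> can be exchanged later.\<close>

lemma ended_one:
  assumes IH: "drawable_below (card K)" and K: "hexagonal K a b"
    and x0: "x0 \<in> K" "adj a x0" "x0 \<noteq> b" and x': "x' \<in> K" "adj b x'" "x' \<noteq> a"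
    and only: "\<And>z. \<lbrakk>z \<in> K; adj b z\<rbrakk> \<Longrightarrow> z = a \<or> z = x'"
  shows "ended K a b" "ended K b a"
proof -
  have cl: "closed_but {a, b} K" and aK: "a \<in> K" "b \<in> K" and ab: "adj a b"
    using K hexagonD(1) unfolding hexagonal_def by blast+
  have Kc: "K \<subseteq> core" using cl unfolding closed_but_def by blast
  define N where "N = {x \<in> K. adj a x \<and> x \<noteq> b}"
  have N: "x \<in> K" "adj a x" "x \<noteq> b" if "x \<in> N" for x using that unfolding N_def by blast+
  have x0N: "x0 \<in> N" using x0 unfolding N_def by blast
  have nb: "\<exists>y. adj x y \<and> y \<noteq> a" if "x \<in> N" for x
    using core_next[OF _ adj_sym[OF N(2)[OF that]] ab] N[OF that] Kc by blast
  define y where "y x = (SOME y. adj x y \<and> y \<noteq> a)" for x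
  have y: "adj x (y x)" "y x \<noteq> a" if "x \<in> N" for x
    using someI_ex[OF nb[OF that]] unfolding y_def by blast+
  obtain y' where y': "adj x' y'" "y' \<noteq> b"
    using core_next[OF _ adj_sym[OF x'(2)] adj_sym[OF ab]] x' Kc by blast
  have yy: "adj z y'" if "x \<in> N" "adj x z" "z \<noteq> a" for x z
    using hexagonal_pairs[OF K N[OF that(1)] x' that(2,3) y'] .
  have nxx: "\<not> adj x' x" if "x \<in> N" for x
    using no_C4[OF adj_sym[OF x'(2)] adj_sym[OF ab] N(2)[OF that] x'(3)] N(3)[OF that] by blast
  have nay: "\<not> adj a y'"
    using no_C4[OF ab x'(2) y'(1) x'(3)[symmetric]] y'(2) by blast
  have xy': "x \<noteq> y'" "x' \<noteq> y x" if "x \<in> N" for x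
    using nxx[OF that] y'(1) y(1)[OF that] adj_sym by blast+
  have Nx: "z = a \<or> z = y x" if x: "x \<in> N" "adj x z" for x z
    using C4_free[OF x(2) yy[OF x] adj_sym[OF yy[OF x(1) y[OF x(1)]]] adj_sym[OF y(1)[OF x(1)]]
      xy'(1)[OF x(1)]] by blast
  have Nx': "z = b \<or> z = y'" if z: "adj x' z" for z
  proof (rule ccontr)
    assume n: "\<not> ?thesis"
    have "adj (y x0) z"
      using hexagonal_pairs[OF K N[OF x0N] x' y[OF x0N] z] n by blast
    then show False
      using C4_free[OF z adj_sym yy[OF x0N y[OF x0N]] adj_sym[OF y'(1)]] xy'(2)[OF x0N] n by blast
  qed
  have yinj: "w = w'" if "w \<in> N" "w' \<in> N" "y w = y w'" for w w'
    using C4_free[OF N(2)[OF that(1)] y(1)[OF that(1)] _ adj_sym[OF N(2)[OF that(2)]], OF _ y(2)[symmetric, OF that(1)]]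
      adj_sym[OF y(1)[OF that(2)]] that(3) by simp
  have onep: "w = w'" if w: "w \<in> N" "w' \<in> N" "branching (y w) w y'" "branching (y w') w' y'" for w w'
  proof (rule ccontr)
    assume ne: "w \<noteq> w'"
    have "hexagon (y w) y' (y w') w' a w"
      unfolding hexagon_def
      using yy[OF w(1) y[OF w(1)]] adj_sym[OF yy[OF w(2) y[OF w(2)]]] adj_sym[OF y(1)[OF w(2)]]
        adj_sym[OF N(2)[OF w(2)]] N(2)[OF w(1)] y(1)[OF w(1)] yinj[OF w(1,2)] y(2)[OF w(1)]
        y(2)[OF w(2)] xy'(1)[OF w(1)] xy'(1)[OF w(2)] ne by metis
    moreover have "branching y' (y w) (y w')"
      by (rule branchingI[OF adj_sym[OF y'(1)]]) (use xy'(2) w in auto)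
    moreover have "branching (y w') y' w'" using w(4) branching_commute by blast
    ultimately show False using C6_3c_free w(3) by blast
  qed
  obtain w0 where w0: "w0 \<in> N" "\<And>w. \<lbrakk>w \<in> N; branching (y w) w y'\<rbrakk> \<Longrightarrow> w = w0"
  proof (cases "\<exists>w\<in>N. branching (y w) w y'")
    case True
    then show ?thesis using that onep by blast
  next
    case False
    then show ?thesis using that x0N by blast
  qed
  define p where "p w = (if w = b then x' else y w)" for w
  have pb: "p b = x'" and pN: "\<And>w. w \<in> N \<Longrightarrow> p w = y w" using N(3) by (auto simp: p_def)
  let ?D = "insert b N"
  have b: "path_bundle ?D p y' a w0 b"
    unfolding path_bundle_def
  proof (intro conjI ballI allI impI)
    show "y' \<notin> ?D" using y'(2) xy'(1) by blast
    show "w0 \<noteq> b" using N(3)[OF w0(1)] .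
    fix w assume w: "w \<in> ?D"
    show "adj w a" using w ab N(2) adj_sym by blast
    show "adj w (p w)" using w pb pN x'(2) y(1) by auto
    show "adj (p w) y'" using w pb pN y'(1) yy y by auto
  next
    fix w z assume w: "w \<in> ?D - {b}" "adj w z"
    then have "w \<in> N" by blast
    then show "z = a \<or> z = p w" using Nx[OF _ w(2)] pN[of w] by simp
  next
    fix w z assume w: "w \<in> ?D - {w0}" "adj (p w) z"
    show "z = w \<or> z = y'"
    proof (cases "w = b")
      case True
      then show ?thesis using Nx' w pb by auto
    next
      case False
      then have "w \<in> N" "\<not> branching (y w) w y'" using w w0(2) by blast+
      then show ?thesis using w(2) pN unfolding branching_def by auto
    qed
  qed (simp_all add: w0(1))
  have sN: "x \<noteq> a" if "x \<in> N" for x using adj_side[OF N(2)[OF that]] by blast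
  have yK: "y x \<in> K" if "x \<in> N" for x
  proof -
    have "y x \<in> core"
      using core_two[OF adj_sym[OF y(1)[OF that]] yy[OF that y[OF that]] xy'(1)[OF that]] .
    then show ?thesis
      using closed_butD[OF cl N(1)[OF that]] sN[OF that] N(3)[OF that] y(1)[OF that] by blast
  qed
  have "y' \<in> core"
    using core_two[OF adj_sym[OF y'(1)] adj_sym[OF yy[OF x0N y[OF x0N]]] xy'(2)[OF x0N]] .
  moreover have "x' \<noteq> b" using adj_side[OF x'(2)] by blast
  ultimately have y'K: "y' \<in> K" using closed_butD[OF cl x'(1)] x'(3) y'(1) by blast
  have nadj: "\<not> adj u w"
    if u: "u \<in> K - (middle ?D p w0 b \<union> ({a, b} \<union> {}))" and w: "w \<in> {a, b} \<union> {}" for u w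
  proof
    assume a: "adj u w"
    from w consider "w = a" | "w = b" by blast
    then show False
    proof cases
      case 1
      then have "u \<in> N" using u adj_sym[OF a] unfolding N_def by blast
      then show False using u N(3) unfolding middle_def by blast
    next
      case 2
      then have "u = x'" using only[of u] u adj_sym[OF a] by blast
      moreover have "x' \<in> middle ?D p w0 b" using pb N(3)[OF w0(1)] unfolding middle_def by force
      ultimately show False using u by blast
    qed
  qed
  have "?D \<subseteq> K" "p ` ?D \<subseteq> K" using aK N(1) pb pN x'(1) yK by auto
  note r = bundle_extend(3,4)[OF IH b Kc this y'K aK(1), of "{}", OF _ _ _ _ _ nadj]
  show "ended K a b" "ended K b a" using r closed_butD[OF cl] by auto
qed

text \<open>If \<open>a\<close> or \<open>b\<close> has no further neighbour in \<open>K\<close>, it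
  is removed, and the other one is a root whose outlet runs along the hexagon. Otherwise one of them
  has exactly one further neighbour, since two at each would produce a \<open>C_4\<close>.\<close>

lemma ended_step:
  assumes IH: "drawable_below (card K)" and K: "hexagonal K a b"
  shows "ended K a b"
proof -
  obtain c d e f where h: "hexagon a b c d e f" and o: "c \<notin> K" "d \<notin> K" "e \<notin> K" "f \<notin> K"
    and cl: "closed_but {a, b} K" and aK: "a \<in> K" "b \<in> K" using K unfolding hexagonal_def by blast
  note hD = hexagonD[OF h]
  have Kc: "K \<subseteq> core" using cl unfolding closed_but_def by blast
  have fin: "finite K" using finite_core[OF Kc] .
  have ne: "a \<noteq> b" using adj_side[OF hD(1)] by blast
  have card: "card (K - {x}) < card K" if "x \<in> K" for x
    using that fin by (intro psubset_card_mono) auto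
  show ?thesis
  proof (cases "\<exists>x\<in>K. adj a x \<and> x \<noteq> b")
    case False
    have "closed_but {b} (K - {a})"
      unfolding closed_but_def
      using closed_butD[OF cl] Kc False adj_sym by blast
    moreover have "outlet (K - {a}) b"
      unfolding outlet_def using o hD(2-4,9,10) hD(7,9) by blast
    ultimately have "legged (K - {a}) b"
      using IH card[OF aK(1)] aK ne unfolding drawable_below_def by blast
    then have "ended (insert a (K - {a})) a b"
    proof (rule legged_ended_root)
      show "adj b a" using adj_sym[OF hD(1)] .
      show "u = b" if "u \<in> K - {a}" "adj a u" for u using False that by blast
    qed blast
    then show ?thesis using aK by (simp add: insert_absorb)
  next
    case Na: True
    show ?thesis
    proof (cases "\<exists>x\<in>K. adj b x \<and> x \<noteq> a")
      case False
      have "closed_but {a} (K - {b})"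
        unfolding closed_but_def
        using closed_butD[OF cl] Kc False adj_sym by blast
      moreover have "outlet (K - {b}) a"
        unfolding outlet_def
        using o adj_sym[OF hD(6)] adj_sym[OF hD(5)] adj_sym[OF hD(4)] hD(8,12) by blast
      ultimately have "legged (K - {b}) a"
        using IH card[OF aK(2)] aK ne unfolding drawable_below_def by blast
      then have "ended (insert b (K - {b})) a b"
      proof (rule legged_ended_root)
        show "adj a b" using hD(1) .
        show "u = a" if "u \<in> K - {b}" "adj b u" for u using False that by blast
      qed blast
      then show ?thesis using aK by (simp add: insert_absorb)
    next
      case True
      then obtain x' where x': "x' \<in> K" "adj b x'" "x' \<noteq> a" by blast
      obtain x where x: "x \<in> K" "adj a x" "x \<noteq> b" using Na by blast
      show ?thesis
      proof (cases "\<forall>z\<in>K. adj b z \<longrightarrow> z = a \<or> z = x'")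
        case True
        then show ?thesis using ended_one(1)[OF IH K x x'] by blast
      next
        case False
        then obtain x1' where x1': "x1' \<in> K" "adj b x1'" "x1' \<noteq> a" "x1' \<noteq> x'" by blast
        show ?thesis
        proof (cases "\<forall>z\<in>K. adj a z \<longrightarrow> z = b \<or> z = x")
          case True
          then show ?thesis using ended_one(2)[OF IH hexagonal_commute[OF K] x' x] by blast
        next
          case False
          then obtain x1 where x1: "x1 \<in> K" "adj a x1" "x1 \<noteq> b" "x1 \<noteq> x" by blast
          have nx: "\<exists>y. adj x y \<and> y \<noteq> a" if "x \<in> K" "adj a x" "x \<noteq> b" for x
            using core_next[OF _ adj_sym[OF that(2)] hD(1)] that Kc by blast
          have nx': "\<exists>y. adj x y \<and> y \<noteq> b" if "x \<in> K" "adj b x" "x \<noteq> a" for x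
            using core_next[OF _ adj_sym[OF that(2)] adj_sym[OF hD(1)]] that Kc by blast
          obtain y y1 y' y1' where y: "adj x y" "y \<noteq> a" and y1: "adj x1 y1" "y1 \<noteq> a"
            and y': "adj x' y'" "y' \<noteq> b" and y1': "adj x1' y1'" "y1' \<noteq> b"
            using nx[OF x] nx[OF x1(1-3)] nx'[OF x'] nx'[OF x1'(1-3)] by blast
          have "y \<noteq> y1"
            using C4_free[OF x(2) y(1) adj_sym adj_sym[OF x1(2)]] y1 y(2) x1(4) by blast
          moreover have "y' \<noteq> y1'"
            using C4_free[OF x'(2) y'(1) adj_sym adj_sym[OF x1'(2)]] y1' y'(2) x1'(4) by blast
          \<comment> \<open>Both \<open>y\<close> and \<open>y1\<close> are adjacent to both
            \<open>y'\<close> and \<open>y1'\<close>, which is a \<open>C_4\<close>.\<close>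
          ultimately show ?thesis
            using C4_free[OF hexagonal_pairs[OF K x x' y y']
                adj_sym[OF hexagonal_pairs[OF K x1(1-3) x' y1 y']]
                hexagonal_pairs[OF K x1(1-3) x1'(1-3) y1 y1']
                adj_sym[OF hexagonal_pairs[OF K x x1'(1-3) y y1']]] by blast
        qed
      qed
    qed
  qed
qed

section \<open>Components without hexagons\<close>

lemma induced_path_Cons:
  assumes ip: "induced_path (x # xs)" and n: "adj n x" and hd: "xs \<noteq> [] \<Longrightarrow> n \<noteq> hd xs"
    and nohex: "\<And>b c d e f. \<not> hexagon n b c d e f"
  shows "induced_path (n # x # xs)"
proof -
  have nx: "n \<noteq> x" using adj_side[OF n] by blast
  have ns: "n \<notin> set xs"
  proof
    assume "n \<in> set xs"
    moreover obtain y ys where "xs = y # ys" using calculation by (cases xs) auto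
    ultimately show False using ip hd adj_sym[OF n] by auto
  qed
  have "\<not> adj n z" if z: "z \<in> set xs" for z
  proof
    assume "adj n z"
    then obtain pre y post where s: "xs = pre @ y # post" "adj n y" "\<forall>u\<in>set pre. \<not> adj n u"
      using split_list_first_prop[of xs "adj n"] z by blast
    have ip': "induced_path (x # pre @ [y])"
      using induced_path_prefix[of "x # pre @ [y]" post] ip s(1) by simp
    \<comment> \<open>With the first further neighbour \<open>y\<close> of \<open>n\<close> on the
      path, \<open>n\<close> closes an induced cycle; this would have to be a hexagon through
      \<open>n\<close>.\<close>
    have "length (x # pre @ [y]) = 5"
      by (rule induced_path_close[OF ip']) (use n s nx ns in auto)
    then have "length pre = 3" by simp
    then obtain p1 p2 p3 where "pre = [p1, p2, p3]"
      by (auto simp: length_Suc_conv numeral_3_eq_3)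
    then have "hexagon n x p1 p2 p3 y"
      unfolding hexagon_def using ip' n adj_sym[OF s(2)] ns s(1) by auto
    then show False using nohex by blast
  qed
  then show ?thesis using ip n nx ns by simp
qed

text \<open>The root is the second vertex of a longest induced path: because of maximality, all its
  neighbours but the next vertex of the path lead nowhere, so that \<open>legged_few_deep\<close>
  applies.\<close>

lemma drawable_no_hexagon:
  assumes IH: "drawable_below (card K)" and K: "closed_but {} K" and "K \<noteq> {}"
    and nohex: "\<And>a b c d e f. a \<in> K \<Longrightarrow> \<not> hexagon a b c d e f"
  shows "drawable K"
proof -
  have Kc: "K \<subseteq> core" using K unfolding closed_but_def by blast
  have fin: "finite K" using finite_core[OF Kc] .
  let ?P = "\<lambda>xs. induced_path xs \<and> set xs \<subseteq> K \<and> xs \<noteq> []"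
  obtain v0 where "v0 \<in> K" using assms(3) by blast
  then have "?P [v0]" by simp
  moreover have "length xs < Suc (card K)" if "?P xs" for xs
    using card_mono[OF fin, of "set xs"] distinct_card[OF induced_path_distinct[of xs]] that by simp
  ultimately obtain xs where xs: "?P xs" "\<And>ys. ?P ys \<Longrightarrow> length ys \<le> length xs"
    using ex_has_greatest_nat[of ?P "[v0]" length "Suc (card K)"] by blast
  obtain p0 ps where ps: "xs = p0 # ps" using xs(1) by (cases xs) auto
  have max: "\<not> induced_path (x # y # ys)" if "length ys = length ps" "set (x # y # ys) \<subseteq> K" for x y ys
    using xs(2)[of "x # y # ys"] that ps by auto
  have K': "closed_but {v} K" for v using K unfolding closed_but_def by blast
  have KD: "w \<in> K" if "u \<in> K" "w \<in> core" "adj u w" for u w using closed_butD[OF K] that by blast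
  show ?thesis
  proof (cases ps)
    case Nil
    have p0: "p0 \<in> K" using xs(1) ps by simp
    have nd: "\<not> deep K p0 x" for x
    proof
      assume "deep K p0 x"
      then have "induced_path [x, p0]" "x \<in> K"
        using adj_side[of p0 x] adj_sym[of p0 x] unfolding deep_def by auto
      then show False using max[of "[]" x p0] Nil p0 by simp
    qed
    show ?thesis
      by (rule legged_drawable[OF legged_few_deep[OF IH p0 K']]) (use nd in blast)+
  next
    case (Cons p1 rest)
    have ip: "induced_path (p0 # p1 # rest)" and inK: "set (p0 # p1 # rest) \<subseteq> K"
      using xs(1) ps Cons by simp_all
    have p: "p0 \<in> K" "p1 \<in> K" "adj p0 p1" using ip inK by auto
    \<comment> \<open>Otherwise \<open>x\<close> and a vertex behind it could replace
      \<open>p0\<close>, which gives a longer induced path.\<close>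
    have deep: "rest \<noteq> [] \<and> x = hd rest" if x: "deep K p1 x" for x
    proof (rule ccontr)
      assume n: "\<not> ?thesis"
      obtain y where y: "y \<in> core" "adj x y" "y \<noteq> p1" and x': "x \<in> K" "adj p1 x"
        using x unfolding deep_def by blast
      have yK: "y \<in> K" using KD[OF x'(1)] y by blast
      have "induced_path (x # p1 # rest)"
        by (rule induced_path_Cons[OF induced_path_tl[OF ip] adj_sym[OF x'(2)]])
          (use n nohex[OF x'(1)] in auto)
      then have "induced_path (y # x # p1 # rest)"
        by (rule induced_path_Cons[OF _ adj_sym[OF y(2)]]) (use y(3) nohex[OF yK] in auto)
      then show False using max[of "p1 # rest" y x] Cons inK x'(1) yK by simp
    qed
    have "legged K p1"
    proof (rule legged_few_deep[OF IH p(2) K'])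
      show "x = hd rest" if "deep K p1 x" for x using deep[OF that] by blast
      assume d: "deep K p1 (hd rest)"
      let ?w = "hd rest"
      have w: "adj p1 ?w" "?w \<in> K" "?w \<in> set rest" using d deep[OF d] unfolding deep_def by auto
      then have ne: "?w \<noteq> p0" using ip by auto
      then obtain z where "adj p0 z" "z \<noteq> p1"
        using core_next[OF _ p(3) w(1)] p(1) Kc by blast
      \<comment> \<open>The outlet runs back through \<open>p1\<close> and \<open>p0\<close> to
        \<open>z\<close>, which may be a leaf.\<close>
      then show "outlet (K - {p1} - legs K p1) ?w"
        unfolding outlet_def using adj_sym[OF w(1)] adj_sym[OF p(3)] ne by blast
    qed
    then show ?thesis by (rule legged_drawable)
  qed
qed

section \<open>Components with a hexagon: splitting at a bundle\<close>

lemma hexagon_opposite: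
  assumes h: "hexagon a b c d e f"
  obtains a' b' c' d' e' f' where "hexagon a' b' c' d' e' f'" "a' \<in> {a, b, c}"
    "\<not> branching c' b' d'" "\<not> branching f' a' e'"
proof -
  note h2 = hexagon_rotate[OF h] note h3 = hexagon_rotate[OF h2] note h4 = hexagon_rotate[OF h3]
  note h5 = hexagon_rotate[OF h4] note h6 = hexagon_rotate[OF h5]
  let ?a = "branching a f b" and ?b = "branching b a c" and ?c = "branching c b d"
  let ?d = "branching d c e" and ?e = "branching e d f" and ?f = "branching f e a"
  have "\<not> (?a \<and> ?b \<and> ?c)" "\<not> (?b \<and> ?c \<and> ?d)" "\<not> (?c \<and> ?d \<and> ?e)" "\<not> (?d \<and> ?e \<and> ?f)"
    "\<not> (?e \<and> ?f \<and> ?a)" "\<not> (?f \<and> ?a \<and> ?b)" "\<not> (?a \<and> ?c \<and> ?e)" "\<not> (?b \<and> ?d \<and> ?f)"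
    using C6_3c_free[OF h] C6_3c_free[OF h2] C6_3c_free[OF h3] C6_3c_free[OF h4]
      C6_3c_free[OF h5] C6_3c_free[OF h6] C6_3nc_free[OF h] C6_3nc_free[OF h2] by blast+
  \<comment> \<open>Three vertices, one of each pair of opposite ones, are always three consecutive
    or three alternating vertices of the hexagon, and these cannot all branch.\<close>
  then consider "\<not> ?c" "\<not> ?f" | "\<not> ?d" "\<not> ?a" | "\<not> ?e" "\<not> ?b" by blast
  then show ?thesis
  proof cases
    case 1 then show ?thesis using that[OF h] branching_commute by blast
  next
    case 2 then show ?thesis using that[OF h2] branching_commute by blast
  next
    case 3 then show ?thesis using that[OF h3] branching_commute by blast
  qed
qed

text \<open>\<open>D\<close> collects all paths of length three between \<open>a\<close> and
  \<open>d\<close>. Since there are at least three, \<open>a\<close> and \<open>d\<close> branch on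
  each hexagon formed by two of them, so \<open>C6_3c_free\<close> restricts the inner vertices. The
  second and third conclusions say that the bundle cannot be enlarged or bypassed; they are what the
  separation of its two sides needs.\<close>

lemma bundle_thick:
  assumes h: "hexagon a b c d e f" and t: "adj a x" "adj x t" "adj t d" "x \<noteq> b" "x \<noteq> f"
  obtains D p w0 w1 where "path_bundle D p a d w0 w1"
    "\<And>w x. \<lbrakk>adj w d; adj w x; adj x a\<rbrakk> \<Longrightarrow> w \<in> D"
    "\<And>y y'. \<lbrakk>adj (p w0) y; adj y y'; adj y' w1; y \<noteq> a; y \<noteq> w0; y' \<noteq> d; y' \<noteq> p w1\<rbrakk> \<Longrightarrow> False"
proof -
  note hD = hexagonD[OF h]
  define D where "D = {w. adj w d \<and> (\<exists>x. adj w x \<and> adj x a)}"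
  define p where "p w = (SOME x. adj w x \<and> adj x a)" for w
  have nad: "\<not> adj a d" using hexagon_chord(1)[OF h] .
  have D: "adj w d" "adj w (p w)" "adj (p w) a" if "w \<in> D" for w
  proof -
    have "\<exists>x. adj w x \<and> adj x a" using that unfolding D_def by blast
    then have "adj w (p w) \<and> adj (p w) a" unfolding p_def by (rule someI_ex)
    then show "adj w d" "adj w (p w)" "adj (p w) a" using that unfolding D_def by blast+
  qed
  have aD: "a \<notin> D" using nad unfolding D_def by blast
  have pu: "y = p w" if "w \<in> D" "adj w y" "adj y a" for w y
    using C4_free[OF that(2,3) adj_sym[OF D(3)[OF that(1)]] adj_sym[OF D(2)[OF that(1)]]] aD that(1)
    by blast
  have pd: "p w \<noteq> d" if "w \<in> D" for w using D(3)[OF that] nad adj_sym by blast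
  have pinj: "p w \<noteq> p w'" if "w \<in> D" "w' \<in> D" "w \<noteq> w'" for w w'
  proof
    assume e: "p w = p w'"
    have "w = w'"
      using C4_free[OF adj_sym[OF D(2)[OF that(1)]] D(1)[OF that(1)] adj_sym[OF D(1)[OF that(2)]]]
        D(2)[OF that(2)] pd[OF that(1)] e by simp
    then show False using that(3) by blast
  qed
  have cet: "c \<in> D" "e \<in> D" "t \<in> D" "p c = b" "p e = f" "p t = x"
  proof -
    show "c \<in> D" "e \<in> D" "t \<in> D"
      unfolding D_def using hD(1-6) t(1-3) adj_sym by blast+
    then show "p c = b" "p e = f" "p t = x"
      using pu[of c b] pu[of e f] pu[of t x] hD(1-6) t(1-3) adj_sym by blast+
  qed
  have other: "\<exists>w''\<in>D. w'' \<noteq> w \<and> w'' \<noteq> w'" for w w'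
    using cet hD(9) t(4,5) by metis
  have hex: "hexagon a (p w) w d w' (p w')" if "w \<in> D" "w' \<in> D" "w \<noteq> w'" for w w'
    unfolding hexagon_def
    using adj_sym[OF D(3)[OF that(1)]] adj_sym[OF D(2)[OF that(1)]] D(1)[OF that(1)]
      adj_sym[OF D(1)[OF that(2)]] D(2,3)[OF that(2)] pinj[OF that] pd[OF that(1)] pd[OF that(2)]
      aD that by metis
  have bra: "branching a (p w) (p w')" and brd: "branching d w w'"
    if "w \<in> D" "w' \<in> D" for w w'
  proof -
    obtain w'' where w: "w'' \<in> D" "w'' \<noteq> w" "w'' \<noteq> w'" using other by blast
    show "branching a (p w) (p w')"
      using branchingI[OF adj_sym[OF D(3)[OF w(1)]]] pinj[OF w(1) that(1) w(2)]
        pinj[OF w(1) that(2) w(3)] by blast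
    show "branching d w w'" using branchingI[OF adj_sym[OF D(1)[OF w(1)]] w(2,3)] .
  qed
  obtain w0 w1 where b: "path_bundle D p a d w0 w1"
  proof (rule bundle_select[OF cet(1,2) hD(9) aD])
    show "adj w d \<and> adj w (p w) \<and> adj (p w) a" if "w \<in> D" for w using D[OF that] by blast
    show "w = w'" if w: "w \<in> D" "w' \<in> D" "branching w d (p w)" "branching w' d (p w')" for w w'
    proof (rule ccontr)
      assume ne: "w \<noteq> w'"
      show False
        using C6_3c_free[OF hexagon_rotate[OF hexagon_rotate[OF hex[OF w(1,2) ne]]] _ brd[OF w(1,2)]]
          w(3,4) branching_commute by blast
    qed
    show "w = w'" if w: "w \<in> D" "w' \<in> D" "branching (p w) w a" "branching (p w') w' a" for w w'
    proof (rule ccontr)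
      assume ne: "w \<noteq> w'"
      show False
        using C6_3c_free[OF hexagon_reflect[OF hex[OF w(1,2) ne]] _ bra[OF w(1,2)]]
          w(3,4) branching_commute by blast
    qed
    show False if w: "w \<in> D" "branching w d (p w)" "branching (p w) w a" for w
    proof -
      obtain w' where w': "w' \<in> D" "w \<noteq> w'" using other by metis
      show False
        using C6_3c_free[OF hexagon_rotate[OF hex[OF w(1) w']] _ _ brd[OF w(1) w'(1)]]
          w(2,3) branching_commute by blast
    qed
  qed
  note bD = bundleD[OF b] and bs = bundle_side[OF b]
  have "w \<in> D" if "adj w d" "adj w x" "adj x a" for w x using that unfolding D_def by blast
  moreover have False
    if y: "adj (p w0) y" "adj y y'" "adj y' w1" "y \<noteq> a" "y \<noteq> w0" "y' \<noteq> d" "y' \<noteq> p w1" for y y'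
  proof -
    obtain w where w: "w \<in> D" "w \<noteq> w0" "w \<noteq> w1" using other by blast
    note h0 = hex[OF bD(1) w(1) w(2)[symmetric]] and h1 = hex[OF bD(1,2,3)]
    have s: "side (p w0) = (\<not> side a)" "side w1 = side a" "side d = (\<not> side a)" "side w = side a"
      "side (p w) = (\<not> side a)"
      using bs[OF bD(1)] bs[OF bD(2)] bs[OF w(1)] by simp_all
    then have sy: "side y = side a" "side y' = (\<not> side a)"
      using adj_side_iff[OF y(1)] adj_side_iff[OF y(2)] by simp_all
    have n: "\<not> adj y d" "\<not> adj y (p w)" "\<not> adj y' w" "\<not> adj y' a" "\<not> adj w1 (p w)"
      using no_C4[OF adj_sym[OF y(1)] adj_sym[OF D(2)[OF bD(1)]] D(1)[OF bD(1)] y(5) pd[OF bD(1)]]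
        no_C4[OF adj_sym[OF y(1)] D(3)[OF bD(1)] adj_sym[OF D(3)[OF w(1)]] y(4)
          pinj[OF bD(1) w(1) w(2)[symmetric]]]
        no_C4[OF y(3) D(1)[OF bD(2)] adj_sym[OF D(1)[OF w(1)]] y(6) w(3)[symmetric]]
        no_C4[OF y(3) D(2,3)[OF bD(2)] y(7)]
        no_C4[OF D(1)[OF bD(2)] adj_sym[OF D(1)[OF w(1)]] D(2)[OF w(1)] w(3)[symmetric]]
        pd[OF w(1)] aD bD(2) by metis+
    have n': "\<not> adj (p w0) w1" "\<not> adj (p w0) w"
      using hexagon_chord(2)[OF h1] hexagon_chord(2)[OF h0] .
    have ne: "y \<noteq> w1" "y \<noteq> w" "y' \<noteq> p w" "p w0 \<noteq> y'" "a \<noteq> w1" "a \<noteq> w"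
      "d \<noteq> p w" "p w \<noteq> p w0" "p w0 \<noteq> d"
      using n' y(1,3) n(5) adj_sym[OF y(3)] aD bD(2) w(1) pd[OF w(1)] pd[OF bD(1)]
        pinj[OF w(1) bD(1) w(2)] by auto
    \<comment> \<open>With a third path of the bundle, through \<open>w\<close>, the bypass closes
      to an induced cycle of length eight, the eighth vertex being \<open>p w0\<close>.\<close>
    have ip: "induced_path [y, y', w1, d, w, p w, a]"
      using y(2,3,4,6) D(1)[OF bD(2)] adj_sym[OF D(1)[OF w(1)]] D(2,3)[OF w(1)] n n(5) ne w(3) s sy nad
      by (auto simp: nadj_side adj_commute)
    have "length [y, y', w1, d, w, p w, a] = 5"
    proof (rule induced_path_close[OF ip, of "p w0"])
      show "p w0 \<notin> set [y, y', w1, d, w, p w, a]" using ne s sy by auto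
      show "z = hd [y, y', w1, d, w, p w, a] \<or> z = last [y, y', w1, d, w, p w, a]"
        if "z \<in> set [y, y', w1, d, w, p w, a]" "adj (p w0) z" for z
        using that n' s sy by (auto simp: nadj_side)
    qed (use y(1) D(3)[OF bD(1)] in auto)
    then show False by simp
  qed
  ultimately show ?thesis using that[OF b] by blast
qed

text \<open>If no two opposite vertices of a hexagon that meets \<open>K\<close> are joined by a
  third path, a single hexagon serves as a bundle of two paths, provided it is read such that the
  opposite vertices \<open>c\<close> and \<open>f\<close> do not branch. A bypass would then be a
  third path between the opposite vertices \<open>b\<close> and \<open>e\<close>.\<close>

lemma closed_bundle:
  assumes K: "closed_but {} K" and h: "hexagon a0 b0 c0 d0 e0 f0" "a0 \<in> K"
  obtains D p a d w0 w1 where "path_bundle D p a d w0 w1" "a \<in> K"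
    "\<And>w x. \<lbrakk>adj w d; adj w x; adj x a\<rbrakk> \<Longrightarrow> w \<in> D"
    "\<And>y y'. \<lbrakk>adj (p w0) y; adj y y'; adj y' w1; y \<noteq> a; y \<noteq> w0; y' \<noteq> d; y' \<noteq> p w1\<rbrakk> \<Longrightarrow> False"
proof (cases "\<exists>a b c d e f x t. hexagon a b c d e f \<and> a \<in> K \<and> adj a x \<and> adj x t \<and> adj t d \<and> x \<noteq> b \<and> x \<noteq> f")
  case True
  then obtain a b c d e f x t where h': "hexagon a b c d e f" "a \<in> K"
    "adj a x" "adj x t" "adj t d" "x \<noteq> b" "x \<noteq> f" by blast
  show ?thesis
    by (rule bundle_thick[OF h'(1,3-7)], rule that, assumption, rule h'(2)) blast+
next
  case thin: False
  have KD: "w \<in> K" if "u \<in> K" "w \<in> core" "adj u w" for u w using closed_butD[OF K] that by blast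
  note h0 = hexagonD[OF h(1)]
  have "b0 \<in> K" using KD[OF h(2) core_two[OF adj_sym[OF h0(1)] h0(2)]] h0(1,7) by blast
  then have "c0 \<in> K" using KD[OF _ core_two[OF adj_sym[OF h0(2)] h0(3)]] h0(2,10) by blast
  obtain a b c d e f where h': "hexagon a b c d e f" "a \<in> {a0, b0, c0}"
    "\<not> branching c b d" "\<not> branching f a e"
    by (rule hexagon_opposite[OF h(1)])
  note hD = hexagonD[OF h'(1)]
  have aK: "a \<in> K" using h'(2) h(2) \<open>b0 \<in> K\<close> \<open>c0 \<in> K\<close> by blast
  then have bK: "b \<in> K" using KD[OF _ core_two[OF adj_sym[OF hD(1)] hD(2)]] hD(1,7) by blast
  let ?p = "\<lambda>w. if w = c then b else f"
  have b: "path_bundle {c, e} ?p a d c e"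
    unfolding path_bundle_def
    using hD h'(3,4) adj_sym[OF hD(1)] adj_sym[OF hD(2)] adj_sym[OF hD(4)]
    unfolding branching_def by auto
  moreover have "w \<in> {c, e}" if w: "adj w d" "adj w x" "adj x a" for w x
  proof -
    have "x = b \<or> x = f" using thin h'(1) aK w adj_sym by blast
    then show ?thesis
      using C4_free[OF hD(2,3) adj_sym[OF w(1)] _ hD(10)]
        C4_free[OF adj_sym[OF hD(5)] adj_sym[OF hD(4)] adj_sym[OF w(1)] _ hD(12)[symmetric]] w(2) by blast
  qed
  moreover have False
    if y: "adj (?p c) y" "adj y y'" "adj y' e" "y \<noteq> a" "y \<noteq> c" "y' \<noteq> d" "y' \<noteq> ?p e" for y y'
  proof -
    have "adj b y" using y(1) by simp
    then show False using thin hexagon_rotate[OF h'(1)] bK y(2-5) by blast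
  qed
  ultimately show ?thesis using that aK by blast
qed

text \<open>A path leaving \<open>S\<close> at its last vertex; shortcuts make it induced.\<close>

definition leaving :: "'a set \<Rightarrow> 'a set \<Rightarrow> 'a list \<Rightarrow> bool" where
  "leaving S Z xs \<longleftrightarrow> induced_path xs \<and> xs \<noteq> [] \<and> set xs \<subseteq> Z \<and> (\<exists>s\<in>S. adj (last xs) s) \<and>
     (\<forall>y\<in>set (butlast xs). \<forall>s\<in>S. \<not> adj y s)"

lemma leaving_suffix: "leaving S Z (pre @ u # suf) \<Longrightarrow> leaving S Z (u # suf)"
  unfolding leaving_def using induced_path_suffix[of pre "u # suf"] by (auto simp: butlast_append)

lemma leaving_extend:
  assumes xs: "leaving S Z xs" and z: "z \<in> Z" "adj z (hd xs)"
  obtains ys where "leaving S Z (z # ys)"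
proof (cases "\<exists>s\<in>S. adj z s")
  case True
  then have "leaving S Z [z]" using z by (simp add: leaving_def)
  then show ?thesis by (rule that)
next
  case nS: False
  show ?thesis
  proof (cases "z \<in> set xs")
    case True
    then obtain pre suf where "xs = pre @ z # suf" by (meson split_list)
    then show ?thesis using that leaving_suffix xs by blast
  next
    case False
    have "hd xs \<in> set xs" using xs unfolding leaving_def by simp
    \<comment> \<open>The last neighbour of \<open>z\<close> on the path is taken, so that the
      shortened path stays induced after adding \<open>z\<close>.\<close>
    then obtain pre u suf where s: "xs = pre @ u # suf" "adj z u" "\<forall>v\<in>set suf. \<not> adj z v"
      using split_list_last_prop[of xs "adj z"] z(2) by blast
    have "leaving S Z (u # suf)" using xs s(1) leaving_suffix by blast
    then have "leaving S Z (z # u # suf)"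
      using s nS z(1) False unfolding leaving_def by auto
    then show ?thesis by (rule that)
  qed
qed

text \<open>A connection \<open>Q\<close> of the right edge with the left edge outside the bundle is
  cut down to an induced path and closed through the bundle; all induced cycles have six vertices.
  Between \<open>d\<close> and \<open>p w0\<close>, or between \<open>w1\<close> and
  \<open>a\<close>, there are two ways to close it, with 3 and with 5 further vertices, which is
  impossible. Between \<open>d\<close> and \<open>a\<close>, or between \<open>w1\<close> and
  \<open>p w0\<close>, 4 vertices are added, so \<open>Q\<close> has two vertices; this contradicts
  \<open>max\<close> or \<open>third\<close>.\<close>

lemma leaving_no_bridge:
  assumes b: "path_bundle D p a d w0 w1"
    and max: "\<And>w x. \<lbrakk>adj w d; adj w x; adj x a\<rbrakk> \<Longrightarrow> w \<in> D"
    and third: "\<And>y y'. \<lbrakk>adj (p w0) y; adj y y'; adj y' w1; y \<noteq> a; y \<noteq> w0; y' \<noteq> d; y' \<noteq> p w1\<rbrakk> \<Longrightarrow> False"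
    and Z: "Z \<inter> (middle D p w0 w1 \<union> {a, p w0, d, w1}) = {}"
    and xs: "leaving {a, p w0} Z xs"
  shows "\<not> adj (hd xs) d \<and> \<not> adj (hd xs) w1"
proof (rule ccontr)
  assume n: "\<not> ?thesis"
  let ?b = "p w0" and ?q = "p w1"
  note bD = bundleD[OF b] and bs = bundle_side[OF b]
  note h = bundle_hexagon[OF b bD(1,2,3)]
  note hD = hexagonD[OF h] and hc = hexagon_chord[OF h] and hs = hexagon_side[OF h]
  have "hd xs \<in> set xs" using xs unfolding leaving_def by simp
  then obtain pre u suf where s: "xs = pre @ u # suf" "adj u d \<or> adj u w1"
    "\<forall>v\<in>set suf. \<not> (adj v d \<or> adj v w1)"
    using split_list_last_prop[of xs "\<lambda>v. adj v d \<or> adj v w1"] n by blast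
  define Q where "Q = u # suf"
  have lQ: "leaving {a, ?b} Z Q" using xs s(1) leaving_suffix unfolding Q_def by blast
  have ipQ: "induced_path Q" and QZ: "set Q \<subseteq> Z" using lQ unfolding leaving_def by blast+
  have mid: "w0 \<in> middle D p w0 w1" "?q \<in> middle D p w0 w1"
    using bD(1-3) unfolding middle_def by blast+
  have out: "v \<noteq> a" "v \<noteq> ?b" "v \<noteq> d" "v \<noteq> w1" "v \<noteq> w0" "v \<noteq> ?q" if "v \<in> set Q" for v
    using that QZ Z mid by blast+
  have nw0: "\<not> adj w0 v" and nq: "\<not> adj ?q v" if "v \<in> set Q" for v
    using bD(8)[OF bD(1,3), of v] bD(9)[OF bD(2) bD(3)[symmetric], of v] out[OF that] by blast+
  have last: "last Q \<in> set Q" "adj (last Q) a \<or> adj (last Q) ?b"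
    using lQ unfolding leaving_def by auto
  have lastu: "v = last Q" if "v \<in> set Q" "adj a v \<or> adj ?b v" for v
  proof (rule ccontr)
    assume "v \<noteq> last Q"
    then have "v \<in> set (butlast Q)"
      using that(1) lQ append_butlast_last_id[of Q] unfolding leaving_def
      by (metis Un_iff empty_iff empty_set set_ConsD set_append)
    then show False using lQ that(2) adj_sym unfolding leaving_def by blast
  qed
  have firstu: "v = u" if "v \<in> set Q" "adj d v \<or> adj w1 v" for v
    using that s(3) adj_sym unfolding Q_def by auto
  have uQ: "u \<in> set Q" unfolding Q_def by simp
  have suf: "\<not> adj d v" "\<not> adj w1 v" if "v \<in> set suf" for v
    using s(3) that adj_sym by blast+
  have ab: "\<not> (adj a v \<and> adj ?b v)" for v using adj_side_iff[of a v] adj_side_iff[of ?b v] hs by blast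
  have dw: "\<not> (adj d v \<and> adj w1 v)" for v using adj_side_iff[of d v] adj_side_iff[of w1 v] hs by blast
  have ns: "\<not> adj a w1" "\<not> adj a w0" "\<not> adj ?b d" "\<not> adj ?b ?q" "\<not> adj w0 w1" "\<not> adj d ?q"
    "a \<noteq> d" "a \<noteq> ?q" "w1 \<noteq> d" "w1 \<noteq> ?b" "?q \<noteq> w1" "w0 \<noteq> d" "w0 \<noteq> ?b" "?q \<noteq> w0" "a \<noteq> ?b"
    using hs by (auto simp: nadj_side)
  have ad: "adj a ?b" "adj ?b w0" "adj w0 d" "adj d w1" "adj w1 ?q" "adj ?q a"
    and nad: "\<not> adj a d" "\<not> adj ?b w1" "\<not> adj w0 ?q"
    using hD(1-6) hc .
  have inQ: "w1 \<notin> set Q" "d \<notin> set Q" "a \<notin> set Q" "?b \<notin> set Q" "w0 \<notin> set Q" "?q \<notin> set Q"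
    using out by blast+
  have Qne: "Q = u # suf" by (rule Q_def)
  consider "adj d u" "\<not> adj w1 u" | "adj w1 u" "\<not> adj d u" using s(2) dw adj_sym by blast
  then show False
  proof cases
    case d: 1
    have w1Q: "\<not> adj w1 v" if "v \<in> set Q" for v using that d(2) suf unfolding Q_def by auto
    have ip1: "induced_path (d # Q)"
      using ipQ d suf inQ unfolding Q_def by auto
    have ip2: "induced_path (?q # w1 # d # Q)"
      using ip1 ad ns w1Q nq inQ hD(12) adj_sym[OF ad(4)] adj_sym[OF ad(5)] adj_commute[of d ?q]
      by auto
    show False
    proof (cases "adj a (last Q)")
      case True
      have "length (?q # w1 # d # Q) = 5"
        by (rule induced_path_close[OF ip2, of a])
          (use True ad ns nad inQ lastu hD(8) Qne adj_sym[OF ad(6)] in auto)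
      then obtain l where "Q = [u, l]" unfolding Q_def by (auto simp: length_Suc_conv)
      then have "adj u d" "adj u l" "adj l a"
        using True d(1) ipQ adj_sym by auto
      then have "u \<in> D" by (rule max)
      then show False using out(4)[OF uQ] uQ QZ Z unfolding middle_def by blast
    next
      case False
      then have bl: "adj ?b (last Q)" using last(2) adj_sym by blast
      have aQ: "\<not> adj a v" if "v \<in> set Q" for v using lastu[OF that] False by blast
      have ip3: "induced_path (w0 # d # Q)" using ip1 ad ns nw0 inQ by auto
      have "length (w0 # d # Q) = 5"
        by (rule induced_path_close[OF ip3, of ?b])
          (use bl ad ns inQ lastu Qne hD(10) in auto)
      moreover have ip4: "induced_path (a # ?q # w1 # d # Q)"
        using ip2 aQ ad(6) adj_sym[OF ad(6)] ns nad inQ hD(8) by auto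
      have "length (a # ?q # w1 # d # Q) = 5"
        by (rule induced_path_close[OF ip4, of ?b])
          (use bl ad ns nad inQ lastu Qne hD(10,11) adj_sym[OF ad(1)] in auto)
      ultimately show False by simp
    qed
  next
    case w: 2
    have dQ: "\<not> adj d v" if "v \<in> set Q" for v using that w(2) suf unfolding Q_def by auto
    have ip1: "induced_path (w1 # Q)"
      using ipQ w suf inQ unfolding Q_def by auto
    have ip2: "induced_path (?q # w1 # Q)"
      using ip1 ad ns nq inQ adj_sym[OF ad(5)] by auto
    show False
    proof (cases "adj a (last Q)")
      case True
      then have bl: "\<not> adj ?b (last Q)" using ab by blast
      have bQ: "\<not> adj ?b v" if "v \<in> set Q" for v using lastu[OF that] bl by blast
      have "length (?q # w1 # Q) = 5"
        by (rule induced_path_close[OF ip2, of a])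
          (use True ad ns nad inQ lastu hD(8) Qne adj_sym[OF ad(6)] in auto)
      moreover have ip3: "induced_path (?b # w0 # d # w1 # Q)"
        using ip1 ad ns nad dQ nw0 bQ inQ hD(9,10) by auto
      have "length (?b # w0 # d # w1 # Q) = 5"
        by (rule induced_path_close[OF ip3, of a])
          (use True ad ns nad inQ lastu hD(7,8) Qne in auto)
      ultimately show False by simp
    next
      case False
      then have bl: "adj ?b (last Q)" using last(2) adj_sym by blast
      have aQ: "\<not> adj a v" if "v \<in> set Q" for v using lastu[OF that] False by blast
      have ip3: "induced_path (a # ?q # w1 # Q)"
        using ip2 aQ adj_sym[OF ad(6)] ns nad inQ hD(8) by auto
      have "length (a # ?q # w1 # Q) = 5"
        by (rule induced_path_close[OF ip3, of ?b])
          (use bl ad ns nad inQ lastu Qne hD(11) adj_sym[OF ad(1)] in auto)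
      then obtain l where l: "Q = [u, l]" unfolding Q_def by (auto simp: length_Suc_conv)
      then have "adj ?b l" "adj l u" "adj u w1" "l \<in> set Q"
        using bl w(1) ipQ adj_sym by auto
      then show False using third[of l u] out[of l] out[OF uQ] by blast
    qed
  qed
qed

text \<open>Removing the middle of the bundle separates the two attaching edges. Each side hangs on
  an edge of a hexagon of the bundle and is drawn by induction; parts of \<open>K\<close> not
  connected with the bundle are counted to the right side.\<close>

lemma drawable_bundle:
  assumes IH: "drawable_below (card K)" and K: "closed_but {} K"
    and b: "path_bundle D p a d w0 w1" and aK: "a \<in> K"
    and max: "\<And>w x. \<lbrakk>adj w d; adj w x; adj x a\<rbrakk> \<Longrightarrow> w \<in> D"
    and third: "\<And>y y'. \<lbrakk>adj (p w0) y; adj y y'; adj y' w1; y \<noteq> a; y \<noteq> w0; y' \<noteq> d; y' \<noteq> p w1\<rbrakk> \<Longrightarrow> False"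
  shows "drawable K"
proof -
  have Kc: "K \<subseteq> core" using K unfolding closed_but_def by blast
  have fin: "finite K" using finite_core[OF Kc] .
  have KD: "w \<in> K" if "u \<in> K" "w \<in> core" "adj u w" for u w using closed_butD[OF K] that by blast
  note bD = bundleD[OF b] and bs = bundle_side[OF b] and bc = bundle_core[OF b]
  note h' = bundle_hexagon[OF b bD(1,2,3)]
  note hD = hexagonD[OF h'] and hs = hexagon_side[OF h'] and hc = hexagon_chord[OF h']
  have DK: "p w \<in> K" "w \<in> K" if "w \<in> D" for w
  proof -
    show "p w \<in> K" using KD[OF aK _ adj_sym[OF bD(7)[OF that]]] bc(2) that by blast
    then show "w \<in> K" using KD[OF _ _ adj_sym[OF bD(6)[OF that]]] bc(1) that by blast
  qed
  have dK: "d \<in> K" using KD[OF DK(2)[OF bD(1)] bc(4) bD(5)[OF bD(1)]] .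
  let ?M = "middle D p w0 w1"
  have MK: "?M \<subseteq> K" using DK unfolding middle_def by blast
  define Z where "Z = K - (?M \<union> {a, p w0, d, w1})"
  define L where "L = {a, p w0} \<union> {z. \<exists>ys. leaving {a, p w0} Z (z # ys)}"
  define R where "R = K - (?M \<union> L)"
  have LZ: "u \<in> Z" if "u \<in> L" "u \<noteq> a" "u \<noteq> p w0" for u
    using that unfolding L_def leaving_def by auto
  have pd: "p w \<noteq> d" if w: "w \<in> D" for w
  proof -
    obtain w' where "w' \<in> D" "w \<noteq> w'" using bD(1-3) by metis
    then show ?thesis using hexagonD(10)[OF bundle_hexagon[OF b w]] by blast
  qed
  have aM: "a \<notin> ?M" using bD(4) bs(3) unfolding middle_def by blast
  have bM: "p w0 \<notin> ?M"
    using bs(2,3)[OF bD(1)] bs(2) bundle_inj[OF b] bD(1) unfolding middle_def inj_on_def by blast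
  have dM: "d \<notin> ?M" using bs(1)[OF bD(1)] bs(2) pd unfolding middle_def by blast
  have wM: "w1 \<notin> ?M" using bs(2)[OF bD(2)] bs(3) unfolding middle_def by blast
  have ne: "a \<noteq> d" "a \<noteq> w1" "p w0 \<noteq> d" "p w0 \<noteq> w1" using hs hD(8,10) by auto
  have LK: "L \<subseteq> K" "L \<inter> ?M = {}" "d \<notin> L" "w1 \<notin> L"
    using LZ aK DK(1)[OF bD(1)] aM bM ne unfolding Z_def by blast+
  have L: "L = K - (?M \<union> R)" unfolding R_def using LK by blast
  have nadj: "\<not> adj u w" if u: "u \<in> L" and w: "w \<in> R" for u w
  proof
    assume uw: "adj u w"
    have wL: "w \<in> K" "w \<notin> ?M" "w \<notin> L" using w unfolding R_def by blast+
    show False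
    proof (cases "u = a \<or> u = p w0")
      case True
      have "w \<noteq> d" "w \<noteq> w1"
        using True uw hc(1,2) nadj_side[of a w1] nadj_side[of "p w0" d] hs by blast+
      then have "w \<in> Z" using wL unfolding Z_def L_def by blast
      then have "leaving {a, p w0} Z [w]" using True adj_sym[OF uw] unfolding leaving_def by auto
      then show False using wL(3) unfolding L_def by blast
    next
      case False
      then obtain ys where ys: "leaving {a, p w0} Z (u # ys)" using u unfolding L_def by blast
      have "\<not> adj u d \<and> \<not> adj u w1"
        using leaving_no_bridge[OF b max third _ ys] unfolding Z_def by force
      then have "w \<noteq> d" "w \<noteq> w1" using uw by blast+
      then have "w \<in> Z" using wL unfolding Z_def L_def by blast
      then obtain zs where "leaving {a, p w0} Z (w # zs)"
        using leaving_extend[OF ys, of w] adj_sym[OF uw] by auto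
      then show False using wL(3) unfolding L_def by blast
    qed
  qed
  have dwR: "d \<in> R" "w1 \<in> R" unfolding R_def using dK DK(2)[OF bD(2)] dM wM LK(3,4) by blast+
  have abL: "a \<in> L" "p w0 \<in> L" unfolding L_def by blast+
  have "hexagonal L a (p w0)"
    by (rule bundle_left_hexagonal[OF b L Kc dwR])
      (use L abL KD nadj aK DK(1)[OF bD(1)] LK(1) in blast)+
  moreover have "card L < card K" using fin LK dK by (intro psubset_card_mono) auto
  ultimately have eL: "ended L a (p w0)" using IH unfolding drawable_below_def by blast
  have RK: "R \<subseteq> K" unfolding R_def by blast
  have "closed_but {d, w1} R"
    unfolding closed_but_def
  proof (intro conjI ballI impI)
    show "R \<subseteq> core" using RK Kc by blast
    fix u w assume u: "u \<in> R - {d, w1}" and w: "w \<in> core" "adj u w"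
    have "w \<in> K" using KD u RK w by blast
    moreover have "w \<notin> L" using nadj u adj_sym[OF w(2)] by blast
    moreover have "w \<notin> ?M"
    proof
      assume "w \<in> ?M"
      then consider "w \<in> D" "w \<noteq> w1" | v where "w = p v" "v \<in> D" "v \<noteq> w0"
        unfolding middle_def by blast
      then show False
      proof cases
        case 1
        then have "u = p w" using bD(8) adj_sym[OF w(2)] u by blast
        then have "u \<in> ?M \<or> u = p w0" using 1 unfolding middle_def by blast
        then show False using u abL unfolding R_def by blast
      next
        case 2
        then have "u = v \<or> u = a" using bD(9) adj_sym[OF w(2)] by blast
        moreover have "v \<in> ?M \<or> v = w1" using 2 unfolding middle_def by blast
        ultimately show False using u abL unfolding R_def by blast
      qed
    qed
    ultimately show "w \<in> R" unfolding R_def by blast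
  qed
  moreover have "hexagon d w1 (p w1) a (p w0) w0"
    using hexagon_rotate[OF hexagon_rotate[OF hexagon_rotate[OF h']]] .
  moreover have "p w1 \<notin> R" "a \<notin> R" "p w0 \<notin> R" "w0 \<notin> R"
    using abL bD(1-3) unfolding R_def middle_def by blast+
  ultimately have "hexagonal R d w1" unfolding hexagonal_def using dwR by blast
  moreover have "card R < card K"
    using fin RK aK abL(1) unfolding R_def by (intro psubset_card_mono) auto
  ultimately have eR: "ended R d w1" using IH unfolding drawable_below_def by blast
  have "drawable (L \<union> ?M \<union> R)"
  proof (rule bundle_drawable[OF b eL eR LK(2)])
    show "R \<inter> ?M = {}" "L \<inter> R = {}" unfolding R_def by blast+
    show "\<not> adj u w" if "u \<in> L" "w \<in> R" for u w using nadj that .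
    show "\<not> exposed u" if "u \<in> ?M" for u using bundle_not_exposed[OF b that] .
  qed
  moreover have "L \<union> ?M \<union> R = K" unfolding R_def using LK(1) MK by blast
  ultimately show ?thesis by simp
qed

lemma drawable_hexagon:
  assumes IH: "drawable_below (card K)" and K: "closed_but {} K"
    and h: "hexagon a0 b0 c0 d0 e0 f0" "a0 \<in> K"
  shows "drawable K"
proof (rule closed_bundle[OF K h])
  fix D p a d w0 w1
  assume b: "path_bundle D p a d w0 w1" "a \<in> K"
    "\<And>w x. \<lbrakk>adj w d; adj w x; adj x a\<rbrakk> \<Longrightarrow> w \<in> D"
    "\<And>y y'. \<lbrakk>adj (p w0) y; adj y y'; adj y' w1; y \<noteq> a; y \<noteq> w0; y' \<noteq> d; y' \<noteq> p w1\<rbrakk> \<Longrightarrow> False"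
  show ?thesis by (rule drawable_bundle[OF IH K b])
qed

lemma drawable_below_all: "drawable_below m"
proof (induction m)
  case 0
  then show ?case by (simp add: drawable_below_def)
next
  case (Suc m)
  have IH: "drawable_below (card K)" if "card K < Suc m" for K :: "'a set"
    using Suc that unfolding drawable_below_def by auto
  have "drawable K" if "card K < Suc m" "closed_but {} K" for K
    using drawable_hexagon[OF IH[OF that(1)] that(2)] drawable_no_hexagon[OF IH[OF that(1)] that(2)]
      drawable_empty by blast
  then show ?case
    unfolding drawable_below_def using legged_step[OF IH] ended_step[OF IH] by blast
qed

theorem drawable_core: "drawable core"
  using drawable_below_all[of "Suc (card core)"] unfolding drawable_below_def closed_but_def by blast

section \<open>Putting the leaves back\<close>

lemma leaf_neighbour:
  assumes "leaf u"
  obtains v where "\<And>z. adj u z \<longleftrightarrow> z = v" "v \<in> core" "exposed v"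
proof -
  obtain v where v: "adj u v" "\<forall>z. adj u z \<longrightarrow> z = v" "\<exists>z. adj v z \<and> z \<noteq> u"
    using assms unfolding leaf_def by blast
  then have "v \<in> core" using core_two[OF adj_sym[OF v(1)]] by blast
  moreover have "exposed v" using exposed_iff adj_sym[OF v(1)] assms by blast
  ultimately show ?thesis using that v by blast
qed

text \<open>A leaf gets the position of its neighbour and the height \<open>gap\<close> minus that
  of the neighbour, so the two see each other with exactly the margin. Any other vertex of
  \<open>core\<close> is taken care of by the third clause of \<open>fits\<close>. Two leaves cannot
  see each other because both heights are at most \<open>gap - 10000\<close>.\<close>

theorem leaves_drawn:
  obtains A h where "\<And>u. u \<in> V \<Longrightarrow> \<bar>h u\<bar> \<le> 12100"
    "\<And>u w. adj u w \<Longrightarrow> (A u - A w)\<^sup>2 + gap \<le> h u + h w"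
    "\<And>u w. \<lbrakk>u \<in> V; w \<in> V; side u \<noteq> side w; \<not> adj u w\<rbrakk> \<Longrightarrow> h u + h w + gap \<le> (A u - A w)\<^sup>2"
proof -
  obtain A0 h0 where d: "drawn core A0 h0" using drawable_core unfolding drawable_def by blast
  have fits0: "fits A0 h0 u w" if "u \<in> core" "w \<in> core" "u \<noteq> w" for u w
    using d that unfolding drawn_def by auto
  define nb where "nb u = (SOME v. adj u v)" for u
  define A where "A u = (if leaf u then A0 (nb u) else A0 u)" for u
  define h where "h u = (if leaf u then gap - h0 (nb u) else h0 u)" for u
  have nb: "adj u z \<longleftrightarrow> z = nb u" "nb u \<in> core" "exposed (nb u)" "\<not> leaf (nb u)" if u: "leaf u" for u z
  proof -
    obtain v where v: "\<And>z. adj u z \<longleftrightarrow> z = v" "v \<in> core" "exposed v"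
      using leaf_neighbour[OF u] by blast
    have "nb u = v" unfolding nb_def by (rule some_equality) (use v(1) in auto)
    then show "adj u z \<longleftrightarrow> z = nb u" "nb u \<in> core" "exposed (nb u)" "\<not> leaf (nb u)"
      using v unfolding core_def by blast+
  qed
  have core: "u \<in> core" if "u \<in> V" "\<not> leaf u" for u using that unfolding core_def by blast
  have hb: "\<bar>h u\<bar> \<le> 12100" if "u \<in> V" for u
  proof (cases "leaf u")
    case True
    then show ?thesis using drawnD[OF d nb(2)[OF True]] nb(3)[OF True] gap by (simp add: h_def)
  next
    case False
    then show ?thesis using drawnD[OF d core[OF that False]] by (simp add: h_def)
  qed
  have leaf_core: "(if adj u w then (A u - A w)\<^sup>2 + gap \<le> h u + h w else h u + h w + gap \<le> (A u - A w)\<^sup>2)"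
    if u: "leaf u" and w: "w \<in> core" "side u \<noteq> side w" for u w
  proof -
    have wl: "A w = A0 w" "h w = h0 w" using w unfolding A_def h_def core_def by auto
    have ul: "A u = A0 (nb u)" "h u = gap - h0 (nb u)" using u unfolding A_def h_def by auto
    show ?thesis
    proof (cases "w = nb u")
      case True
      then show ?thesis using nb(1)[OF u, of w] wl ul by simp
    next
      case False
      have "side w = side (nb u)" using adj_side[of u "nb u"] nb(1)[OF u, of "nb u"] w(2) by auto
      moreover have "fits A0 h0 (nb u) w"
        using fits0[OF nb(2)[OF u] w(1)] False by simp
      ultimately have "h0 w + 2 * gap \<le> h0 (nb u) + (A0 (nb u) - A0 w)\<^sup>2"
        using nb(3)[OF u] unfolding fits_def by simp
      then show ?thesis using False nb(1)[OF u, of w] wl ul by simp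
    qed
  qed
  have main: "(if adj u w then (A u - A w)\<^sup>2 + gap \<le> h u + h w else h u + h w + gap \<le> (A u - A w)\<^sup>2)"
    if uw: "u \<in> V" "w \<in> V" "side u \<noteq> side w" for u w
  proof -
    consider "\<not> leaf u" "\<not> leaf w" | "leaf u" "\<not> leaf w" | "\<not> leaf u" "leaf w" | "leaf u" "leaf w"
      by blast
    then show ?thesis
    proof cases
      case 1
      have "u \<noteq> w" using uw(3) by blast
      then have "fits A0 h0 u w" using fits0 core uw 1 by blast
      then show ?thesis using 1 uw(3) by (simp add: fits_def A_def h_def)
    next
      case 2
      then show ?thesis using leaf_core[OF 2(1) core[OF uw(2) 2(2)]] uw(3) by blast
    next
      case 3
      have "(if adj w u then (A w - A u)\<^sup>2 + gap \<le> h w + h u else h w + h u + gap \<le> (A w - A u)\<^sup>2)"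
        using leaf_core[OF 3(2) core[OF uw(1) 3(1)]] uw(3) by blast
      then show ?thesis
        unfolding adj_commute[of w u] power2_commute[of "A w" "A u"] add.commute[of "h w" "h u"] .
    next
      case 4
      have "\<not> adj u w" using nb(1)[OF 4(1), of w] nb(4)[OF 4(1)] 4(2) by auto
      moreover have "h u + h w + gap \<le> 0"
        using drawnD(3)[OF d nb(2,3)[OF 4(1)]] drawnD(3)[OF d nb(2,3)[OF 4(2)]] gap 4
        by (simp add: h_def)
      moreover have "0 \<le> (A u - A w)\<^sup>2" by simp
      ultimately show ?thesis by (simp only: if_False)
    qed
  qed
  show ?thesis
  proof (rule that[of h A])
    show "\<bar>h u\<bar> \<le> 12100" if "u \<in> V" for u using hb[OF that] .
    show "(A u - A w)\<^sup>2 + gap \<le> h u + h w" if "adj u w" for u w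
      using main[OF adj_V[OF that] adj_V2[OF that] adj_side[OF that]] that by simp
    show "h u + h w + gap \<le> (A u - A w)\<^sup>2"
      if "u \<in> V" "w \<in> V" "side u \<noteq> side w" "\<not> adj u w" for u w
      using main[OF that(1-3)] that(4) by simp
  qed
qed

end

section \<open>From the limit to unit disks\<close>

lemma edge_cobip:
  assumes "bipartitioned U W E" "u \<in> U \<union> W" "v \<in> U \<union> W" "u \<noteq> v"
  shows "{u, v} \<in> edges (cobip U W E) \<longleftrightarrow> (u \<in> U \<longleftrightarrow> v \<in> U) \<or> {u, v} \<in> E"
  using assms unfolding bipartitioned_def cobip_def by (auto simp: doubleton_eq_iff)

text \<open>The vertical distance is 1 - s, and the choice of \<open>r\<close> makes the linear
  terms of \<open>d\<^sup>2\<close> equal to 2 * (l / 12100) * ((x1 - x2)^2 - h1 - h2), which is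
  beyond 2 * q in absolute value. The bound \<open>gap / 48400\<close> on \<open>l\<close> makes the
  error s^2 <= 4 * l^2 at most \<open>q\<close>, so that a change of the distance by q / 2
  survives.\<close>

lemma dist_across:
  fixes l gap :: real
  assumes l: "0 < l" "l \<le> gap / 48400" and gap: "gap \<le> 1 / 8"
    and h: "\<bar>h1\<bar> \<le> 12100" "\<bar>h2\<bar> \<le> 12100" and r: "r\<^sup>2 = 2 * l / 12100"
    and d: "d = dist (r * x1, l * h1 / 12100) (r * x2, 1 - l * h2 / 12100)"
  shows "(x1 - x2)\<^sup>2 + gap \<le> h1 + h2 \<Longrightarrow> d \<le> 1 - l * gap / 24200"
    and "h1 + h2 + gap \<le> (x1 - x2)\<^sup>2 \<Longrightarrow> 1 + l * gap / 24200 \<le> d"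
proof -
  define s where "s = l * (h1 + h2) / 12100"
  define q where "q = l * gap / 12100"
  have s: "s = l / 12100 * (h1 + h2)" and q: "q = l / 12100 * gap" by (simp_all add: s_def q_def)
  have d0: "0 \<le> d" unfolding d by simp
  have "d\<^sup>2 = (r * x1 - r * x2)\<^sup>2 + (l * h1 / 12100 - (1 - l * h2 / 12100))\<^sup>2"
    unfolding d dist_Pair_Pair dist_real_def by simp
  also have "(r * x1 - r * x2)\<^sup>2 = r\<^sup>2 * (x1 - x2)\<^sup>2" by (simp add: power2_eq_square algebra_simps)
  also have "l * h1 / 12100 - (1 - l * h2 / 12100) = s - 1"
    unfolding s_def by (simp add: field_simps)
  also have "(s - 1)\<^sup>2 = 1 - 2 * s + s\<^sup>2" by (simp add: power2_eq_square algebra_simps)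
  also have "r\<^sup>2 * (x1 - x2)\<^sup>2 + (1 - 2 * s + s\<^sup>2) = 1 + 2 * (l / 12100 * (x1 - x2)\<^sup>2 - s) + s\<^sup>2"
    unfolding r by simp
  finally have d2: "d\<^sup>2 = 1 + 2 * (l / 12100 * (x1 - x2)\<^sup>2 - s) + s\<^sup>2" .
  define t where "t = l / 12100 * (x1 - x2)\<^sup>2"
  note d2 = d2[folded t_def]
  have "\<bar>h1 + h2\<bar> \<le> 24200" using h by simp
  then have "\<bar>s\<bar> \<le> 2 * l"
    unfolding s_def using l(1) mult_left_mono[of "\<bar>h1 + h2\<bar>" 24200 l] by (simp add: abs_mult)
  then have s2: "s\<^sup>2 \<le> (2 * l)\<^sup>2" using power_mono[of "\<bar>s\<bar>" "2 * l" 2] by simp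
  have "l * l \<le> l * (gap / 48400)" using l by (intro mult_left_mono) auto
  then have sq: "s\<^sup>2 \<le> q" using s2 unfolding q_def by (simp add: power2_eq_square)
  have gp: "0 < gap" using l by simp
  have q0: "0 < q" unfolding q_def using l(1) gp by simp
  have "l * gap \<le> 1 * 1" using l gap gp by (intro mult_mono) auto
  then have q1: "q \<le> 1" unfolding q_def by simp
  have qq: "l * gap / 24200 = q / 2" unfolding q_def by simp
  show "d \<le> 1 - l * gap / 24200" if a: "(x1 - x2)\<^sup>2 + gap \<le> h1 + h2"
  proof -
    have "l / 12100 * ((x1 - x2)\<^sup>2 + gap) \<le> l / 12100 * (h1 + h2)"
      using a l(1) by (intro mult_left_mono) auto
    then have "t - s \<le> - q"
      unfolding s q t_def by (simp only: distrib_left, (linarith)?)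
    then have "d\<^sup>2 \<le> 1 - q" using d2 sq by simp
    also have "\<dots> \<le> (1 - q / 2)\<^sup>2" by (simp add: power2_eq_square algebra_simps)
    finally show ?thesis unfolding qq by (rule power2_le_imp_le) (use q1 in simp)
  qed
  show "1 + l * gap / 24200 \<le> d" if a: "h1 + h2 + gap \<le> (x1 - x2)\<^sup>2"
  proof -
    have "l / 12100 * (h1 + h2 + gap) \<le> l / 12100 * (x1 - x2)\<^sup>2"
      using a l(1) by (intro mult_left_mono) auto
    then have "q \<le> t - s"
      unfolding s q t_def by (simp only: distrib_left, (linarith)?)
    then have "1 + 2 * q \<le> 1 + 2 * (t - s)" by simp
    also have "\<dots> \<le> d\<^sup>2" unfolding d2 by simp
    finally have "1 + 2 * q \<le> d\<^sup>2" .
    moreover have "(1 + q / 2)\<^sup>2 \<le> 1 + 2 * q"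
    proof -
      have "q * q \<le> q * 1" using q0 q1 by (intro mult_left_mono) auto
      then show ?thesis using q0 by (simp add: power2_eq_square algebra_simps)
    qed
    ultimately have "(1 + q / 2)\<^sup>2 \<le> d\<^sup>2" by simp
    then show ?thesis unfolding qq using d0 by (rule power2_le_imp_le)
  qed
qed

lemma unit_disk_representation:
  fixes A h :: "'a \<Rightarrow> real"
  assumes bip: "bipartitioned U W E" and gap: "0 < gap" "gap \<le> 1 / 8" and q: "q \<le> gap / 24200"
    and h: "\<And>u. u \<in> U \<union> W \<Longrightarrow> \<bar>h u\<bar> \<le> 12100"
    and adj: "\<And>u w. \<lbrakk>u \<in> U; w \<in> W; {u, w} \<in> E\<rbrakk> \<Longrightarrow> (A u - A w)\<^sup>2 + gap \<le> h u + h w"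
    and nadj: "\<And>u w. \<lbrakk>u \<in> U; w \<in> W; {u, w} \<notin> E\<rbrakk> \<Longrightarrow> h u + h w + gap \<le> (A u - A w)\<^sup>2"
  shows "\<forall>\<^sub>F \<Lambda> in at_right (0::real).
    \<exists>\<Delta>'\<in>{0<..<1/3}. \<exists>g :: 'a \<Rightarrow> real \<times> real.
      UDG_representation (cobip U W E) g \<and>
      g ` U \<subseteq> {0..\<Delta>'} \<times> {-\<Lambda>..\<Lambda>} \<and>
      g ` W \<subseteq> {0..\<Delta>'} \<times> {1 - \<Lambda>..1 + \<Lambda>} \<and>
      (\<forall>u\<in>U. \<forall>w\<in>W. dist (g u) (g w) = 1 \<or> \<bar>dist (g u) (g w) - 1\<bar> \<ge> q * \<Lambda>)"
proof -
  have fin: "finite (U \<union> W)" and dis: "U \<inter> W = {}" using bip unfolding bipartitioned_def by auto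
  define B where "B = (\<Sum>u\<in>U \<union> W. \<bar>A u\<bar>) + 1"
  have B: "\<bar>A u\<bar> \<le> B" if "u \<in> U \<union> W" for u
    using member_le_sum[OF that abs_ge_zero fin, of A] unfolding B_def by linarith
  have B0: "0 < B" unfolding B_def by (intro add_nonneg_pos sum_nonneg) auto
  \<comment> \<open>The first bound controls the quadratic error, the second one makes the total
    width \<open>r * (2 * B)\<close> at most 1/4, which is the value of
    \<open>\<Delta>'\<close>.\<close>
  define b where "b = min (gap / 48400) (12100 / (128 * B\<^sup>2))"
  show ?thesis
  proof (rule eventually_at_rightI[of 0 b])
    show "0 < b" unfolding b_def using gap B0 by simp
    fix l :: real assume "l \<in> {0<..<b}"
    then have l: "0 < l" "l \<le> gap / 48400" "l \<le> 12100 / (128 * B\<^sup>2)" unfolding b_def by auto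
    define r where "r = sqrt (2 * l / 12100)"
    have r2: "r\<^sup>2 = 2 * l / 12100" unfolding r_def using l(1) by simp
    have r0: "0 \<le> r" unfolding r_def using l(1) by simp
    have "128 * B\<^sup>2 * l \<le> 12100" using l(3) B0 by (simp add: field_simps)
    then have "(r * (8 * B))\<^sup>2 \<le> 1\<^sup>2" unfolding power_mult_distrib r2 by simp
    then have rB: "r * (8 * B) \<le> 1" by (rule power2_le_imp_le) simp
    define y where "y u = l * h u / 12100" for u
    have y: "\<bar>y u\<bar> \<le> l" if "u \<in> U \<union> W" for u
      using mult_left_mono[OF h[OF that], of l] l(1) unfolding y_def by (simp add: abs_mult)
    have y': "- l \<le> y u" "y u \<le> l" if "u \<in> U \<union> W" for u using y[OF that] by auto
    define g where "g u = (r * (A u + B), if u \<in> U then y u else 1 - y u)" for u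
    have gx: "0 \<le> r * (A u + B)" "r * (A u + B) \<le> 1 / 4" if "u \<in> U \<union> W" for u
    proof -
      show "0 \<le> r * (A u + B)" using B[OF that] r0 by (intro mult_nonneg_nonneg) auto
      have "r * (A u + B) \<le> r * (2 * B)" using B[OF that] r0 by (intro mult_left_mono) auto
      then show "r * (A u + B) \<le> 1 / 4" using rB by simp
    qed
    have l4: "l \<le> 1 / 4" using l(2) gap by simp
    have same: "dist (g u) (g v) \<le> 1" if uv: "u \<in> U \<union> W" "v \<in> U \<union> W" "u \<in> U \<longleftrightarrow> v \<in> U" for u v
    proof -
      have "dist (g u) (g v) \<le> dist (fst (g u)) (fst (g v)) + dist (snd (g u)) (snd (g v))"
        unfolding dist_prod_def by (rule sqrt_sum_squares_le_sum) auto
      also have "\<dots> \<le> 1 / 4 + 2 * l"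
      proof (rule add_mono)
        show "dist (fst (g u)) (fst (g v)) \<le> 1 / 4"
          using gx[OF uv(1)] gx[OF uv(2)] unfolding g_def dist_real_def fst_conv abs_le_iff by linarith
        show "dist (snd (g u)) (snd (g v)) \<le> 2 * l"
          using y[OF uv(1)] y[OF uv(2)] uv(3) unfolding g_def dist_real_def by auto
      qed
      finally show ?thesis using l4 by simp
    qed
    have across: "{u, w} \<in> E \<Longrightarrow> dist (g u) (g w) \<le> 1 - l * gap / 24200"
      "{u, w} \<notin> E \<Longrightarrow> 1 + l * gap / 24200 \<le> dist (g u) (g w)" if uw: "u \<in> U" "w \<in> W" for u w
    proof -
      have "w \<notin> U" using uw dis by blast
      then have "dist (g u) (g w) = dist (r * (A u + B), l * h u / 12100) (r * (A w + B), 1 - l * h w / 12100)"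
        unfolding g_def y_def using uw by simp
      note da = dist_across[OF l(1,2) gap(2) h h r2 this]
      show "{u, w} \<in> E \<Longrightarrow> dist (g u) (g w) \<le> 1 - l * gap / 24200"
        using da(1) adj[OF uw] uw by simp
      show "{u, w} \<notin> E \<Longrightarrow> 1 + l * gap / 24200 \<le> dist (g u) (g w)"
        using da(2) nadj[OF uw] uw by simp
    qed
    have lg: "0 < l * gap / 24200" using l(1) gap(1) by simp
    have "UDG_representation (cobip U W E) g"
      unfolding UDG_representation_def
    proof (intro ballI impI)
      fix u v assume "u \<in> verts (cobip U W E)" "v \<in> verts (cobip U W E)" and ne: "u \<noteq> v"
      then have uv: "u \<in> U \<union> W" "v \<in> U \<union> W" by (auto simp: cobip_def)
      have c: "{u, v} \<in> E \<longleftrightarrow> dist (g u) (g v) \<le> 1" if "u \<in> U" "v \<in> W" for u v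
        using across[OF that] lg by fastforce
      consider "u \<in> U \<longleftrightarrow> v \<in> U" | "u \<in> U" "v \<in> W" "v \<notin> U" | "u \<in> W" "v \<in> U" "u \<notin> U"
        using uv by blast
      then show "{u, v} \<in> edges (cobip U W E) \<longleftrightarrow> dist (g u) (g v) \<le> 1"
        unfolding edge_cobip[OF bip uv ne]
        using same[OF uv] c[of u v] c[of v u] by cases (auto simp: insert_commute dist_commute)
    qed
    moreover have "g ` U \<subseteq> {0..1 / 4} \<times> {-l..l}"
      using gx y' unfolding g_def by auto
    moreover have "g ` W \<subseteq> {0..1 / 4} \<times> {1 - l..1 + l}"
    proof (rule image_subsetI)
      fix w assume "w \<in> W"
      then have "w \<in> U \<union> W" "w \<notin> U" using dis by auto
      then show "g w \<in> {0..1 / 4} \<times> {1 - l..1 + l}"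
        using gx[of w] y'[of w] unfolding g_def by auto
    qed
    moreover have "\<forall>u\<in>U. \<forall>w\<in>W. dist (g u) (g w) = 1 \<or> \<bar>dist (g u) (g w) - 1\<bar> \<ge> q * l"
    proof (intro ballI disjI2)
      fix u w assume uw: "u \<in> U" "w \<in> W"
      have "q * l \<le> gap / 24200 * l" using q l(1) by (intro mult_right_mono) auto
      then have "q * l \<le> l * gap / 24200" by (simp add: mult.commute)
      then show "\<bar>dist (g u) (g w) - 1\<bar> \<ge> q * l" using across[OF uw] by (cases "{u, w} \<in> E") auto
    qed
    ultimately show "\<exists>\<Delta>'\<in>{0<..<1/3}. \<exists>g :: 'a \<Rightarrow> real \<times> real.
      UDG_representation (cobip U W E) g \<and>
      g ` U \<subseteq> {0..\<Delta>'} \<times> {-l..l} \<and> g ` W \<subseteq> {0..\<Delta>'} \<times> {1 - l..1 + l} \<and>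
      (\<forall>u\<in>U. \<forall>w\<in>W. dist (g u) (g w) = 1 \<or> \<bar>dist (g u) (g w) - 1\<bar> \<ge> q * l)"
      by (intro bexI[of _ "1/4"] exI[of _ g]) auto
  qed
qed

section \<open>From the excluded induced subgraphs to the locales\<close>

lemma contains_induced_embedding:
  assumes adj: "\<And>u v. adj u v \<longleftrightarrow> {u, v} \<in> edges G"
    and V: "\<And>u v. adj u v \<Longrightarrow> u \<in> verts G"
    and f: "inj_on f (verts H)" "\<forall>i\<in>verts H. \<forall>j\<in>verts H. adj (f i) (f j) \<longleftrightarrow> {i, j} \<in> edges H"
    and H: "\<forall>i\<in>verts H. \<exists>j\<in>verts H. {i, j} \<in> edges H"
  shows "contains_induced G H"
proof -
  have "f ` verts H \<subseteq> verts G" using V f(2) H by blast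
  moreover have "graph_iso H (induced_subgraph G (f ` verts H))"
    unfolding graph_iso_def induced_subgraph_def
    using f adj by (intro exI[of _ f]) (auto simp: bij_betw_def)
  ultimately show ?thesis unfolding contains_induced_def by blast
qed

lemma no_isolated_list:
  assumes "verts H = {0..<n}" "edges H = (\<lambda>(i, j). {i, j}) ` set es"
    and "list_all (\<lambda>i. list_ex (\<lambda>(p, q). i = p \<or> i = q) es) [0..<n]"
    and "list_all (\<lambda>(p, q). p < n \<and> q < n) es"
  shows "\<forall>i\<in>verts H. \<exists>j\<in>verts H. {i, j} \<in> edges H"
proof
  fix i assume "i \<in> verts H"
  then have "list_ex (\<lambda>(p, q). i = p \<or> i = q) es"
    using assms(1,3) unfolding list_all_iff by simp
  then obtain p q where pq: "(p, q) \<in> set es" "i = p \<or> i = q"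
    unfolding list_ex_iff by blast
  then have "p \<in> verts H" "q \<in> verts H" using assms(1,4) by (auto simp: list_all_iff)
  moreover have "{p, q} \<in> edges H" "{q, p} \<in> edges H"
    using pq(1) assms(2) by (auto simp: insert_commute)
  ultimately show "\<exists>j\<in>verts H. {i, j} \<in> edges H" using pq(2) by blast
qed

lemma no_isolated:
  "n > 0 \<Longrightarrow> \<forall>i\<in>verts (cycle_graph n). \<exists>j\<in>verts (cycle_graph n). {i, j} \<in> edges (cycle_graph n)"
  "\<forall>i\<in>verts S333. \<exists>j\<in>verts S333. {i, j} \<in> edges S333"
  "\<forall>i\<in>verts C6_3c. \<exists>j\<in>verts C6_3c. {i, j} \<in> edges C6_3c"
  "\<forall>i\<in>verts C6_3nc. \<exists>j\<in>verts C6_3nc. {i, j} \<in> edges C6_3nc"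
  "\<forall>i\<in>verts C6_2l2. \<exists>j\<in>verts C6_2l2. {i, j} \<in> edges C6_2l2"
proof -
  show "\<forall>i\<in>verts (cycle_graph n). \<exists>j\<in>verts (cycle_graph n). {i, j} \<in> edges (cycle_graph n)" if "n > 0"
  proof
    fix i assume "i \<in> verts (cycle_graph n)"
    then show "\<exists>j\<in>verts (cycle_graph n). {i, j} \<in> edges (cycle_graph n)"
      using that by (intro bexI[of _ "(i + 1) mod n"]) (auto simp: cycle_graph_def)
  qed
  show "\<forall>i\<in>verts S333. \<exists>j\<in>verts S333. {i, j} \<in> edges S333"
    by (rule no_isolated_list[where n = 10 and
          es = "[(0,1), (1,2), (2,3), (0,4), (4,5), (5,6), (0,7), (7,8), (8,9)]"])
      (simp add: S333_def, simp add: S333_def insert_commute, code_simp+)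
  show "\<forall>i\<in>verts C6_3c. \<exists>j\<in>verts C6_3c. {i, j} \<in> edges C6_3c"
    by (rule no_isolated_list[where n = 9 and
          es = "[(0,1), (1,2), (2,3), (3,4), (4,5), (0,5), (0,6), (1,7), (2,8)]"])
      (simp add: C6_3c_def, simp add: C6_3c_def edges_cycle_graph_6 insert_commute, code_simp+)
  show "\<forall>i\<in>verts C6_3nc. \<exists>j\<in>verts C6_3nc. {i, j} \<in> edges C6_3nc"
    by (rule no_isolated_list[where n = 9 and
          es = "[(0,1), (1,2), (2,3), (3,4), (4,5), (0,5), (0,6), (2,7), (4,8)]"])
      (simp add: C6_3nc_def, simp add: C6_3nc_def edges_cycle_graph_6 insert_commute, code_simp+)
  show "\<forall>i\<in>verts C6_2l2. \<exists>j\<in>verts C6_2l2. {i, j} \<in> edges C6_2l2"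
    by (rule no_isolated_list[where n = 10 and
          es = "[(0,1), (1,2), (2,3), (3,4), (4,5), (0,5), (0,6), (6,7), (1,8), (8,9)]"])
      (simp add: C6_2l2_def, simp add: C6_2l2_def edges_cycle_graph_6 insert_commute, code_simp+)
qed

theorem theorem22:
  fixes U W :: "'a set" and E :: "'a set set" and n :: nat
  assumes "(U, W, E) \<in> class_X_star"
    and "card (U \<union> W) = n"
  shows "\<forall>\<^sub>F \<Lambda> in at_right (0::real).
    \<exists>\<Delta>'\<in>{0<..<1/3}. \<exists>g :: 'a \<Rightarrow> real \<times> real.
      UDG_representation (cobip U W E) g \<and>
      g ` U \<subseteq> {0..\<Delta>'} \<times> {-\<Lambda>..\<Lambda>} \<and>
      g ` W \<subseteq> {0..\<Delta>'} \<times> {1 - \<Lambda>..1 + \<Lambda>} \<and>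
      (\<forall>u\<in>U. \<forall>w\<in>W. dist (g u) (g w) = 1 \<or>
         \<bar>dist (g u) (g w) - 1\<bar> \<ge> 1 / (64 ^ 4 * 200 * (real n)\<^sup>2) * \<Lambda>)"
proof -
  have bip: "bipartitioned U W E" and X: "bip U W E \<in> class_X"
    using assms(1) unfolding class_X_star_def by auto
  have fin: "finite (U \<union> W)" and dis: "U \<inter> W = {}"
    and E: "E \<subseteq> {{u, w} | u w. u \<in> U \<and> w \<in> W}" using bip unfolding bipartitioned_def by auto
  define adj where "adj u v \<longleftrightarrow> {u, v} \<in> E" for u v
  define side where "side u \<longleftrightarrow> u \<in> U" for u
  have adjD: "u \<in> U \<union> W" "side u \<noteq> side v" if "adj u v" for u v
  proof -
    obtain x y where "{u, v} = {x, y}" "x \<in> U" "y \<in> W" using \<open>adj u v\<close> E unfolding adj_def by blast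
    then show "u \<in> U \<union> W" "side u \<noteq> side v"
      using dis unfolding side_def by (auto simp: doubleton_eq_iff)
  qed
  interpret B: bipartite_graph "U \<union> W" adj side
    by unfold_locales (use fin adjD in \<open>auto simp: adj_def insert_commute\<close>)
  have emb: "contains_induced (bip U W E) H"
    if H: "B.embeds H" "\<forall>i\<in>verts H. \<exists>j\<in>verts H. {i, j} \<in> edges H" for H
  proof -
    obtain f where "inj_on f (verts H)"
      "\<forall>i\<in>verts H. \<forall>j\<in>verts H. adj (f i) (f j) \<longleftrightarrow> {i, j} \<in> edges H"
      using H(1) unfolding B.embeds_def by blast
    then show ?thesis
      using H(2) adjD(1) by (intro contains_induced_embedding[of adj]) (auto simp: adj_def bip_def)
  qed
  interpret X: X_graph "U \<union> W" adj side
  proof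
    show "\<not> B.embeds (cycle_graph m)" if "m \<ge> 3" "m \<noteq> 6" for m
      using X emb[of "cycle_graph m"] no_isolated(1)[of m] that unfolding class_X_def by auto
  qed (use X emb no_isolated(2-5) in \<open>unfold class_X_def, blast\<close>)+
  obtain idx where idx: "inj_on idx (U \<union> W)" "idx ` (U \<union> W) = {0..<n}"
    using ex_bij_betw_finite_nat[OF fin] assms(2) unfolding bij_betw_def by blast
  define pos where "pos u = (if u \<in> U \<union> W then real (idx u) / (real n + 1) else 0)" for u
  \<comment> \<open>The positions \<open>pos\<close> have distance at least 1 / (n + 1), so
    \<open>2 * gap\<close> leaves room; the factor 8 gives \<open>gap \<le> 1 / 8\<close>, also for
    \<open>n = 0\<close>.\<close>
  define gap where "gap = 1 / (8 * (real n + 1)\<^sup>2)"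
  have "1 \<le> (real n + 1)\<^sup>2" by (rule one_le_power) simp
  then have gap: "0 < gap" "gap \<le> 1 / 8"
    unfolding gap_def by (simp_all add: divide_le_eq)
  interpret D: X_drawing "U \<union> W" adj side gap pos "\<lambda>v. \<exists>u. adj v u \<and> B.leaf u"
  proof
    show "0 < gap" "gap \<le> 1 / 8" by (rule gap)+
    fix u
    have "idx u < n" if "u \<in> U \<union> W" using idx(2) that by fastforce
    then show "0 \<le> pos u" "pos u \<le> 1" unfolding pos_def by auto
  next
    fix u w assume uw: "u \<in> U \<union> W" "w \<in> U \<union> W" "u \<noteq> w"
    have "idx u \<noteq> idx w" using idx(1) uw by (auto simp: inj_on_def)
    then have "1 \<le> \<bar>real (idx u) - real (idx w)\<bar>" by linarith
    then have "1\<^sup>2 \<le> (real (idx u) - real (idx w))\<^sup>2" by (intro square_mono_dist) auto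
    moreover have "pos u - pos w = (real (idx u) - real (idx w)) / (real n + 1)"
      unfolding pos_def using uw by (simp add: diff_divide_distrib)
    ultimately show "2 * gap \<le> (pos u - pos w)\<^sup>2"
      unfolding gap_def by (simp add: power_divide frac_le)
  qed simp
  have q: "1 / (64 ^ 4 * 200 * (real n)\<^sup>2) \<le> gap / 24200"
  \<comment> \<open>For \<open>n = 0\<close> the left-hand side is 0 by the convention for division
    by zero. Otherwise n + 1 <= 2 * n, and 8 * 24200 * 4 is far below 64^4 * 200.\<close>
  proof (cases "n = 0")
    case True
    then show ?thesis using gap by simp
  next
    case False
    then have "(real n + 1)\<^sup>2 \<le> (2 * real n)\<^sup>2" by (intro power_mono) auto
    then have "(real n + 1)\<^sup>2 \<le> 4 * (real n)\<^sup>2" by (simp add: power_mult_distrib)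
    moreover have scale: "8 * x * 24200 \<le> 64 ^ 4 * 200 * y" if "x \<le> 4 * y" "0 \<le> y" for x y :: real
      using that by simp
    ultimately have "8 * (real n + 1)\<^sup>2 * 24200 \<le> 64 ^ 4 * 200 * (real n)\<^sup>2"
      by (intro scale) auto
    then have "1 / (64 ^ 4 * 200 * (real n)\<^sup>2) \<le> 1 / (8 * (real n + 1)\<^sup>2 * 24200)"
      by (intro divide_left_mono) (use False in auto)
    then show ?thesis unfolding gap_def by simp
  qed
  show ?thesis
  proof (rule D.leaves_drawn)
    fix A h :: "'a \<Rightarrow> real"
    assume Ah: "\<And>u. u \<in> U \<union> W \<Longrightarrow> \<bar>h u\<bar> \<le> 12100"
    "\<And>u w. adj u w \<Longrightarrow> (A u - A w)\<^sup>2 + gap \<le> h u + h w"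
    "\<And>u w. \<lbrakk>u \<in> U \<union> W; w \<in> U \<union> W; side u \<noteq> side w; \<not> adj u w\<rbrakk> \<Longrightarrow>
      h u + h w + gap \<le> (A u - A w)\<^sup>2"
    show ?thesis
    proof (rule unit_disk_representation[OF bip gap q Ah(1)])
      show "(A u - A w)\<^sup>2 + gap \<le> h u + h w" if "{u, w} \<in> E" for u w
        using Ah(2) that unfolding adj_def by blast
      show "h u + h w + gap \<le> (A u - A w)\<^sup>2" if "u \<in> U" "w \<in> W" "{u, w} \<notin> E" for u w
        using Ah(3)[of u w] that dis unfolding adj_def side_def by blast
    qed
  qed
qed

end
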